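(* Let $N^{(1/2)}_{\{\,\}}$ be the field on non-oriented edges defined by $N^{(1/2)}_{\{x,y\}}=N^{(1/2)}_{x,y}+N^{(1/2)}_{y,x}$, and let $\hat{\mathcal L}_{1/2}=(\hat{\mathcal L}_{1/2}^x)_{x\in X}$ be the occupation field of the Poissonian loop ensemble $\mathcal L_{1/2}$ of intensity $\frac12\mu$. i) For any even network $k$, $$P\bigl(N^{(1/2)}_{\{\,\}}=k\bigr)=\sqrt{\det(I-P)}\ \frac{\prod_{x\in X}(2k_x)!}{\prod_{x\in X}2^{k_x}k_x!\ \prod_{\{x,y\}\in E}k_{\{x,y\}}!}\ \prod_{\{x,y\}\in E}\bigl(P_{x,y}P_{y,x}\bigr)^{k_{\{x,y\}}/2}.$$ ii) For any even network $k$, and any nonnegative function $\rho$ on $X$, $$P\bigl(N^{(1/2)}_{\{\,\}}=k,\ \hat{\mathcal L}_{1/2}\in(\rho,\rho+d\rho)\bigr)=\frac{1}{\sqrt{\det(G)}}\prod_{\{x,y\}\in E}\frac{\bigl(\sqrt{\rho_x}\,C_{x,y}\sqrt{\rho_y}\bigr)^{k_{\{x,y\}}}}{k_{\{x,y\}}!}\ \prod_{x\in X}\frac{1}{\sqrt{2\pi\rho_x}}\,e^{-\frac12\lambda_x\rho_x}\,d\rho_x .$$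
   Context: Let $\mathcal G=(X,E)$ be a finite connected graph without loop-edges or multiple edges. Let $C_{x,y}=C_{y,x}\ge 0$ be conductances indexed by the edges (with $C_{x,y}=0$ if $\{x,y\}\notin E$) and let $\kappa_x\ge 0$, $x\in X$, be a killing measure. Put $\lambda_x=\sum_yC_{x,y}+\kappa_x$, and assume that the energy $\mathcal E(f,f)=\frac12\sum_{x,y}C_{x,y}(f(x)-f(y))^2+\sum_x\kappa_xf(x)^2$ is positive definite. The symmetric Green function $G=(G_{x,y})_{x,y\in X}$ associated with $\mathcal E$ is the inverse of the matrix with entries $\lambda_x1_{x=y}-C_{x,y}$. Let $P_{x,y}=C_{x,y}/\lambda_x$ be the transition matrix, and $I$ the identity matrix. Loop measure $\mu$. A discrete based loop of length $n\ge 2$ is a sequence $(\xi_1,\dots,\xi_n)$ in $X$ with $\{\xi_i,\xi_{i+1}\}\in E$ for all $1\le i\le n$, where $\xi_{n+1}=\xi_1$. A non-trivial discrete loop is an equivalence class of such sequences under cyclic shift. Its $\mu$-measure is $\frac1m\prod_{i=1}^nP_{\xi_i,\xi_{i+1}}$, where $m$ is its multiplicity (the largest integer $m$ such that the sequence is the $m$-fold repetition of a shorter based loop; $m=1$ if aperiodic). The measure $\mu$ on continuous time loops is obtained by attaching to the successive points of a discrete loop independent exponential holding times of mean $1$; moreover, for each vertex $x$, the trivial one-point loops at $x$ are given the holding time measure (of infinite mass) with density $\frac{e^{-t}}{t}$ on $(0,\infty)$. For $\alpha>0$, $\mathcal L_\alpha$ denotes the Poisson process of loops with intensity $\alpha\mu$.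 Its occupation field $\hat{\mathcal L}_\alpha^x$ is the total time spent at $x$ by the loops of $\mathcal L_\alpha$, normalized (divided) by $\lambda_x$. For an oriented edge $(x,y)$, $N^{(\alpha)}_{x,y}$ is the total number of jumps from $x$ to $y$ made by the loops of $\mathcal L_\alpha$. An even network is a family $k=(k_{\{x,y\}})_{\{x,y\}\in E}$ of nonnegative integers attached to the non-oriented edges such that, for every $x\in X$, $k_x=\frac12\sum_{y:\{x,y\}\in E}k_{\{x,y\}}$ is an integer. Convention: $0^0=1$.
   Formalization: In ii) the displayed density is proved for twice the occupation field, 2·L̂_{1/2}, instead of L̂_{1/2}, because with the stated normalization the printed formula is off by this factor (already on a one-vertex graph). *)

theory Defs
  imports "HOL-Probability.Probability"
begin

text \<open>The vertex set is the finite type \<^typ>\<open>'v\<close>. A simple graph on it is given by its set of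
  two-element edges.\<close>

definition simple_graph :: "'v set set \<Rightarrow> bool" where
  "simple_graph E \<longleftrightarrow> (\<forall>e\<in>E. card e = 2)"

definition connected_graph :: "'v set set \<Rightarrow> bool" where
  "connected_graph E \<longleftrightarrow> (\<forall>x y. (x, y) \<in> {(a, b). {a, b} \<in> E}\<^sup>*)"

text \<open>Evaluation of a symmetric function of two vertices at a non-oriented edge.\<close>

definition unord :: "('v \<Rightarrow> 'v \<Rightarrow> 'b) \<Rightarrow> 'v set \<Rightarrow> 'b" where
  "unord f e = (THE r. \<exists>x y. e = {x, y} \<and> r = f x y)"

lemma unord_eq:
  assumes "f x y = f y x"
  shows "unord f {x, y} = f x y"
  unfolding unord_def by (rule the_equality) (use assms in \<open>auto simp: doubleton_eq_iff\<close>)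


definition energy :: "('v::finite \<Rightarrow> 'v \<Rightarrow> real) \<Rightarrow> ('v \<Rightarrow> real) \<Rightarrow> ('v \<Rightarrow> real) \<Rightarrow> real" where
  "energy C \<kappa> f = 1/2 * (\<Sum>x\<in>UNIV. \<Sum>y\<in>UNIV. C x y * (f x - f y)^2) + (\<Sum>x\<in>UNIV. \<kappa> x * (f x)^2)"

definition total_rate :: "('v::finite \<Rightarrow> 'v \<Rightarrow> real) \<Rightarrow> ('v \<Rightarrow> real) \<Rightarrow> 'v \<Rightarrow> real" where
  "total_rate C \<kappa> x = (\<Sum>y\<in>UNIV. C x y) + \<kappa> x"

definition transition :: "('v::finite \<Rightarrow> 'v \<Rightarrow> real) \<Rightarrow> ('v \<Rightarrow> real) \<Rightarrow> real^'v^'v" where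
  "transition C \<kappa> = (\<chi> x y. C x y / total_rate C \<kappa> x)"

definition green :: "('v::finite \<Rightarrow> 'v \<Rightarrow> real) \<Rightarrow> ('v \<Rightarrow> real) \<Rightarrow> real^'v^'v" where
  "green C \<kappa> = matrix_inv (\<chi> x y. (if x = y then total_rate C \<kappa> x else 0) - C x y)"


text \<open>Cyclically consecutive pairs, and the class of a sequence under cyclic shift.\<close>

definition cyclic_steps :: "'b list \<Rightarrow> ('b \<times> 'b) list" where
  "cyclic_steps xs = zip xs (rotate1 xs)"

definition cyc :: "'b list \<Rightarrow> 'b list set" where
  "cyc xs = range (\<lambda>n. rotate n xs)"

lemma cyc_self: "xs \<in> cyc xs"
  unfolding cyc_def by (rule range_eqI[of _ _ 0]) simp

text \<open>A representative of such a class; every function applied to it below is invariant under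
  cyclic shift (in law, for the independent holding times).\<close>

definition rep :: "'b list set \<Rightarrow> 'b list" where
  "rep c = (SOME xs. xs \<in> c)"

definition based_loop :: "'v set set \<Rightarrow> 'v list \<Rightarrow> bool" where
  "based_loop E xs \<longleftrightarrow> 2 \<le> length xs \<and> (\<forall>(a, b) \<in> set (cyclic_steps xs). {a, b} \<in> E)"

definition discrete_loops :: "'v set set \<Rightarrow> 'v list set set" where
  "discrete_loops E = cyc ` {xs. based_loop E xs}"

definition multiplicity_loop :: "'v list \<Rightarrow> nat" where
  "multiplicity_loop xs = Max {m. \<exists>ys. xs = concat (replicate m ys)}"

definition discrete_weight :: "real^'v^'v \<Rightarrow> 'v list set \<Rightarrow> real" where
  "discrete_weight P c =
     1 / real (multiplicity_loop (rep c)) * (\<Prod>(a, b)\<leftarrow>cyclic_steps (rep c). P $ a $ b)"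


text \<open>A continuous time loop is a class, under cyclic shift, of sequences of pairs
  (point, holding time). Sequences of length one are the trivial one-point loops.\<close>

definition attach_times :: "'v list \<Rightarrow> (nat \<Rightarrow> real) \<Rightarrow> ('v \<times> real) list set" where
  "attach_times xs t = cyc (zip xs (map t [0..<length xs]))"

definition skeleton :: "'v set set \<Rightarrow> 'v list \<Rightarrow> bool" where
  "skeleton E xs \<longleftrightarrow> length xs = 1 \<or> based_loop E xs"

definition cloops :: "'v set set \<Rightarrow> ('v \<times> real) list set set" where
  "cloops E = {cyc w | w. skeleton E (map fst w) \<and> (\<forall>p\<in>set w. 0 < snd p)}"

text \<open>The sigma-algebra is the quotient one: the finest making the class maps from the Borel
  spaces of holding times measurable.\<close>

definition cloop_sets :: "'v set set \<Rightarrow> ('v \<times> real) list set set set" where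
  "cloop_sets E = {A. A \<subseteq> cloops E \<and>
     (\<forall>xs. skeleton E xs \<longrightarrow>
        {t \<in> space (PiM {..<length xs} (\<lambda>_. borel)). attach_times xs t \<in> A}
          \<in> sets (PiM {..<length xs} (\<lambda>_. borel :: real measure)))}"

definition loop_mass ::
  "'v::finite set set \<Rightarrow> real^'v^'v \<Rightarrow> ('v \<times> real) list set set \<Rightarrow> ennreal" where
  "loop_mass E P A =
     (\<Sum>x\<in>UNIV. emeasure (density lborel (\<lambda>t. ennreal (indicator {0<..} t * (exp (- t) / t))))
        {t. cyc [(x, t)] \<in> A})
   + (\<integral>\<^sup>+ c. ennreal (discrete_weight P c) *
        emeasure (PiM {..<length (rep c)} (\<lambda>_. density lborel (exponential_density 1)))
          {t \<in> space (PiM {..<length (rep c)} (\<lambda>_. borel)). attach_times (rep c) t \<in> A}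
      \<partial>count_space (discrete_loops E))"

definition loop_measure :: "'v::finite set set \<Rightarrow> real^'v^'v \<Rightarrow> ('v \<times> real) list set measure" where
  "loop_measure E P = measure_of (cloops E) (cloop_sets E) (loop_mass E P)"

lemma sigma_algebra_cloop_sets: "sigma_algebra (cloops E) (cloop_sets E)"
proof (rule sigma_algebra_iff2[THEN iffD2], intro conjI ballI allI impI)
  show "cloop_sets E \<subseteq> Pow (cloops E)" by (auto simp: cloop_sets_def)
  show "{} \<in> cloop_sets E" by (simp add: cloop_sets_def)
next
  have pos: "attach_times xs t \<in> cloops E \<longleftrightarrow> (\<forall>i<length xs. 0 < t i)"
    if "skeleton E xs" for xs t
  proof
    assume "attach_times xs t \<in> cloops E"
    then obtain w where w: "cyc (zip xs (map t [0..<length xs])) = cyc w" "\<forall>p\<in>set w. 0 < snd p"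
      by (auto simp: cloops_def attach_times_def)
    have "zip xs (map t [0..<length xs]) \<in> cyc w"
      unfolding w(1)[symmetric] by (rule cyc_self)
    then obtain n where n: "zip xs (map t [0..<length xs]) = rotate n w" unfolding cyc_def by blast
    have "set (zip xs (map t [0..<length xs])) = set w" unfolding n by simp
    moreover have "(xs ! i, t i) \<in> set (zip xs (map t [0..<length xs]))" if "i < length xs" for i
      using that by (auto simp: set_zip)
    ultimately show "\<forall>i<length xs. 0 < t i" using w(2) by fastforce
  next
    assume "\<forall>i<length xs. 0 < t i"
    then show "attach_times xs t \<in> cloops E" using that
      unfolding cloops_def attach_times_def
      by (intro CollectI exI[of _ "zip xs (map t [0..<length xs])"]) (auto simp: set_zip)
  qed
  have full: "{t \<in> space (PiM {..<length xs} (\<lambda>_. borel)). attach_times xs t \<in> cloops E}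
      \<in> sets (PiM {..<length xs} (\<lambda>_. borel :: real measure))" if "skeleton E xs" for xs
  proof -
    have "{t \<in> space (PiM {..<length xs} (\<lambda>_. borel)). \<forall>i\<in>{..<length xs}. 0 < t i}
      \<in> sets (PiM {..<length xs} (\<lambda>_. borel :: real measure))"
      by measurable
    then show ?thesis by (simp add: pos[OF that] Ball_def)
  qed
  fix A assume A: "A \<in> cloop_sets E"
  show "cloops E - A \<in> cloop_sets E" unfolding cloop_sets_def
  proof (intro CollectI conjI allI impI)
    fix xs assume xs: "skeleton E xs"
    let ?N = "PiM {..<length xs} (\<lambda>_. borel :: real measure)"
    have "{t \<in> space ?N. attach_times xs t \<in> A} \<in> sets ?N"
      using A xs by (auto simp: cloop_sets_def)
    from sets.Diff[OF full[OF xs] this]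
    show "{t \<in> space ?N. attach_times xs t \<in> cloops E - A} \<in> sets ?N"
      by (rule back_subst[where P = "\<lambda>S. S \<in> sets ?N"]) auto
  qed auto
next
  fix A :: "nat \<Rightarrow> _" assume A: "range A \<subseteq> cloop_sets E"
  show "(\<Union>i. A i) \<in> cloop_sets E" unfolding cloop_sets_def
  proof (intro CollectI conjI allI impI)
    show "(\<Union>i. A i) \<subseteq> cloops E" using A by (fastforce simp: cloop_sets_def)
    fix xs assume xs: "skeleton E xs"
    let ?N = "PiM {..<length xs} (\<lambda>_. borel :: real measure)"
    have "{t \<in> space ?N. attach_times xs t \<in> A i} \<in> sets ?N" for i
      using A xs by (auto simp: cloop_sets_def)
    then have "(\<Union>i. {t \<in> space ?N. attach_times xs t \<in> A i}) \<in> sets ?N" by blast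
    then show "{t \<in> space ?N. attach_times xs t \<in> (\<Union>i. A i)} \<in> sets ?N"
      by (rule back_subst[where P = "\<lambda>S. S \<in> sets ?N"]) auto
  qed
qed

lemma space_loop_measure: "space (loop_measure E P) = cloops E"
  unfolding loop_measure_def by (rule space_measure_of) (auto simp: cloop_sets_def)

lemma sets_loop_measure: "sets (loop_measure E P) = cloop_sets E"
  unfolding loop_measure_def by (rule sigma_algebra.sets_measure_of_eq[OF sigma_algebra_cloop_sets])

lemma emeasure_loop_measure:
  assumes "A \<in> cloop_sets E"
  shows "emeasure (loop_measure E P) A = loop_mass E P A"
proof (rule emeasure_measure_of_sigma[OF sigma_algebra_cloop_sets _ _ assms, of "loop_mass E P",
      folded loop_measure_def])
  show "positive (cloop_sets E) (loop_mass E P)"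
    by (simp add: positive_def loop_mass_def)
  show "countably_additive (cloop_sets E) (loop_mass E P)"
  proof (rule countably_additiveI)
    fix A :: "nat \<Rightarrow> ('a \<times> real) list set set"
    assume A: "range A \<subseteq> cloop_sets E" and dA: "disjoint_family A"
    have one: "{t. cyc [(x, t)] \<in> A i} \<in> sets borel" for x i
    proof -
      let ?N = "PiM {..<length [x]} (\<lambda>_. borel :: real measure)"
      have 1: "{t \<in> space ?N. attach_times [x] t \<in> A i} \<in> sets ?N"
        using A unfolding cloop_sets_def skeleton_def by (auto simp: image_subset_iff)
      have 2: "(\<lambda>t. \<lambda>j\<in>{..<length [x]}. t) \<in> measurable borel ?N"
        by (intro measurable_restrict) auto
      from measurable_sets[OF 2 1] show ?thesis
        by (rule back_subst[where P = "\<lambda>S. S \<in> sets borel"])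
           (auto simp: attach_times_def space_PiM restrict_def split: if_splits)
    qed
    have rep: "rep c \<in> c" if "c \<in> discrete_loops E" for c
      using that unfolding rep_def discrete_loops_def by (auto intro: someI cyc_self)
    have st: "cyclic_steps (rotate1 xs) = rotate1 (cyclic_steps xs)" for xs :: "'a list"
    proof (cases xs)
      case (Cons a as)
      then show ?thesis
        using zip_append[of as "tl (as @ [a])" "[a]" "[hd (as @ [a])]"]
        by (cases as) (auto simp: cyclic_steps_def)
    qed (simp add: cyclic_steps_def)
    have sk: "skeleton E (rep c)" if c: "c \<in> discrete_loops E" for c
    proof -
      obtain xs n where xs: "based_loop E xs" "rep c = rotate n xs"
        using c rep[OF c] by (auto simp: discrete_loops_def cyc_def)
      have "set (cyclic_steps (rotate n xs)) = set (cyclic_steps xs)"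
        by (induction n) (auto simp: st)
      then show ?thesis using xs by (auto simp: skeleton_def based_loop_def)
    qed
    let ?D = "\<lambda>x. density lborel (\<lambda>t. ennreal (indicator {0<..} t * (exp (- t) / t)))"
    let ?E = "\<lambda>c. PiM {..<length (rep c)} (\<lambda>_. density lborel (exponential_density 1))"
    let ?N = "\<lambda>c. PiM {..<length (rep c)} (\<lambda>_. borel :: real measure)"
    let ?S = "\<lambda>c B. {t \<in> space (?N c). attach_times (rep c) t \<in> B}"
    have two: "?S c (A i) \<in> sets (?N c)" if "c \<in> discrete_loops E" for c i
      using A sk[OF that] by (auto simp: cloop_sets_def)
    have setsE: "sets (?E c) = sets (?N c)" for c by (intro sets_PiM_cong) auto
    have a: "(\<Sum>i. emeasure (?D x) {t. cyc [(x, t)] \<in> A i})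
        = emeasure (?D x) {t. cyc [(x, t)] \<in> (\<Union>i. A i)}" for x
    proof -
      have "(\<Sum>i. emeasure (?D x) {t. cyc [(x, t)] \<in> A i})
          = emeasure (?D x) (\<Union>i. {t. cyc [(x, t)] \<in> A i})"
        using one dA by (intro suminf_emeasure) (auto simp: disjoint_family_on_def disjoint_iff)
      then show ?thesis by (simp add: UN_iff Collect_ex_eq)
    qed
    have b: "(\<Sum>i. emeasure (?E c) (?S c (A i))) = emeasure (?E c) (?S c (\<Union>i. A i))"
      if "c \<in> discrete_loops E" for c
    proof -
      have "(\<Sum>i. emeasure (?E c) (?S c (A i))) = emeasure (?E c) (\<Union>i. ?S c (A i))"
        using two[OF that] dA
        by (intro suminf_emeasure) (auto simp: disjoint_family_on_def disjoint_iff setsE)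
      also have "(\<Union>i. ?S c (A i)) = ?S c (\<Union>i. A i)" by auto
      finally show ?thesis .
    qed
    have "(\<Sum>i. loop_mass E P (A i)) =
      (\<Sum>i. \<Sum>x\<in>UNIV. emeasure (?D x) {t. cyc [(x, t)] \<in> A i}) +
      (\<Sum>i. \<integral>\<^sup>+c. ennreal (discrete_weight P c) * emeasure (?E c) (?S c (A i))
          \<partial>count_space (discrete_loops E))"
      unfolding loop_mass_def by (rule suminf_add[symmetric]) auto
    also have "(\<Sum>i. \<Sum>x\<in>UNIV. emeasure (?D x) {t. cyc [(x, t)] \<in> A i})
       = (\<Sum>x\<in>UNIV. emeasure (?D x) {t. cyc [(x, t)] \<in> (\<Union>i. A i)})"
      by (subst suminf_sum) (simp_all only: a summableI)
    also have "(\<Sum>i. \<integral>\<^sup>+c. ennreal (discrete_weight P c) * emeasure (?E c) (?S c (A i))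
          \<partial>count_space (discrete_loops E))
       = (\<integral>\<^sup>+c. ennreal (discrete_weight P c) * emeasure (?E c) (?S c (\<Union>i. A i))
          \<partial>count_space (discrete_loops E))"
      by (subst nn_integral_suminf[symmetric]) (auto intro!: nn_integral_cong simp: b)
    finally show "(\<Sum>i. loop_mass E P (A i)) = loop_mass E P (\<Union>i. A i)"
      by (simp add: loop_mass_def)
  qed
qed

definition loop_time :: "'v \<Rightarrow> ('v \<times> real) list set \<Rightarrow> real" where
  "loop_time x l = (\<Sum>p\<leftarrow>rep l. if fst p = x then snd p else 0)"

definition loop_jumps :: "'v \<Rightarrow> 'v \<Rightarrow> ('v \<times> real) list set \<Rightarrow> nat" where
  "loop_jumps x y l = count_list (cyclic_steps (map fst (rep l))) (x, y)"


text \<open>A Poisson process is represented by its random counting measure \<open>\<Phi>\<close>, so that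
  summing a quantity over the points of the process is integrating it against \<open>\<Phi> \<omega>\<close>.\<close>

definition poisson_process :: "'w measure \<Rightarrow> 'l measure \<Rightarrow> ('w \<Rightarrow> 'l measure) \<Rightarrow> bool" where
  "poisson_process M \<nu> \<Phi> \<longleftrightarrow>
     prob_space M \<and>
     (\<forall>\<omega>\<in>space M. sets (\<Phi> \<omega>) = sets \<nu> \<and>
        (\<forall>A\<in>sets \<nu>. emeasure (\<Phi> \<omega>) A \<in> insert \<infinity> (range of_nat))) \<and>
     (\<forall>A\<in>sets \<nu>. (\<lambda>\<omega>. emeasure (\<Phi> \<omega>) A) \<in> borel_measurable M) \<and>
     (\<forall>A\<in>sets \<nu>. emeasure \<nu> A < \<infinity> \<longrightarrow>
        (\<forall>n. measure M {\<omega>\<in>space M. emeasure (\<Phi> \<omega>) A = of_nat n}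
               = measure \<nu> A ^ n / fact n * exp (- measure \<nu> A))) \<and>
     (\<forall>A\<in>sets \<nu>. emeasure \<nu> A = \<infinity> \<longrightarrow> (AE \<omega> in M. emeasure (\<Phi> \<omega>) A = \<infinity>)) \<and>
     (\<forall>F. finite F \<and> F \<subseteq> sets \<nu> \<and> disjoint F \<longrightarrow>
        prob_space.indep_vars M (\<lambda>_. borel) (\<lambda>A \<omega>. emeasure (\<Phi> \<omega>) A) F)"

definition loop_ensemble ::
  "'w measure \<Rightarrow> 'v::finite set set \<Rightarrow> ('v \<Rightarrow> 'v \<Rightarrow> real) \<Rightarrow> ('v \<Rightarrow> real) \<Rightarrow> real
     \<Rightarrow> ('w \<Rightarrow> ('v \<times> real) list set measure) \<Rightarrow> bool" where
  "loop_ensemble M E C \<kappa> \<alpha> L \<longleftrightarrow>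
     poisson_process M (scale_measure (ennreal \<alpha>) (loop_measure E (transition C \<kappa>))) L"

text \<open>With holding times of mean one and one-point loops of density \<open>exp (- t) / t\<close>, the occupation
  field at intensity \<open>1/2\<close> has the law of half the square of the Gaussian field of covariance \<open>green\<close>.
  A density built from the factors \<open>exp (- \<lambda> \<rho> / 2) / sqrt (2 * pi * \<rho>)\<close> is that of the square
  itself, i.e. of twice the occupation field; e.g. on a single vertex \<open>occupation\<close> is
  Gamma distributed with shape \<open>1/2\<close> and rate \<open>\<lambda>\<close>, not \<open>\<lambda> / 2\<close>.\<close>

definition occupation ::
  "('v::finite \<Rightarrow> 'v \<Rightarrow> real) \<Rightarrow> ('v \<Rightarrow> real) \<Rightarrow> ('v \<times> real) list set measure \<Rightarrow> 'v \<Rightarrow> ennreal" where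
  "occupation C \<kappa> \<Lambda> x = (\<integral>\<^sup>+ l. ennreal (loop_time x l) \<partial>\<Lambda>) / ennreal (total_rate C \<kappa> x)"

definition jumps :: "('v \<times> real) list set measure \<Rightarrow> 'v \<Rightarrow> 'v \<Rightarrow> ennreal" where
  "jumps \<Lambda> x y = (\<integral>\<^sup>+ l. of_nat (loop_jumps x y l) \<partial>\<Lambda>)"

definition edge_jumps :: "('v \<times> real) list set measure \<Rightarrow> 'v set \<Rightarrow> ennreal" where
  "edge_jumps \<Lambda> = unord (\<lambda>x y. jumps \<Lambda> x y + jumps \<Lambda> y x)"


text \<open>Only the values of a network on the edges are relevant. The truncating division in
  \<open>half_degree\<close> is exact for even networks.\<close>

definition even_network :: "'v::finite set set \<Rightarrow> ('v set \<Rightarrow> nat) \<Rightarrow> bool" where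
  "even_network E k \<longleftrightarrow> (\<forall>x. even (\<Sum>y\<in>{y. {x, y} \<in> E}. k {x, y}))"

definition half_degree :: "'v::finite set set \<Rightarrow> ('v set \<Rightarrow> nat) \<Rightarrow> 'v \<Rightarrow> nat" where
  "half_degree E k x = (\<Sum>y\<in>{y. {x, y} \<in> E}. k {x, y}) div 2"

end

theory Submission
  imports Defs
begin

text \<open>
  The Laplace functional of the Poisson process turns the joint transform of the edge counts and of
  the occupation field into a sum over loops, that is, into \<open>exp (\<Sum>n. trace (Q ^ n) / (2 n))\<close> for a tilted
  transition matrix \<open>Q\<close>, hence into \<open>(det (I - Q)) powr (- 1/2)\<close>. This is also a Gaussian integral of
  \<open>exp (\<Sum>e. s e * C e * \<phi> x * \<phi> y)\<close>. Expanding that exponential into a power series in the \<open>s e\<close> and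
  averaging over the signs of \<open>\<phi>\<close> leaves exactly the even networks, and the substitution
  \<open>\<rho> = \<phi>\<^sup>2\<close> gives the claimed density. Writing a count \<open>n\<close> as \<open>exp (- n)\<close> and a field value \<open>\<rho>\<close> as
  \<open>exp (- \<rho>)\<close> makes these transforms the moments of a law on a cube, which determine it.
  Part i) is the total mass of the density, a product of even Gaussian moments.
\<close>

subsection \<open>Symmetric matrices and orthogonal invariance of Lebesgue measure\<close>

text \<open>Only integer exponents are needed in the transforms: the moment of order
  \<open>j\<close> of the coded law corresponds to the tilt \<open>s e = exp (- j e)\<close> of the
  edges and to raising the rate at \<open>x\<close> by \<open>2 * m x\<close>. The coding also
  absorbs infinite values, because \<open>nexp\<close> sends them to 0. Finiteness of the counts and
  of the field, and the nullity of odd networks, then need no argument of their own: they follow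
  from equality with a law that does not charge such points. The obstacle is convergence. The trace
  series needs eigenvalues in the open interval (-1, 1), not merely below 1. The two-sided bound
  comes from applying positivity of the energy to the absolute value of a function, since the
  conductances are nonnegative and the tilts are at most 1. The one-point loops supply the factor
  \<Prod>(1 + \<theta> x) that turns det (I - Q) into the determinant of a precision matrix;
  intensity 1/2 supplies the square root of the Gaussian integral. Nearly all interchanges concern
  nonnegative terms. The exponential series at a fixed field is the signed one, and there absolute
  summability is used.\<close>

lemma symmetric_matrix_inner:
  fixes A :: "real^'n^'n"
  assumes "transpose A = A"
  shows "x \<bullet> (A *v y) = (A *v x) \<bullet> y"
  using assms by (metis dot_lmul_matrix transpose_matrix_vector)

text \<open>First-order condition at a maximum: for small \<open>t\<close> a linear term cannot be
  dominated by a quadratic one unless it vanishes.\<close>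

lemma linear_bound_imp_zero:
  fixes b K :: real
  assumes "\<And>t. 2 * t * b \<le> t\<^sup>2 * K"
  shows "b = 0"
proof (rule ccontr)
  assume "b \<noteq> 0"
  define K' where "K' = \<bar>K\<bar> + 1"
  have K': "K' > 0" "K \<le> K'" by (auto simp: K'_def)
  \<comment> \<open>At \<open>t = b / K'\<close> the left side is twice the bound obtained with
    \<open>K'\<close> in place of \<open>K\<close>; the shift by 1 in \<open>K'\<close> keeps it
    positive for every \<open>K\<close>.\<close>
  have "2 * (b / K') * b \<le> (b / K')\<^sup>2 * K" by (rule assms)
  also have "\<dots> \<le> (b / K')\<^sup>2 * K'" by (intro mult_left_mono K') auto
  also have "\<dots> = b\<^sup>2 / K'" using K' by (simp add: power2_eq_square)
  finally have "2 * (b\<^sup>2 / K') \<le> b\<^sup>2 / K'" by (simp add: power2_eq_square)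
  moreover have "b\<^sup>2 / K' > 0" using K' \<open>b \<noteq> 0\<close> by simp
  ultimately show False by linarith
qed

text \<open>Rayleigh quotient: the quadratic form attains its maximum on the unit sphere of
  \<open>V\<close>, and a maximiser is an eigenvector. An arbitrary invariant subspace is allowed so
  that the argument can be repeated on orthogonal complements.\<close>

lemma symmetric_matrix_eigenvector:
  fixes A :: "real^'n^'n"
  assumes sym: "transpose A = A" and V: "subspace V" "\<And>x. x \<in> V \<Longrightarrow> A *v x \<in> V" "V \<noteq> {0}"
  obtains v c where "v \<in> V" "norm v = 1" "A *v v = c *\<^sub>R v"
proof -
  let ?S = "V \<inter> sphere 0 1"
  obtain u where u: "u \<in> V" "u \<noteq> 0" using V subspace_0 by blast
  have "u /\<^sub>R norm u \<in> ?S" using u V(1) by (auto simp: subspace_scale)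
  moreover have "compact ?S"
    using V(1) by (intro closed_Int_compact closed_subspace) auto
  moreover have "continuous_on ?S (\<lambda>x. x \<bullet> (A *v x))"
    by (intro continuous_intros linear_continuous_on matrix_vector_mul_linear
        bounded_linear.continuous_on[OF matrix_vector_mul_bounded_linear])
  ultimately obtain v where v: "v \<in> ?S" "\<And>x. x \<in> ?S \<Longrightarrow> x \<bullet> (A *v x) \<le> v \<bullet> (A *v v)"
    using continuous_attains_sup[of ?S "\<lambda>x. x \<bullet> (A *v x)"] by blast
  define c where "c = v \<bullet> (A *v v)"
  have nv: "v \<bullet> v = 1" "v \<in> V" using v(1) by (auto simp: norm_eq_1)
  have le: "x \<bullet> (A *v x) \<le> c * (x \<bullet> x)" if "x \<in> V" for x
  proof (cases "x = 0")
    case False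
    have "x /\<^sub>R norm x \<in> ?S" using that False V(1) by (auto simp: subspace_scale)
    from v(2)[OF this] have "(x \<bullet> (A *v x)) / (norm x)\<^sup>2 \<le> c"
      by (simp add: c_def matrix_vector_mult_scaleR power2_eq_square divide_simps mult.commute)
    then show ?thesis using False by (simp add: dot_square_norm divide_simps)
  qed simp
  \<comment> \<open>Moving from the maximiser \<open>v\<close> to \<open>v + t *\<^sub>R w\<close>
    leaves the terms of order zero equal, so the term linear in \<open>t\<close> must
    vanish.\<close>
  have orth: "w \<bullet> (A *v v) = 0" if w: "w \<in> V" "w \<bullet> v = 0" for w
  proof (rule linear_bound_imp_zero)
    fix t :: real
    have "v + t *\<^sub>R w \<in> V" using w nv V(1) by (simp add: subspace_add subspace_scale)
    from le[OF this]
    have "c + t * (v \<bullet> (A *v w)) + t * (w \<bullet> (A *v v)) + t\<^sup>2 * (w \<bullet> (A *v w)) \<le> c * (1 + t\<^sup>2 * (w \<bullet> w))"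
      using w(2) nv(1) by (simp add: matrix_vector_right_distrib matrix_vector_mult_scaleR
          inner_add_left inner_add_right c_def power2_eq_square algebra_simps inner_commute[of v w])
    moreover have "v \<bullet> (A *v w) = w \<bullet> (A *v v)"
      by (metis symmetric_matrix_inner[OF sym] inner_commute)
    ultimately show "2 * t * (w \<bullet> (A *v v)) \<le> t\<^sup>2 * (c * (w \<bullet> w) - w \<bullet> (A *v w))"
      by (simp add: algebra_simps)
  qed
  \<comment> \<open>The residual of the eigenvalue equation lies in \<open>V\<close> and is
    orthogonal to \<open>v\<close>, hence by \<open>orth\<close> it is orthogonal to
    \<open>A *v v\<close> as well, and so to itself.\<close>
  define w where "w = A *v v - c *\<^sub>R v"
  have "w \<in> V" using nv(2) V by (simp add: w_def subspace_diff subspace_scale)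
  moreover have wv: "w \<bullet> v = 0"
    using nv(1) by (simp add: w_def inner_diff_left c_def inner_commute[of "A *v v" v])
  ultimately have "w \<bullet> (A *v v) = 0" by (rule orth)
  then have "w \<bullet> (w + c *\<^sub>R v) = 0" by (simp add: w_def)
  then have "w \<bullet> w = 0" by (simp add: inner_add_right wv)
  then have "A *v v = c *\<^sub>R v" by (simp add: w_def)
  with that[of v c] nv show ?thesis by (simp add: norm_eq_1)
qed

text \<open>By symmetry the orthogonal complement in \<open>V\<close> of an eigenvector is again
  invariant, and its dimension is smaller.\<close>

lemma symmetric_matrix_eigenbasis:
  fixes A :: "real^'n^'n"
  assumes sym: "transpose A = A"
  shows "subspace V \<Longrightarrow> (\<And>x. x \<in> V \<Longrightarrow> A *v x \<in> V) \<Longrightarrow>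
    \<exists>B\<subseteq>V. pairwise orthogonal B \<and> (\<forall>b\<in>B. norm b = 1 \<and> (\<exists>c. A *v b = c *\<^sub>R b)) \<and> V \<subseteq> span B"
proof (induction "dim V" arbitrary: V rule: less_induct)
  case less
  show ?case
  proof (cases "V = {0}")
    case True
    then show ?thesis by (intro exI[of _ "{}"]) auto
  next
    case False
    obtain v c where v: "v \<in> V" "norm v = 1" "A *v v = c *\<^sub>R v"
      using symmetric_matrix_eigenvector[OF sym less.prems False] by metis
    define W where "W = {w\<in>V. orthogonal v w}"
    have W: "subspace W" "W \<subseteq> V"
      using less.prems(1) subspace_orthogonal_to_vector[of v]
      by (auto simp: W_def subspace_def orthogonal_clauses)
    have "v \<notin> W" using v(2) by (auto simp: W_def orthogonal_def)
    then have "W \<subset> V" using W v by blast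
    then have "dim W < dim V"
      using W(1) less.prems(1) by (metis dim_psubset span_eq_iff)
    moreover have "A *v x \<in> W" if "x \<in> W" for x
    proof -
      have "v \<bullet> (A *v x) = (A *v v) \<bullet> x" by (rule symmetric_matrix_inner[OF sym])
      also have "\<dots> = 0" using that v by (simp add: W_def orthogonal_def)
      finally show ?thesis using that less.prems(2) by (auto simp: W_def orthogonal_def)
    qed
    ultimately obtain B where B: "B \<subseteq> W" "pairwise orthogonal B"
      "\<forall>b\<in>B. norm b = 1 \<and> (\<exists>c. A *v b = c *\<^sub>R b)" "W \<subseteq> span B"
      using less.hyps[of W] W(1) by metis
    have "x \<in> span (insert v B)" if x: "x \<in> V" for x
    proof -
      have "x - (x \<bullet> v) *\<^sub>R v \<in> W"
        using x v less.prems(1) by (auto simp: W_def subspace_diff subspace_scale orthogonal_def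
            inner_diff_right norm_eq_1 inner_commute)
      then show ?thesis using B(4) by (auto simp: span_insert)
    qed
    then show ?thesis using B v W
      by (intro exI[of _ "insert v B"])
        (auto simp: pairwise_insert W_def orthogonal_commute subset_iff)
  qed
qed

text \<open>The columns of \<open>U\<close> are the orthonormal eigenvectors; being independent and
  spanning, there are exactly \<open>CARD('n)\<close> of them, so the index type can enumerate
  them.\<close>

lemma symmetric_matrix_diagonalization:
  fixes A :: "real^'n^'n"
  assumes sym: "transpose A = A"
  obtains U :: "real^'n^'n" and d :: "'n \<Rightarrow> real" where "orthogonal_matrix U"
    "A = U ** (\<chi> i j. if i = j then d i else 0) ** transpose U"
proof -
  obtain B where B: "pairwise orthogonal B"
    "\<And>b. b \<in> B \<Longrightarrow> norm b = 1 \<and> (\<exists>c. A *v b = c *\<^sub>R b)" "UNIV \<subseteq> span B"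
    using symmetric_matrix_eigenbasis[OF sym, of UNIV] by auto
  have "0 \<notin> B" using B(2) by force
  then have ind: "independent B" using B(1) pairwise_orthogonal_independent by blast
  have finB: "finite B" using ind independent_imp_finite by blast
  have "card B = CARD('n)"
    using ind B(3) by (metis DIM_cart DIM_real dim_UNIV dim_span_eq_card_independent mult.right_neutral span_UNIV top.extremum_uniqueI)
  then obtain b :: "'n \<Rightarrow> real^'n" where b: "bij_betw b UNIV B"
    using finB by (metis finite_class.finite_UNIV finite_same_card_bij)
  have bB: "b i \<in> B" for i using b by (auto simp: bij_betw_def)
  have "\<forall>i. \<exists>c. A *v b i = c *\<^sub>R b i" using B(2) bB by blast
  from choice[OF this] obtain d where d: "\<And>i. A *v b i = d i *\<^sub>R b i" by blast
  define U :: "real^'n^'n" where "U = (\<chi> i j. b j $ i)"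
  have col: "column i U = b i" for i by (simp add: U_def column_def vec_eq_iff)
  have "orthogonal (b i) (b j)" if "i \<noteq> j" for i j
    using B(1) bB b that by (metis bij_betw_imp_inj_on injD pairwiseD)
  then have U: "orthogonal_matrix U"
    using B(2) bB by (simp add: orthogonal_matrix_orthonormal_columns col)
  have "A ** U = U ** (\<chi> i j. if i = j then d i else 0)"
  proof -
    have "(A ** U) $ i $ j = (A *v b j) $ i" for i j
      by (simp add: matrix_matrix_mult_def matrix_vector_mult_def U_def)
    then show ?thesis
      by (simp add: vec_eq_iff d) (simp add: matrix_matrix_mult_def U_def if_distrib
          sum.delta mult.commute cong: if_cong)
  qed
  then have "A = U ** (\<chi> i j. if i = j then d i else 0) ** transpose U"
    using U by (metis matrix_mul_assoc matrix_mul_rid orthogonal_matrix_def)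
  with U show ?thesis by (rule that)
qed

text \<open>Both sides are the measure of the pairs \<open>(x, y)\<close> with \<open>y \<in> A\<close> and \<open>x + y \<in> B\<close>; with a ball for \<open>B\<close>
  this yields the uniqueness of translation invariant measures. It replaces the library's
  \<open>measure_orthogonal_image\<close>, which requires a well-ordered index type.\<close>

lemma emeasure_translation_invariant_commute:
  fixes \<mu> :: "'a::euclidean_space measure"
  assumes sets[measurable_cong]: "sets \<mu> = sets borel" and sf: "sigma_finite_measure \<mu>"
    and inv: "\<And>a. distr \<mu> borel (\<lambda>x. a + x) = \<mu>"
    and A[measurable]: "A \<in> sets borel" and B[measurable]: "B \<in> sets borel"
  shows "emeasure lborel A * emeasure \<mu> B = emeasure lborel B * emeasure \<mu> (uminus -` A)"
proof -
  interpret \<mu>: sigma_finite_measure \<mu> by (rule sf)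
  interpret pair_sigma_finite lborel \<mu> ..
  have invmu: "(\<integral>\<^sup>+x. f (a + x) \<partial>\<mu>) = (\<integral>\<^sup>+x. f x \<partial>\<mu>)" if "f \<in> borel_measurable borel" for f a
    using that by (subst (2) inv[symmetric, of a]) (auto simp: nn_integral_distr)
  have invl: "(\<integral>\<^sup>+x. f (a + x) \<partial>lborel) = (\<integral>\<^sup>+x. f x \<partial>lborel)"
    if "f \<in> borel_measurable borel" for f and a :: 'a
    using that by (subst (2) lborel_distr_plus[symmetric, of a]) (auto simp: nn_integral_distr)
  have "emeasure lborel A * emeasure \<mu> B = (\<integral>\<^sup>+y. indicator A y * (\<integral>\<^sup>+x. indicator B x \<partial>\<mu>) \<partial>lborel)"
    by (simp add: nn_integral_multc)
  also have "\<dots> = (\<integral>\<^sup>+y. (\<integral>\<^sup>+x. indicator A y * indicator B (y + x) \<partial>\<mu>) \<partial>lborel)"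
    by (intro nn_integral_cong) (subst nn_integral_cmult, auto simp: invmu)
  also have "\<dots> = (\<integral>\<^sup>+x. (\<integral>\<^sup>+y. indicator A y * indicator B (x + y) \<partial>lborel) \<partial>\<mu>)"
    by (subst Fubini') (auto simp: add.commute)
  also have "\<dots> = (\<integral>\<^sup>+x. (\<integral>\<^sup>+y. indicator A (y - x) * indicator B y \<partial>lborel) \<partial>\<mu>)"
  proof (rule nn_integral_cong)
    fix x :: 'a
    show "(\<integral>\<^sup>+y. indicator A y * indicator B (x + y) \<partial>lborel) =
      (\<integral>\<^sup>+y. indicator A (y - x) * indicator B y \<partial>lborel)"
      using invl[of "\<lambda>y. indicator A (y - x) * indicator B y" x] by simp
  qed
  also have "\<dots> = (\<integral>\<^sup>+y. (\<integral>\<^sup>+x. indicator A (y - x) * indicator B y \<partial>\<mu>) \<partial>lborel)"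
    by (subst Fubini') auto
  also have "\<dots> = (\<integral>\<^sup>+y. (\<integral>\<^sup>+x. indicator A (- x) \<partial>\<mu>) * indicator B y \<partial>lborel)"
  proof (rule nn_integral_cong)
    fix y :: 'a
    have "(\<integral>\<^sup>+x. indicator A (y - x) * indicator B y \<partial>\<mu>) = (\<integral>\<^sup>+x. indicator A (y - x) \<partial>\<mu>) * indicator B y"
      by (rule nn_integral_multc) auto
    also have "(\<integral>\<^sup>+x. indicator A (y - x) \<partial>\<mu>) = (\<integral>\<^sup>+x. indicator A (- x) \<partial>\<mu>)"
      using invmu[of "\<lambda>x. indicator A (y - x)" y] by simp
    finally show "(\<integral>\<^sup>+x. indicator A (y - x) * indicator B y \<partial>\<mu>) =
      (\<integral>\<^sup>+x. indicator A (- x) \<partial>\<mu>) * indicator B y" .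
  qed
  also have "\<dots> = (\<integral>\<^sup>+x. indicator A (- x) \<partial>\<mu>) * emeasure lborel B"
    by (subst nn_integral_cmult) auto
  also have "(\<integral>\<^sup>+x. indicator A (- x) \<partial>\<mu>) = (\<integral>\<^sup>+x. indicator (uminus -` A) x \<partial>\<mu>)"
    by (intro nn_integral_cong) (auto simp: indicator_def)
  also have "\<dots> = emeasure \<mu> (uminus -` A)"
  proof (subst nn_integral_indicator)
    have "uminus \<in> borel_measurable (borel :: 'a measure)" by simp
    from measurable_sets[OF this A] show "uminus -` A \<in> sets \<mu>" by (simp add: sets)
  qed simp
  finally show ?thesis by (simp add: mult.commute)
qed

text \<open>\<open>T\<close> is onto and turns translation by \<open>b\<close> into translation by
  \<open>T b\<close>, so the image measure is translation invariant. Norms are preserved, so it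
  agrees with Lebesgue measure on centred balls, which fixes the constant.\<close>

lemma lborel_distr_orthogonal:
  fixes T :: "'a::euclidean_space \<Rightarrow> 'a"
  assumes T: "orthogonal_transformation T"
  shows "distr lborel borel T = lborel"
proof -
  have lin: "linear T" and nT: "norm (T x) = norm x" for x
    using T by (auto simp: orthogonal_transformation)
  have [measurable]: "T \<in> borel_measurable borel"
    using lin by (intro borel_measurable_continuous_onI linear_continuous_on linear_conv_bounded_linear[THEN iffD1])
  define \<mu> where "\<mu> = distr lborel borel T"
  have sets\<mu>[measurable_cong]: "sets \<mu> = sets borel" by (simp add: \<mu>_def)
  have eball: "emeasure \<mu> (ball 0 r) = emeasure lborel (ball 0 r :: 'a set)" for r
    unfolding \<mu>_def by (subst emeasure_distr) (auto intro!: arg_cong[where f="emeasure lborel"] simp: nT)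
  have sf: "sigma_finite_measure \<mu>"
  proof
    show "\<exists>A. countable A \<and> A \<subseteq> sets \<mu> \<and> \<Union> A = space \<mu> \<and> (\<forall>a\<in>A. emeasure \<mu> a \<noteq> \<infinity>)"
    proof (intro exI conjI ballI)
      show "\<Union> (range (\<lambda>n::nat. ball (0::'a) (real n))) = space \<mu>"
        using reals_Archimedean2 by (auto simp: \<mu>_def)
      show "range (\<lambda>n::nat. ball 0 (real n)) \<subseteq> sets \<mu>" by (auto simp: sets\<mu>)
      fix a :: "'a set" assume "a \<in> range (\<lambda>n::nat. ball 0 (real n))"
      then show "emeasure \<mu> a \<noteq> \<infinity>"
        using emeasure_lborel_ball_finite by (auto simp: eball less_top)
    qed auto
  qed
  have inv: "distr \<mu> borel (\<lambda>x. a + x) = \<mu>" for a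
  proof -
    obtain b where b: "a = T b"
      using orthogonal_transformation_surj[OF T] by (metis surjD)
    have "distr \<mu> borel (\<lambda>x. a + x) = distr (distr lborel borel (\<lambda>x. b + x)) borel T"
      unfolding \<mu>_def by (subst (1 2) distr_distr) (auto simp: o_def b linear_add[OF lin])
    then show ?thesis by (simp add: \<mu>_def lborel_distr_plus)
  qed
  have fin: "emeasure lborel (ball 0 1 :: 'a set) \<noteq> \<infinity>" "emeasure lborel (ball 0 1 :: 'a set) \<noteq> 0"
    using emeasure_lborel_ball_finite[of "0::'a" 1] open_not_negligible[of "ball (0::'a) 1"]
      negligible_iff_emeasure0[of "ball (0::'a) 1"] emeasure_completion[of "ball (0::'a) 1" lborel]
    by (auto simp: less_top)
  \<comment> \<open>The unit ball has positive finite measure and can be cancelled from the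
    commutation identity. This is used once for the image measure and once for Lebesgue measure
    itself, so that the two reflections cancel.\<close>
  have eq: "emeasure \<nu> (uminus -` A) = emeasure lborel A"
    if "A \<in> sets borel" "sets \<nu> = sets borel" "sigma_finite_measure \<nu>"
      "\<And>a. distr \<nu> borel (\<lambda>x. a + x) = \<nu>"
      "emeasure \<nu> (ball 0 1) = emeasure lborel (ball 0 1 :: 'a set)" for A and \<nu> :: "'a measure"
  proof -
    have "emeasure lborel A * emeasure \<nu> (ball 0 1) = emeasure lborel (ball 0 1 :: 'a set) * emeasure \<nu> (uminus -` A)"
      using that by (intro emeasure_translation_invariant_commute) auto
    with fin show ?thesis
      unfolding that(5) by (metis ennreal_mult_cancel_left mult.commute infinity_ennreal_def)
  qed
  show ?thesis unfolding \<mu>_def[symmetric]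
  proof (rule measure_eqI)
    fix A assume "A \<in> sets \<mu>"
    then have A: "A \<in> sets borel" by (simp add: sets\<mu>)
    have A': "uminus -` A \<in> sets borel"
      using measurable_sets[of "uminus :: 'a \<Rightarrow> 'a" borel borel A] A by simp
    have "emeasure \<mu> A = emeasure lborel (uminus -` A)"
      using eq[OF A' sets\<mu> sf inv eball] by (simp add: vimage_def)
    also have "\<dots> = emeasure lborel A"
      using A by (intro eq) (auto simp: lborel_distr_plus lborel.sigma_finite_measure_axioms)
    finally show "emeasure \<mu> A = emeasure lborel A" .
  qed (simp add: sets\<mu>)
qed

subsection \<open>Gaussian integrals and traces of powers\<close>

lemma prod_Basis_vec: "(\<Prod>b\<in>(Basis :: (real^'n) set). f b) = (\<Prod>i\<in>UNIV. f (axis i 1))"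
proof -
  have eq: "(Basis :: (real^'n) set) = range (\<lambda>i. axis i 1)" by (auto simp: Basis_vec_def)
  show ?thesis unfolding eq by (subst prod.reindex) (auto simp: inj_on_def axis_eq_axis)
qed

interpretation lborel_product: product_sigma_finite "\<lambda>_ :: 'i. lborel :: real measure" ..

lemma measurable_vec_lambda_PiM [measurable]:
  "(\<lambda>g. \<chi> i. g i) \<in> PiM UNIV (\<lambda>_::'n::finite. borel :: real measure) \<rightarrow>\<^sub>M (borel :: (real^'n) measure)"
proof (subst borel_measurable_euclidean_space, rule ballI)
  fix b :: "real^'n" assume "b \<in> Basis"
  then obtain i where "b = axis i 1" by (auto simp: Basis_vec_def)
  then show "(\<lambda>g. (\<chi> i. g i) \<bullet> b) \<in> borel_measurable (PiM UNIV (\<lambda>_. borel))"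
    by (simp add: inner_axis)
qed

lemma measurable_vec_lambda [measurable (raw)]:
  assumes "\<And>i. (\<lambda>x. f x i) \<in> borel_measurable M"
  shows "(\<lambda>x. \<chi> i. (f x i :: real)) \<in> M \<rightarrow>\<^sub>M (borel :: (real^'n::finite) measure)"
proof (subst borel_measurable_euclidean_space, rule ballI)
  fix b :: "real^'n" assume "b \<in> Basis"
  then obtain i where "b = axis i 1" by (auto simp: Basis_vec_def)
  then show "(\<lambda>x. (\<chi> i. f x i) \<bullet> b) \<in> borel_measurable M"
    using assms by (simp add: inner_axis)
qed

lemma measurable_vec_nth [measurable (raw)]:
  assumes "f \<in> M \<rightarrow>\<^sub>M (borel :: (real^'n::finite) measure)"
  shows "(\<lambda>x. f x $ i) \<in> borel_measurable M"
  using borel_measurable_inner[OF assms, of "\<lambda>_. axis i 1"] by (simp add: inner_axis)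

lemma lborel_vec_eq_distr_PiM:
  "(lborel :: (real^'n::finite) measure) = distr (PiM UNIV (\<lambda>_. lborel)) borel (\<lambda>g. \<chi> i. g i)"
proof (rule lborel_eqI)
  fix l u :: "real^'n" assume lu: "\<And>b. b \<in> Basis \<Longrightarrow> l \<bullet> b \<le> u \<bullet> b"
  have le: "l $ i \<le> u $ i" for i
    using lu[of "axis i 1"] by (simp add: inner_axis axis_in_Basis_iff)
  have [measurable]: "(\<lambda>g. \<chi> i. g i) \<in> PiM UNIV (\<lambda>_. lborel :: real measure) \<rightarrow>\<^sub>M (borel :: (real^'n) measure)"
    by measurable
  have "emeasure (distr (PiM UNIV (\<lambda>_. lborel)) borel (\<lambda>g. \<chi> i. g i)) (box l u)
    = emeasure (PiM UNIV (\<lambda>_. lborel)) (PiE UNIV (\<lambda>i. {l $ i <..< u $ i}))"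
    by (subst emeasure_distr)
      (auto intro!: arg_cong[where f="emeasure _"] simp: space_PiM mem_box_cart Pi_iff PiE_iff)
  also have "\<dots> = (\<Prod>i\<in>UNIV. ennreal (u $ i - l $ i))"
    using le by (subst lborel_product.emeasure_PiM) auto
  also have "\<dots> = ennreal (\<Prod>i\<in>UNIV. u $ i - l $ i)"
    using le by (subst prod_ennreal) auto
  also have "(\<Prod>i\<in>UNIV. u $ i - l $ i) = (\<Prod>b\<in>Basis. (u - l) \<bullet> b)"
    by (simp add: prod_Basis_vec inner_axis)
  finally show "emeasure (distr (PiM UNIV (\<lambda>_. lborel)) borel (\<lambda>g. \<chi> i. g i)) (box l u)
    = ennreal (\<Prod>b\<in>Basis. (u - l) \<bullet> b)" .
qed simp

lemma nn_integral_lborel_vec: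
  fixes f :: "real^'n::finite \<Rightarrow> ennreal"
  assumes [measurable]: "f \<in> borel_measurable borel"
  shows "(\<integral>\<^sup>+x. f x \<partial>lborel) = (\<integral>\<^sup>+g. f (\<chi> i. g i) \<partial>PiM UNIV (\<lambda>_. lborel))"
  by (subst lborel_vec_eq_distr_PiM, subst nn_integral_distr) auto

lemma nn_integral_lborel_vec_prod:
  fixes f :: "'n::finite \<Rightarrow> real \<Rightarrow> ennreal"
  assumes [measurable]: "\<And>i. f i \<in> borel_measurable borel"
  shows "(\<integral>\<^sup>+x. (\<Prod>i\<in>UNIV. f i (x $ i)) \<partial>lborel) = (\<Prod>i\<in>UNIV. \<integral>\<^sup>+t. f i t \<partial>lborel)"
  by (subst nn_integral_lborel_vec) (auto simp: lborel_product.product_nn_integral_prod)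

lemma nn_integral_gaussian:
  assumes "0 < d"
  shows "(\<integral>\<^sup>+t. ennreal (exp (- (1/2) * (d * t\<^sup>2))) \<partial>lborel) = ennreal (sqrt (2 * pi / d))"
proof -
  have "(\<integral>\<^sup>+t. ennreal (exp (- (1/2) * (d * t\<^sup>2))) \<partial>lborel)
    = (\<integral>\<^sup>+t. ennreal (sqrt (2 * pi / d)) * ennreal (normal_density 0 (1 / sqrt d) t) \<partial>lborel)"
    using assms by (intro nn_integral_cong)
      (simp add: normal_density_def ennreal_mult[symmetric] power_divide real_sqrt_divide field_simps)
  also have "\<dots> = ennreal (sqrt (2 * pi / d))"
    using assms by (subst nn_integral_cmult)
      (auto simp: nn_integral_eq_integral integral_normal_density integrable_normal_density)
  finally show ?thesis .
qed

section \<open>Quadratic forms and their Gaussian integrals, by diagonalisation\<close>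

abbreviation diag :: "('n \<Rightarrow> real) \<Rightarrow> real^'n^'n" where
  "diag d \<equiv> (\<chi> i j. if i = j then d i else 0)"

lemma diag_mult_vec: "(diag d *v x) $ i = d i * x $ i"
  by (simp add: matrix_vector_mult_def if_distrib[of "\<lambda>a. a * _"] cong: if_cong)

lemma det_diag: "det (diag d) = (\<Prod>i\<in>UNIV. d i)"
  by (subst det_diagonal) auto

lemma det_orthogonal_conjugate:
  assumes "orthogonal_matrix (U :: real^'n^'n)"
  shows "det (U ** B ** transpose U) = det B"
proof -
  have "det U * det (transpose U) = 1"
    using assms by (metis det_I det_mul orthogonal_matrix_def)
  then show ?thesis by (simp add: det_mul)
qed

lemma quadratic_form_diagonalization:
  assumes A: "A = U ** diag d ** transpose (U :: real^'n^'n)"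
  shows "x \<bullet> (A *v x) = (\<Sum>i\<in>UNIV. d i * ((transpose U *v x) $ i)\<^sup>2)"
proof -
  let ?y = "transpose U *v x"
  have "x \<bullet> (A *v x) = x \<bullet> (U *v (diag d *v ?y))"
    by (simp add: A matrix_vector_mul_assoc matrix_mul_assoc del: transpose_matrix_vector)
  also have "\<dots> = ?y \<bullet> (diag d *v ?y)"
    by (simp add: dot_lmul_matrix)
  also have "\<dots> = (\<Sum>i\<in>UNIV. d i * (?y $ i)\<^sup>2)"
    unfolding inner_vec_def by (simp add: diag_mult_vec power2_eq_square algebra_simps)
  finally show ?thesis .
qed

text \<open>Exhibits a diagonal entry as a value of the form at a unit vector (column
  \<open>i\<close> of \<open>U\<close>), so that sign and size conditions on the form pass to the
  eigenvalues.\<close>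

lemma quadratic_form_eigenvector:
  assumes A: "A = U ** diag d ** transpose (U :: real^'n^'n)" and U: "orthogonal_matrix U"
  obtains x where "x \<noteq> 0" "x \<bullet> x = 1" "x \<bullet> (A *v x) = d i"
proof -
  let ?x = "U *v axis i 1"
  have Ux: "transpose U *v ?x = axis i 1"
    using U by (simp add: matrix_vector_mul_assoc orthogonal_matrix_def)
  have "?x \<bullet> ?x = (axis i 1 :: real^'n) \<bullet> axis i 1"
    using Ux by (simp add: dot_lmul_matrix[symmetric])
  then have 1: "?x \<bullet> ?x = 1" by (simp add: inner_axis)
  have "?x \<bullet> (A *v ?x) = (\<Sum>k\<in>UNIV. d k * ((axis i 1 :: real^'n) $ k)\<^sup>2)"
    by (simp only: quadratic_form_diagonalization[OF A] Ux)
  also have "\<dots> = d i"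
    by (simp add: axis_def if_distrib[of "\<lambda>a. a\<^sup>2"] if_distrib[of "\<lambda>a. _ * a"] cong: if_cong)
  finally show ?thesis using 1 by (intro that[of ?x]) auto
qed

lemma nn_integral_lborel_orthogonal:
  fixes U :: "real^'n^'n"
  assumes "orthogonal_matrix U" and [measurable]: "f \<in> borel_measurable borel"
  shows "(\<integral>\<^sup>+x. f (U *v x) \<partial>lborel) = (\<integral>\<^sup>+x. f x \<partial>lborel)"
proof -
  have T: "orthogonal_transformation ((*v) U)"
    using assms(1) by (simp add: orthogonal_transformation_matrix)
  have [measurable]: "(*v) U \<in> borel_measurable borel"
    by (intro borel_measurable_continuous_onI linear_continuous_on matrix_vector_mul_bounded_linear)
  show ?thesis
    by (subst (2) lborel_distr_orthogonal[OF T, symmetric], subst nn_integral_distr) auto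
qed

lemma posdef_det_pos:
  fixes A :: "real^'n^'n"
  assumes sym: "transpose A = A" and pos: "\<And>x. x \<noteq> 0 \<Longrightarrow> 0 < x \<bullet> (A *v x)"
  shows "0 < det A"
proof -
  obtain U d where U: "orthogonal_matrix U" and A: "A = U ** diag d ** transpose U"
    using symmetric_matrix_diagonalization[OF sym] .
  have "0 < d i" for i by (metis quadratic_form_eigenvector[OF A U] pos)
  then show ?thesis unfolding A det_orthogonal_conjugate[OF U] det_diag by (intro prod_pos) auto
qed

text \<open>Rotating by \<open>transpose U\<close> preserves Lebesgue measure and separates the
  variables into one Gaussian integral per eigenvalue.\<close>

lemma nn_integral_gaussian_posdef:
  fixes A :: "real^'n^'n"
  assumes sym: "transpose A = A" and pos: "\<And>x. x \<noteq> 0 \<Longrightarrow> 0 < x \<bullet> (A *v x)"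
  shows "(\<integral>\<^sup>+x. ennreal (exp (- (1/2) * (x \<bullet> (A *v x)))) \<partial>lborel) = ennreal (sqrt (2 * pi) ^ CARD('n) / sqrt (det A))"
proof -
  obtain U d where U: "orthogonal_matrix U" and A: "A = U ** diag d ** transpose U"
    using symmetric_matrix_diagonalization[OF sym] .
  have d: "0 < d i" for i by (metis quadratic_form_eigenvector[OF A U] pos)
  have U': "orthogonal_matrix (transpose U)" using U by simp
  have eq: "(\<integral>\<^sup>+x. ennreal (exp (- (1/2) * (x \<bullet> (A *v x)))) \<partial>lborel) =
    ennreal (\<Prod>i\<in>UNIV. sqrt (2 * pi) / sqrt (d i))"
  proof -
    have "(\<integral>\<^sup>+x. ennreal (exp (- (1/2) * (x \<bullet> (A *v x)))) \<partial>lborel)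
      = (\<integral>\<^sup>+x. (\<Prod>i\<in>UNIV. ennreal (exp (- (1/2) * (d i * ((transpose U *v x) $ i)\<^sup>2)))) \<partial>lborel)"
      by (intro nn_integral_cong)
        (simp add: quadratic_form_diagonalization[OF A] prod_ennreal exp_sum sum_distrib_left sum_negf[symmetric])
    also have "\<dots> = (\<integral>\<^sup>+x. (\<Prod>i\<in>UNIV. ennreal (exp (- (1/2) * (d i * (x $ i)\<^sup>2)))) \<partial>lborel)"
      by (rule nn_integral_lborel_orthogonal[OF U', of "\<lambda>x. \<Prod>i\<in>UNIV. ennreal (exp (- (1/2) * (d i * (x $ i)\<^sup>2)))"])
        measurable
    also have "\<dots> = (\<Prod>i\<in>UNIV. \<integral>\<^sup>+t. ennreal (exp (- (1/2) * (d i * t\<^sup>2))) \<partial>lborel)"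
      by (rule nn_integral_lborel_vec_prod) measurable
    also have "\<dots> = (\<Prod>i\<in>UNIV. ennreal (sqrt (2 * pi / d i)))"
      by (simp only: nn_integral_gaussian[OF d])
    also have "\<dots> = ennreal (\<Prod>i\<in>UNIV. sqrt (2 * pi) / sqrt (d i))"
      using d by (subst prod_ennreal) (auto simp: real_sqrt_divide less_imp_le)
    finally show ?thesis .
  qed
  have "sqrt (\<Prod>i\<in>I. d i) = (\<Prod>i\<in>I. sqrt (d i))" for I
    by (induction I rule: infinite_finite_induct) (auto simp: real_sqrt_mult)
  then have "(\<Prod>i\<in>UNIV. sqrt (2 * pi) / sqrt (d i)) = sqrt (2 * pi) ^ CARD('n) / sqrt (det A)"
    by (simp add: A det_orthogonal_conjugate[OF U] det_diag prod_dividef)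
  with eq show ?thesis by simp
qed

section \<open>Traces of powers and the logarithm of a determinant\<close>

primrec matpow :: "real^'n^'n \<Rightarrow> nat \<Rightarrow> real^'n^'n" where
  "matpow A 0 = mat 1"
| "matpow A (Suc n) = A ** matpow A n"

lemma matpow_conjugate:
  assumes "V ** U = mat 1"
  shows "U ** V = mat 1 \<Longrightarrow> matpow (U ** A ** V) n = U ** matpow A n ** V"
  using assms
proof (induction n)
  case (Suc n)
  have "matpow (U ** A ** V) (Suc n) = U ** A ** (V ** U) ** matpow A n ** V"
    unfolding matpow.simps Suc.IH[OF Suc.prems] by (simp only: matrix_mul_assoc)
  then show ?case by (simp add: Suc.prems matrix_mul_assoc)
qed simp

lemma trace_matpow_conjugate:
  assumes "V ** U = mat 1" "U ** V = mat 1"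
  shows "trace (matpow (U ** A ** V) n) = trace (matpow A n)"
proof -
  have "trace (matpow (U ** A ** V) n) = trace (V ** (U ** matpow A n))"
    by (simp add: matpow_conjugate[OF assms] trace_mul_sym[of _ V])
  then show ?thesis by (simp add: matrix_mul_assoc assms)
qed

lemma matpow_diag: "matpow (diag d) n = diag (\<lambda>i. d i ^ n)"
proof (induction n)
  case (Suc n)
  have "diag d ** diag (\<lambda>i. d i ^ n) = diag (\<lambda>i. d i * d i ^ n)"
    by (simp add: vec_eq_iff matrix_matrix_mult_def if_distrib[of "\<lambda>a. a * _"] cong: if_cong)
  then show ?case by (simp only: matpow.simps Suc power_Suc)
qed (simp add: mat_def cong: if_cong)

lemma sums_neg_ln: "\<bar>x\<bar> < 1 \<Longrightarrow> (\<lambda>n. x ^ Suc n / real (Suc n)) sums (- ln (1 - x))"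
proof -
  assume x: "\<bar>x\<bar> < 1"
  then have "(\<lambda>n. - ((- (- x)) ^ n) / real n) sums ln (1 + - x)"
    by (intro ln_series') auto
  then have "(\<lambda>n. - (- (x ^ n) / real n)) sums (- ln (1 - x))"
    using sums_minus by fastforce
  \<comment> \<open>The shifted series loses the term of index 0, whose value is
    \<open>1 / 0 = 0\<close>.\<close>
  then show ?thesis by (subst sums_Suc_iff) simp
qed

text \<open>The two-sided bound puts every eigenvalue into (-1, 1), where the series of
  \<open>- ln (1 - d i)\<close> converges; these are then added over \<open>i\<close>.\<close>

lemma sums_trace_matpow:
  fixes S :: "real^'n^'n"
  assumes sym: "transpose S = S" and bound: "\<And>x. x \<noteq> 0 \<Longrightarrow> \<bar>x \<bullet> (S *v x)\<bar> < x \<bullet> x"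
  shows "(\<lambda>n. trace (matpow S (Suc n)) / real (Suc n)) sums (- ln (det (mat 1 - S)))"
proof -
  obtain U d where U: "orthogonal_matrix U" and S: "S = U ** diag d ** transpose U"
    using symmetric_matrix_diagonalization[OF sym] .
  have d: "\<bar>d i\<bar> < 1" for i by (metis quadratic_form_eigenvector[OF S U] bound)
  have UU: "U ** transpose U = mat 1" "transpose U ** U = mat 1"
    using U by (auto simp: orthogonal_matrix_def)
  have "(mat 1 - S) *v x = (U ** (mat 1 - diag d) ** transpose U) *v x" for x
    by (simp add: S matrix_vector_mult_diff_rdistrib matrix_vector_mul_assoc[symmetric]
        matrix_vector_mult_diff_distrib del: transpose_matrix_vector)
      (simp add: matrix_vector_mul_assoc UU del: transpose_matrix_vector)
  then have "mat 1 - S = U ** (mat 1 - diag d) ** transpose U" by (simp add: matrix_eq)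
  also have "mat 1 - diag d = diag (\<lambda>i. 1 - d i)" by (simp add: vec_eq_iff mat_def)
  finally have "det (mat 1 - S) = (\<Prod>i\<in>UNIV. 1 - d i)"
    by (simp only: det_orthogonal_conjugate[OF U] det_diag)
  moreover have "ln (\<Prod>i\<in>UNIV. 1 - d i) = (\<Sum>i\<in>UNIV. ln (1 - d i))"
    using d by (intro ln_prod) (auto simp: abs_less_iff, metis less_irrefl)
  moreover have "trace (matpow S n) = (\<Sum>i\<in>UNIV. d i ^ n)" for n
    unfolding S trace_matpow_conjugate[OF UU(2,1)] by (simp add: matpow_diag trace_def)
  ultimately show ?thesis
    using sums_sum[of UNIV "\<lambda>i n. d i ^ Suc n / real (Suc n)", OF sums_neg_ln[OF d]]
    by (simp add: sum_negf sum_divide_distrib del: matpow.simps power_Suc of_nat_Suc)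
qed

subsection \<open>The Laplace functional of a Poisson process\<close>

text \<open>Extended by \<open>exp (- \<infinity>) = 0\<close>.\<close>

definition nexp :: "ennreal \<Rightarrow> real" where
  "nexp u = (if u = \<infinity> then 0 else exp (- enn2real u))"

lemma nexp_nonneg [simp]: "0 \<le> nexp u" and nexp_le_1 [simp]: "nexp u \<le> 1"
  by (auto simp: nexp_def)

lemma nexp_0 [simp]: "nexp 0 = 1" and nexp_top [simp]: "nexp top = 0"
  by (auto simp: nexp_def)

lemma nexp_ennreal: "0 \<le> r \<Longrightarrow> nexp (ennreal r) = exp (- r)"
  by (auto simp: nexp_def)

lemma nexp_of_nat: "nexp (of_nat n) = exp (- real n)"
  by (simp add: ennreal_of_nat_eq_real_of_nat nexp_ennreal)

lemma nexp_add: "nexp (u + v) = nexp u * nexp v"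
  by (cases u; cases v) (auto simp: nexp_ennreal ennreal_plus[symmetric] exp_add[symmetric] simp del: ennreal_plus)

lemma nexp_sum: "nexp (\<Sum>i\<in>I. u i) = (\<Prod>i\<in>I. nexp (u i))"
  by (induction I rule: infinite_finite_induct) (auto simp: nexp_add)

lemma nexp_of_nat_mult: "nexp (of_nat n * u) = nexp u ^ n"
  by (induction n) (auto simp: nexp_add distrib_right)

lemma nexp_eq_exp_iff: "0 \<le> r \<Longrightarrow> nexp u = exp (- r) \<longleftrightarrow> u = ennreal r"
  by (cases u) (auto simp: nexp_ennreal)

lemma nexp_less_1: "u \<noteq> 0 \<Longrightarrow> nexp u < 1"
  by (cases u) (auto simp: nexp_ennreal)

lemma measurable_nexp [measurable]: "nexp \<in> borel_measurable borel"
  unfolding nexp_def by measurable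

text \<open>Continuity along increasing sequences, including the limit \<infinity>, is what carries
  the Laplace functional from simple to general functions.\<close>

lemma tendsto_nexp_SUP:
  assumes "incseq u"
  shows "(\<lambda>i. nexp (u i)) \<longlonglongrightarrow> nexp (SUP i. u i)"
proof (cases "(SUP i. u i) = \<infinity>")
  case False
  then have fin: "(SUP i. u i) < top" unfolding infinity_ennreal_def less_top .
  have "u i < top" for i by (rule le_less_trans[OF SUP_upper fin]) auto
  then have eq: "nexp (u i) = exp (- enn2real (u i))" for i by (auto simp: nexp_def less_top)
  have "(\<lambda>i. enn2real (u i)) \<longlonglongrightarrow> enn2real (SUP i. u i)"
    using LIMSEQ_SUP[OF assms] fin by (intro tendsto_enn2real) auto
  then have "(\<lambda>i. exp (- enn2real (u i))) \<longlonglongrightarrow> exp (- enn2real (SUP i. u i))"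
    by (intro tendsto_exp tendsto_minus)
  moreover have "nexp (SUP i. u i) = exp (- enn2real (SUP i. u i))"
    using False by (simp only: nexp_def if_False)
  ultimately show ?thesis by (simp only: eq)
next
  case True
  show ?thesis unfolding True
  proof (rule LIMSEQ_I)
    fix r :: real assume "0 < r"
    define B where "B = max 0 (- ln r)"
    have "ennreal B < (SUP i. u i)" unfolding True by simp
    then obtain N where N: "ennreal B < u N" by (auto simp: less_SUP_iff)
    have "norm (nexp (u i) - nexp \<infinity>) < r" if "i \<ge> N" for i
    proof -
      have "ennreal B < u i" using N incseqD[OF assms that] by (rule less_le_trans)
      then show ?thesis
      proof (cases "u i")
        case (real x)
        have "0 \<le> B" by (simp add: B_def)
        then have "B < x" using real \<open>ennreal B < u i\<close> by (simp add: ennreal_less_iff)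
        then have "- ln r < x" by (simp add: B_def)
        then have "exp (- x) < exp (ln r)" by simp
        then show ?thesis using real \<open>0 < r\<close> by (simp add: nexp_ennreal)
      qed (use \<open>0 < r\<close> in auto)
    qed
    then show "\<exists>N. \<forall>i\<ge>N. norm (nexp (u i) - nexp \<infinity>) < r" by blast
  qed
qed

text \<open>Only the evaluations of the random measure on sets are assumed measurable; the class of
  integrands for which the claim holds is closed under scaling, sums and increasing limits.\<close>

lemma borel_measurable_nn_integral_random_measure:
  assumes sets: "\<And>\<omega>. \<omega> \<in> space M \<Longrightarrow> sets (\<Phi> \<omega>) = sets \<nu>"
    and A: "\<And>A. A \<in> sets \<nu> \<Longrightarrow> (\<lambda>\<omega>. emeasure (\<Phi> \<omega>) A) \<in> borel_measurable M"
    and f: "f \<in> borel_measurable \<nu>"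
  shows "(\<lambda>\<omega>. \<integral>\<^sup>+l. f l \<partial>\<Phi> \<omega>) \<in> borel_measurable M"
proof -
  have meas: "borel_measurable (\<Phi> \<omega>) = (borel_measurable \<nu> :: ('b \<Rightarrow> ennreal) set)" if "\<omega> \<in> space M" for \<omega>
    using measurable_cong_sets[OF sets[OF that] refl] .
  from f show ?thesis
  proof (induction f rule: borel_measurable_induct)
    case (cong f g)
    have "(\<integral>\<^sup>+l. f l \<partial>\<Phi> \<omega>) = (\<integral>\<^sup>+l. g l \<partial>\<Phi> \<omega>)" if "\<omega> \<in> space M" for \<omega>
      using cong(3) sets_eq_imp_space_eq[OF sets[OF that]] by (intro nn_integral_cong) auto
    with cong(4) show ?case by (simp cong: measurable_cong)
  next
    case (set B)
    have "(\<integral>\<^sup>+l. indicator B l \<partial>\<Phi> \<omega>) = emeasure (\<Phi> \<omega>) B" if "\<omega> \<in> space M" for \<omega>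
      using set sets[OF that] by simp
    with A[OF set] show ?case by (simp cong: measurable_cong)
  next
    case (mult u c)
    have "(\<integral>\<^sup>+l. c * u l \<partial>\<Phi> \<omega>) = c * (\<integral>\<^sup>+l. u l \<partial>\<Phi> \<omega>)" if "\<omega> \<in> space M" for \<omega>
      using mult(2) by (intro nn_integral_cmult) (simp add: meas[OF that])
    with mult(4) show ?case by (simp cong: measurable_cong)
  next
    case (add u v)
    have "(\<integral>\<^sup>+l. v l + u l \<partial>\<Phi> \<omega>) = (\<integral>\<^sup>+l. v l \<partial>\<Phi> \<omega>) + (\<integral>\<^sup>+l. u l \<partial>\<Phi> \<omega>)" if "\<omega> \<in> space M" for \<omega>
      using add.hyps by (intro nn_integral_add) (simp_all add: meas[OF that])
    with add show ?case by (simp cong: measurable_cong)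
  next
    case (seq U)
    have "(\<integral>\<^sup>+l. (SUP i. U i) l \<partial>\<Phi> \<omega>) = (SUP i. \<integral>\<^sup>+l. U i l \<partial>\<Phi> \<omega>)" if "\<omega> \<in> space M" for \<omega>
      unfolding SUP_apply
      using seq.hyps by (intro nn_integral_monotone_convergence_SUP) (simp_all add: meas[OF that])
    note eq = this
    have "(\<lambda>\<omega>. SUP i. \<integral>\<^sup>+l. U i l \<partial>\<Phi> \<omega>) \<in> borel_measurable M"
      by (intro borel_measurable_SUP seq) auto
    then show ?case by (rule measurable_cong[THEN iffD2, rotated]) (rule eq)
  qed
qed

locale poisson_random_measure =
  fixes M :: "'w measure" and \<nu> :: "'l measure" and \<Phi> :: "'w \<Rightarrow> 'l measure"
  assumes pp: "poisson_process M \<nu> \<Phi>"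
begin

sublocale prob_space M using pp by (simp add: poisson_process_def)

lemma sets_\<Phi>: "\<omega> \<in> space M \<Longrightarrow> sets (\<Phi> \<omega>) = sets \<nu>"
  and count_\<Phi>: "\<omega> \<in> space M \<Longrightarrow> A \<in> sets \<nu> \<Longrightarrow> emeasure (\<Phi> \<omega>) A \<in> insert \<infinity> (range of_nat)"
  and measurable_\<Phi>: "A \<in> sets \<nu> \<Longrightarrow> (\<lambda>\<omega>. emeasure (\<Phi> \<omega>) A) \<in> borel_measurable M"
  using pp by (auto simp: poisson_process_def)

text \<open>For finite mass this is the generating function of the Poisson law. For infinite mass
  and \<open>y\<close> nonzero the count is almost surely infinite and both sides are 0.\<close>

lemma laplace_count:
  assumes A: "A \<in> sets \<nu>" and y: "y < top"
  shows "expectation (\<lambda>\<omega>. nexp (y * emeasure (\<Phi> \<omega>) A)) = nexp (ennreal (1 - nexp y) * emeasure \<nu> A)"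
proof (cases "y = 0")
  case True
  then show ?thesis by (simp add: prob_space)
next
  case y0: False
  note [measurable] = measurable_\<Phi>[OF A]
  have q: "0 < 1 - nexp y" using nexp_less_1[OF y0] by simp
  show ?thesis
  proof (cases "emeasure \<nu> A = \<infinity>")
    case True
    then have "AE \<omega> in M. emeasure (\<Phi> \<omega>) A = \<infinity>"
      using pp A by (auto simp: poisson_process_def)
    then have "AE \<omega> in M. nexp (y * emeasure (\<Phi> \<omega>) A) = 0"
      by eventually_elim (use y0 in \<open>auto simp: ennreal_mult_top\<close>)
    then have "expectation (\<lambda>\<omega>. nexp (y * emeasure (\<Phi> \<omega>) A)) = expectation (\<lambda>\<omega>. 0)"
      by (intro integral_cong_AE) auto
    also have "\<dots> = nexp (ennreal (1 - nexp y) * emeasure \<nu> A)"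
      using True q by (simp add: ennreal_mult_top)
    finally show ?thesis .
  next
    case False
    define m where "m = measure \<nu> A"
    have em: "emeasure \<nu> A = ennreal m" using False by (simp add: m_def emeasure_eq_ennreal_measure)
    have P: "emeasure M {\<omega>\<in>space M. emeasure (\<Phi> \<omega>) A = of_nat n} = ennreal (m ^ n / fact n * exp (- m))" for n
      using pp A False by (simp add: poisson_process_def emeasure_eq_measure m_def less_top)
    \<comment> \<open>The series has no term for an infinite count; there the left side vanishes
      too, since \<open>y\<close> is nonzero.\<close>
    have pt: "ennreal (nexp (y * emeasure (\<Phi> \<omega>) A))
      = (\<Sum>n. ennreal (nexp y ^ n) * indicator {\<omega>\<in>space M. emeasure (\<Phi> \<omega>) A = of_nat n} \<omega>)"
      if \<omega>: "\<omega> \<in> space M" for \<omega>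
    proof (cases "emeasure (\<Phi> \<omega>) A = \<infinity>")
      case True
      then show ?thesis using y0 by (auto simp: ennreal_mult_top indicator_def)
    next
      case False
      then obtain N :: nat where N: "emeasure (\<Phi> \<omega>) A = of_nat N" using count_\<Phi>[OF \<omega> A] by auto
      have "(\<Sum>n. ennreal (nexp y ^ n) * indicator {\<omega>\<in>space M. emeasure (\<Phi> \<omega>) A = of_nat n} \<omega>)
        = (\<Sum>n\<in>{N}. ennreal (nexp y ^ n) * indicator {\<omega>\<in>space M. emeasure (\<Phi> \<omega>) A = of_nat n} \<omega>)"
        using \<omega> N by (intro suminf_finite) auto
      then show ?thesis using \<omega> N by (simp add: nexp_of_nat_mult mult.commute[of y])
    qed
    have "(\<integral>\<^sup>+\<omega>. ennreal (nexp (y * emeasure (\<Phi> \<omega>) A)) \<partial>M)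
      = (\<integral>\<^sup>+\<omega>. (\<Sum>n. ennreal (nexp y ^ n) * indicator {\<omega>\<in>space M. emeasure (\<Phi> \<omega>) A = of_nat n} \<omega>) \<partial>M)"
      by (intro nn_integral_cong pt)
    also have "\<dots> = (\<Sum>n. ennreal (nexp y ^ n) * emeasure M {\<omega>\<in>space M. emeasure (\<Phi> \<omega>) A = of_nat n})"
      by (subst nn_integral_suminf) (auto simp: nn_integral_cmult)
    also have "\<dots> = (\<Sum>n. ennreal (exp (- m) * ((m * nexp y) ^ n / fact n)))"
      by (simp add: P ennreal_mult'[symmetric] power_mult_distrib mult_ac)
    also have "\<dots> = ennreal (exp (- m) * exp (m * nexp y))"
      using exp_converges[of "m * nexp y"]
      by (intro suminf_ennreal_eq sums_mult) (auto simp: m_def divide_inverse mult.commute)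
    also have "exp (- m) * exp (m * nexp y) = nexp (ennreal (1 - nexp y) * emeasure \<nu> A)"
    proof -
      have "0 \<le> (1 - nexp y) * m" using q by (simp add: m_def)
      then have "nexp (ennreal (1 - nexp y) * emeasure \<nu> A) = exp (- ((1 - nexp y) * m))"
        using q by (simp only: em nexp_ennreal ennreal_mult''[symmetric] m_def measure_nonneg)
      then show ?thesis by (simp add: exp_add[symmetric] algebra_simps)
    qed
    finally show ?thesis by (subst integral_eq_nn_integral) auto
  qed
qed

text \<open>The level sets of \<open>g\<close> are disjoint, so the counts on them are independent
  and the expectation factorises into the one-set formula.\<close>

lemma laplace_simple:
  assumes g: "simple_function \<nu> g" and fin: "\<And>l. g l < top"
  shows "expectation (\<lambda>\<omega>. nexp (\<integral>\<^sup>+l. g l \<partial>\<Phi> \<omega>)) = nexp (\<integral>\<^sup>+l. ennreal (1 - nexp (g l)) \<partial>\<nu>)"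
proof -
  define A where "A y = g -` {y} \<inter> space \<nu>" for y
  let ?Y = "g ` space \<nu>"
  have Y: "finite ?Y" and A: "A y \<in> sets \<nu>" for y
    using simple_functionD[OF g] by (auto simp: A_def)
  have inj: "inj_on A ?Y" by (auto simp: inj_on_def A_def)
  have "disjoint (A ` ?Y)" by (auto simp: disjoint_def A_def)
  then have ind: "indep_vars (\<lambda>_. borel) (\<lambda>B \<omega>. emeasure (\<Phi> \<omega>) B) (A ` ?Y)"
    using pp[unfolded poisson_process_def, THEN conjunct2, THEN conjunct2, THEN conjunct2,
        THEN conjunct2, THEN conjunct2, rule_format, of "A ` ?Y"] Y A by blast
  \<comment> \<open>Independence is indexed by the level sets themselves; \<open>v\<close> recovers
    the value of \<open>g\<close> on such a set, which is unambiguous because level sets of attained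
    values are nonempty and disjoint.\<close>
  define v where "v = the_inv_into ?Y A"
  have v: "v (A y) = y" if "y \<in> ?Y" for y using that inj by (simp add: v_def the_inv_into_f_f)
  have ind': "indep_vars (\<lambda>_. borel) (\<lambda>B \<omega>. nexp (v B * emeasure (\<Phi> \<omega>) B)) (A ` ?Y)"
    by (rule indep_vars_compose2[OF ind]) measurable
  have int: "(\<integral>\<^sup>+l. g l \<partial>\<Phi> \<omega>) = (\<Sum>y\<in>?Y. y * emeasure (\<Phi> \<omega>) (A y))" if "\<omega> \<in> space M" for \<omega>
  proof -
    note eq = sets_\<Phi>[OF that] sets_eq_imp_space_eq[OF sets_\<Phi>[OF that]]
    have "simple_function (\<Phi> \<omega>) g" using g by (simp add: simple_function_def eq)
    then show ?thesis
      by (simp add: nn_integral_eq_simple_integral simple_integral_def eq A_def)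
  qed
  have "expectation (\<lambda>\<omega>. nexp (\<integral>\<^sup>+l. g l \<partial>\<Phi> \<omega>)) = expectation (\<lambda>\<omega>. \<Prod>B\<in>A ` ?Y. nexp (v B * emeasure (\<Phi> \<omega>) B))"
    by (intro Bochner_Integration.integral_cong) (auto simp: int nexp_sum prod.reindex[OF inj] v)
  also have "\<dots> = (\<Prod>B\<in>A ` ?Y. expectation (\<lambda>\<omega>. nexp (v B * emeasure (\<Phi> \<omega>) B)))"
  proof (rule indep_vars_lebesgue_integral[OF _ ind'])
    fix B assume "B \<in> A ` ?Y"
    then have [measurable]: "(\<lambda>\<omega>. emeasure (\<Phi> \<omega>) B) \<in> borel_measurable M"
      using A by (auto intro!: measurable_\<Phi>)
    show "integrable M (\<lambda>\<omega>. nexp (v B * emeasure (\<Phi> \<omega>) B))"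
      by (rule integrable_const_bound[where B=1]) auto
  qed (use Y in auto)
  also have "\<dots> = (\<Prod>y\<in>?Y. nexp (ennreal (1 - nexp y) * emeasure \<nu> (A y)))"
    using A fin by (auto simp: prod.reindex[OF inj] v laplace_count intro!: prod.cong)
  also have "\<dots> = nexp (\<Sum>y\<in>?Y. ennreal (1 - nexp y) * emeasure \<nu> (A y))"
    by (simp add: nexp_sum)
  also have "(\<Sum>y\<in>?Y. ennreal (1 - nexp y) * emeasure \<nu> (A y)) = (\<integral>\<^sup>+l. (\<Sum>y\<in>?Y. ennreal (1 - nexp y) * indicator (A y) l) \<partial>\<nu>)"
    using A by (subst nn_integral_sum) (auto simp: nn_integral_cmult)
  also have "\<dots> = (\<integral>\<^sup>+l. ennreal (1 - nexp (g l)) \<partial>\<nu>)"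
  proof (rule nn_integral_cong)
    fix l assume l: "l \<in> space \<nu>"
    then have "(\<Sum>y\<in>?Y. ennreal (1 - nexp y) * indicator (A y) l) = (\<Sum>y\<in>?Y. if y = g l then ennreal (1 - nexp y) else 0)"
      by (intro sum.cong) (auto simp: A_def indicator_def)
    then show "(\<Sum>y\<in>?Y. ennreal (1 - nexp y) * indicator (A y) l) = ennreal (1 - nexp (g l))"
      using l Y by simp
  qed
  finally show ?thesis .
qed

text \<open>Along an increasing approximation by simple functions, the left side converges by
  domination by 1, and the right side by monotone convergence of \<open>1 - nexp (g i l)\<close>,
  which needs no finiteness of the intensity.\<close>

theorem laplace_functional:
  assumes f: "f \<in> borel_measurable \<nu>"
  shows "expectation (\<lambda>\<omega>. nexp (\<integral>\<^sup>+l. f l \<partial>\<Phi> \<omega>)) = nexp (\<integral>\<^sup>+l. ennreal (1 - nexp (f l)) \<partial>\<nu>)"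
proof -
  obtain g where g: "\<And>i. simple_function \<nu> (g i)" "incseq g" "\<And>i l. g i l < top" "\<And>l. (SUP i. g i l) = f l"
    using borel_measurable_implies_simple_function_sequence'[OF f] by blast
  have gm: "g i \<in> borel_measurable \<nu>" for i using g(1) by (rule borel_measurable_simple_function)
  note meas = borel_measurable_nn_integral_random_measure[OF sets_\<Phi> measurable_\<Phi>]
  have [measurable]: "(\<lambda>\<omega>. \<integral>\<^sup>+l. g i l \<partial>\<Phi> \<omega>) \<in> borel_measurable M" "(\<lambda>\<omega>. \<integral>\<^sup>+l. f l \<partial>\<Phi> \<omega>) \<in> borel_measurable M" for i
    by (intro meas gm f; simp)+
  have incl: "incseq (\<lambda>i. g i l)" for l using g(2) by (auto simp: incseq_def le_fun_def)
  have "(\<lambda>i. expectation (\<lambda>\<omega>. nexp (\<integral>\<^sup>+l. g i l \<partial>\<Phi> \<omega>))) \<longlonglongrightarrow> expectation (\<lambda>\<omega>. nexp (\<integral>\<^sup>+l. f l \<partial>\<Phi> \<omega>))"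
  proof (rule integral_dominated_convergence[where w="\<lambda>_. 1"])
    show "AE \<omega> in M. (\<lambda>i. nexp (\<integral>\<^sup>+l. g i l \<partial>\<Phi> \<omega>)) \<longlonglongrightarrow> nexp (\<integral>\<^sup>+l. f l \<partial>\<Phi> \<omega>)"
    proof (rule AE_I2)
      fix \<omega> assume \<omega>: "\<omega> \<in> space M"
      have "g i \<in> borel_measurable (\<Phi> \<omega>)" for i
        using gm measurable_cong_sets[OF sets_\<Phi>[OF \<omega>] refl] by blast
      then have "(\<integral>\<^sup>+l. f l \<partial>\<Phi> \<omega>) = (SUP i. \<integral>\<^sup>+l. g i l \<partial>\<Phi> \<omega>)"
        unfolding g(4)[symmetric] using g(2) by (intro nn_integral_monotone_convergence_SUP)
      moreover have "incseq (\<lambda>i. \<integral>\<^sup>+l. g i l \<partial>\<Phi> \<omega>)"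
        using g(2) by (auto simp: incseq_def le_fun_def intro!: nn_integral_mono)
      ultimately show "(\<lambda>i. nexp (\<integral>\<^sup>+l. g i l \<partial>\<Phi> \<omega>)) \<longlonglongrightarrow> nexp (\<integral>\<^sup>+l. f l \<partial>\<Phi> \<omega>)"
        by (simp add: tendsto_nexp_SUP)
    qed
  qed auto
  moreover have "(\<lambda>i. nexp (\<integral>\<^sup>+l. ennreal (1 - nexp (g i l)) \<partial>\<nu>)) \<longlonglongrightarrow> nexp (\<integral>\<^sup>+l. ennreal (1 - nexp (f l)) \<partial>\<nu>)"
  proof -
    have mono: "nexp v \<le> nexp u" if "u \<le> v" for u v
      using that by (metis le_iff_add mult_left_le nexp_add nexp_le_1 nexp_nonneg)
    have inc: "incseq (\<lambda>i l. ennreal (1 - nexp (g i l)))"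
      using g(2) by (auto simp: incseq_def le_fun_def intro!: ennreal_leI mono)
    have "ennreal (1 - nexp (f l)) = (SUP i. ennreal (1 - nexp (g i l)))" for l
    proof (rule LIMSEQ_unique)
      show "(\<lambda>i. ennreal (1 - nexp (g i l))) \<longlonglongrightarrow> (SUP i. ennreal (1 - nexp (g i l)))"
        using inc by (intro LIMSEQ_SUP) (auto simp: incseq_def le_fun_def)
      show "(\<lambda>i. ennreal (1 - nexp (g i l))) \<longlonglongrightarrow> ennreal (1 - nexp (f l))"
        unfolding g(4)[symmetric] by (intro tendsto_intros tendsto_nexp_SUP incl)
    qed
    then have "(\<integral>\<^sup>+l. ennreal (1 - nexp (f l)) \<partial>\<nu>) = (SUP i. \<integral>\<^sup>+l. ennreal (1 - nexp (g i l)) \<partial>\<nu>)"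
      using gm inc by (simp add: nn_integral_monotone_convergence_SUP)
    moreover have "incseq (\<lambda>i. \<integral>\<^sup>+l. ennreal (1 - nexp (g i l)) \<partial>\<nu>)"
      using inc by (auto simp: incseq_def le_fun_def intro!: nn_integral_mono)
    ultimately show ?thesis by (simp add: tendsto_nexp_SUP)
  qed
  moreover have "expectation (\<lambda>\<omega>. nexp (\<integral>\<^sup>+l. g i l \<partial>\<Phi> \<omega>)) = nexp (\<integral>\<^sup>+l. ennreal (1 - nexp (g i l)) \<partial>\<nu>)" for i
    by (intro laplace_simple g)
  ultimately show ?thesis by (simp add: LIMSEQ_unique)
qed

end

subsection \<open>Discrete loops and traces\<close>

lemma commuting_append_concat_replicate:
  assumes "us @ vs = vs @ us" "length vs = q * length us"
  shows "vs = concat (replicate q us)"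
  using assms
proof (induction q arbitrary: vs)
  case (Suc q)
  then have "length us \<le> length vs" by simp
  then have "us = take (length us) vs"
    using Suc.prems(1) by (metis append_eq_append_conv_if)
  then obtain vs' where vs': "vs = us @ vs'" by (metis append_take_drop_id)
  with Suc have "vs' = concat (replicate q us)" by simp
  with vs' show ?case by simp
qed simp

text \<open>Rotating by \<open>d\<close> exchanges the prefix of length \<open>d\<close> with the
  rest, so invariance says that the two commute; the rest is then a power of the prefix.\<close>

lemma rotate_fixed_concat_replicate:
  assumes "rotate d xs = xs" "length xs = q * d" "0 < q"
  shows "xs = concat (replicate q (take d xs))"
proof -
  have d: "d \<le> length xs" using assms(2,3) by simp
  have rot: "rotate d (take d xs @ drop d xs) = drop d xs @ take d xs"
    using rotate_append[of "take d xs" "drop d xs"] d by simp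
  have "drop d xs = concat (replicate (q - 1) (take d xs))"
  proof (rule commuting_append_concat_replicate)
    show "take d xs @ drop d xs = drop d xs @ take d xs" using rot assms(1) by simp
    show "length (drop d xs) = (q - 1) * length (take d xs)" using assms by (simp add: diff_mult_distrib)
  qed
  then have "xs = take d xs @ concat (replicate (q - 1) (take d xs))" by (metis append_take_drop_id)
  with assms(3) show ?thesis by (cases q) auto
qed

lemma rotate_concat_replicate:
  "rotate (length ys) (concat (replicate m ys)) = concat (replicate m ys)"
proof (cases m)
  case (Suc k)
  have "concat (replicate k ys) @ ys = ys @ concat (replicate k ys)"
    by (induction k) auto
  then show ?thesis by (simp add: Suc rotate_append)
qed simp

text \<open>The least period \<open>p\<close> of the rotation is the number of distinct rotations,
  and the multiplicity is the quotient of the length by \<open>p\<close>. This lets the weight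
  \<open>1 / m\<close> of a class be shared equally among its representatives as one over the
  length.\<close>

lemma card_cyc:
  assumes "xs \<noteq> []"
  shows "multiplicity_loop xs * card (cyc xs) = length xs"
proof -
  \<comment> \<open>Every period is a multiple of the least one, since a nonzero remainder would be
    a smaller period.\<close>
  define p where "p = (LEAST p. 0 < p \<and> rotate p xs = xs)"
  have "0 < p \<and> rotate p xs = xs"
    unfolding p_def by (rule LeastI[of _ "length xs"]) (use assms in simp)
  then have p: "0 < p" "rotate p xs = xs" by auto
  have pq: "rotate (q * p) xs = xs" for q
    by (induction q) (auto simp: p(2) rotate_rotate[symmetric])
  have per: "p dvd k" if "rotate k xs = xs" for k
  proof -
    have "rotate (k mod p) xs = rotate (k mod p) (rotate (k div p * p) xs)" by (simp only: pq)
    also have "\<dots> = xs" using that by (simp add: rotate_rotate)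
    finally have "\<not> 0 < k mod p"
      using not_less_Least[of "k mod p" "\<lambda>p. 0 < p \<and> rotate p xs = xs"] p(1) by (auto simp: p_def[symmetric])
    then show ?thesis by auto
  qed
  have rot_mod: "rotate k xs = rotate (k mod p) xs" for k
  proof -
    have "rotate k xs = rotate (k mod p) (rotate (k div p * p) xs)" by (simp only: rotate_rotate mod_div_mult_eq)
    then show ?thesis by (simp only: pq)
  qed
  have "cyc xs = (\<lambda>j. rotate j xs) ` {..<p}"
    unfolding cyc_def using rot_mod p(1) by (auto simp: image_iff) (metis mod_less_divisor lessThan_iff)
  moreover have "inj_on (\<lambda>j. rotate j xs) {..<p}"
  proof (rule linorder_inj_onI)
    fix i j assume ij: "i < j" "i \<in> {..<p}" "j \<in> {..<p}"
    show "rotate i xs \<noteq> rotate j xs"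
    proof
      assume "rotate i xs = rotate j xs"
      then have "rotate (p - i) (rotate i xs) = rotate (p - i) (rotate j xs)" by simp
      then have "rotate (p - i + j) xs = xs" using ij p(2) by (simp add: rotate_rotate)
      then have "p dvd p - i + j" by (rule per)
      then have "p dvd p + (j - i)" using ij by simp
      then have "p dvd j - i" by (simp only: dvd_add_triv_left_iff)
      then show False using ij by (auto dest: dvd_imp_le)
    qed
  qed auto
  ultimately have card: "card (cyc xs) = p" by (simp add: card_image)
  have "p dvd length xs" by (rule per) simp
  then obtain m where m: "length xs = m * p" by (metis dvd_def mult.commute)
  have m0: "0 < m" using m assms by (cases m) auto
  have "multiplicity_loop xs = m" unfolding multiplicity_loop_def
  proof (rule Max_eqI)
    \<comment> \<open>A repetition of \<open>ys\<close> is fixed by rotation through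
      \<open>length ys\<close>, so \<open>p\<close> divides \<open>length ys\<close> and no more
      than \<open>m\<close> copies fit.\<close>
    have le: "k \<le> m" if "xs = concat (replicate k ys)" for k ys
    proof -
      have "p dvd length ys" using that rotate_concat_replicate[of ys k] by (intro per) simp
      moreover have len: "length xs = k * length ys"
        using arg_cong[OF that, of length] by (simp add: length_concat sum_list_replicate)
      moreover have "length ys \<noteq> 0" using len assms by auto
      ultimately have "k * p \<le> m * p" using m by (metis dvd_imp_le gr0I mult_le_mono2)
      then show ?thesis using p(1) by simp
    qed
    then show "\<And>y. y \<in> {k. \<exists>ys. xs = concat (replicate k ys)} \<Longrightarrow> y \<le> m" by auto
    show "finite {k. \<exists>ys. xs = concat (replicate k ys)}"
      by (rule finite_subset[of _ "{..m}"]) (auto dest: le)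
    show "m \<in> {k. \<exists>ys. xs = concat (replicate k ys)}"
      using rotate_fixed_concat_replicate[OF p(2) m m0] by blast
  qed
  then show ?thesis using card m by simp
qed

lemma cyclic_steps_Cons: "cyclic_steps (x # xs) = zip (x # xs) (xs @ [x])"
  by (simp add: cyclic_steps_def)

lemma cyclic_steps_rotate1: "cyclic_steps (rotate1 xs) = rotate1 (cyclic_steps xs)"
proof (cases xs)
  case (Cons a as)
  then show ?thesis
    using zip_append[of as "tl (as @ [a])" "[a]" "[hd (as @ [a])]"]
    by (cases as) (auto simp: cyclic_steps_def)
qed (simp add: cyclic_steps_def)

lemma cyclic_steps_rotate: "cyclic_steps (rotate n xs) = rotate n (cyclic_steps xs)"
  by (induction n) (auto simp: cyclic_steps_rotate1)

lemma based_loop_rotate: "based_loop E (rotate n xs) \<longleftrightarrow> based_loop E xs"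
  by (simp add: based_loop_def cyclic_steps_rotate)

lemma cyc_eq_iff: "cyc xs = cyc ys \<longleftrightarrow> ys \<in> cyc xs"
proof
  assume "ys \<in> cyc xs"
  then obtain n where n: "ys = rotate n xs" by (auto simp: cyc_def)
  have "rotate m xs \<in> range (\<lambda>k. rotate k ys)" for m
  proof (cases "xs = []")
    case False
    \<comment> \<open>Rotation by \<open>n\<close> is undone by completing it to the full turn count
      \<open>n * length xs\<close>, a multiple of the length that is at least
      \<open>n\<close>.\<close>
    define k where "k = m + (n * length xs - n)"
    have "n \<le> n * length xs" using False by (cases xs) auto
    then have "k + n = m + n * length xs" unfolding k_def by arith
    then have "rotate k ys = rotate m (rotate (n * length xs) xs)" by (simp only: n rotate_rotate)
    also have "rotate (n * length xs) xs = xs" by (simp add: rotate_id)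
    finally show ?thesis by (metis rangeI)
  qed (simp add: n)
  then show "cyc xs = cyc ys" by (auto simp: cyc_def n rotate_rotate)
qed (use cyc_self in auto)

lemma rep_cyc: "rep (cyc xs) \<in> cyc xs"
  unfolding rep_def by (rule someI[of _ xs]) (rule cyc_self)

lemma rep_discrete_loop:
  assumes "c \<in> discrete_loops E"
  shows "cyc (rep c) = c" "based_loop E (rep c)"
proof -
  obtain xs where xs: "based_loop E xs" "c = cyc xs" using assms by (auto simp: discrete_loops_def)
  show "cyc (rep c) = c" using rep_cyc[of xs] by (simp add: xs(2)) (metis cyc_eq_iff)
  show "based_loop E (rep c)" using rep_cyc[of xs] xs by (auto simp: cyc_def based_loop_rotate)
qed

lemma prod_list_rotate: "prod_list (rotate n (xs :: 'a :: comm_monoid_mult list)) = prod_list xs"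
proof (induction n)
  case (Suc n)
  have "prod_list (rotate1 ys) = prod_list (ys :: 'a list)" for ys by (cases ys) (auto simp: mult.commute)
  with Suc show ?case by simp
qed simp

section \<open>Powers of a matrix as sums over walks, and their traces as sums over loops\<close>

lemma sum_lists_length_Suc:
  fixes f :: "'a::finite list \<Rightarrow> 'b::comm_monoid_add"
  shows "(\<Sum>xs | length xs = Suc n. f xs) = (\<Sum>x\<in>UNIV. \<Sum>xs | length xs = n. f (x # xs))"
proof -
  have "{xs :: 'a list. length xs = Suc n} = (\<lambda>(x, xs). x # xs) ` (UNIV \<times> {xs. length xs = n})"
    by (auto simp: length_Suc_conv image_iff)
  moreover have "inj_on (\<lambda>(x, xs). x # xs) (UNIV \<times> {xs :: 'a list. length xs = n})" by (auto simp: inj_on_def)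
  ultimately have "(\<Sum>xs | length xs = Suc n. f xs) = (\<Sum>(x, xs)\<in>UNIV \<times> {xs. length xs = n}. f (x # xs))"
    by (simp only: sum.reindex o_def case_prod_unfold)
  then show ?thesis by (simp add: sum.cartesian_product)
qed

lemma matpow_entry:
  fixes Q :: "real^'v^'v::finite"
  shows "matpow Q (Suc n) $ x $ y = (\<Sum>xs | length xs = n. \<Prod>(a, b)\<leftarrow>zip (x # xs) (xs @ [y]). Q $ a $ b)"
proof (induction n arbitrary: x)
  case (Suc n)
  have "matpow Q (Suc (Suc n)) $ x $ y = (\<Sum>z\<in>UNIV. Q $ x $ z * matpow Q (Suc n) $ z $ y)"
    by (subst matpow.simps(2)) (simp only: matrix_matrix_mult_def vec_lambda_beta)
  then show ?case unfolding Suc.IH by (simp add: sum_lists_length_Suc sum_distrib_left)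
qed simp

definition step_prod :: "real^'v^'v \<Rightarrow> 'v list \<Rightarrow> real" where
  "step_prod Q xs = (\<Prod>(a, b)\<leftarrow>cyclic_steps xs. Q $ a $ b)"

lemma trace_matpow:
  fixes Q :: "real^'v^'v::finite"
  shows "trace (matpow Q (Suc n)) = (\<Sum>xs | length xs = Suc n. step_prod Q xs)"
  by (simp add: trace_def matpow_entry sum_lists_length_Suc step_prod_def cyclic_steps_Cons
      del: matpow.simps)

lemma step_prod_rotate: "step_prod Q (rotate n xs) = step_prod Q xs"
  by (simp add: step_prod_def cyclic_steps_rotate rotate_map[symmetric] prod_list_rotate)

text \<open>Allows sums over based loops to be extended to all nonempty sequences, as a trace
  requires. A sequence of length one takes the step from \<open>x\<close> to \<open>x\<close>, which
  a graph without loop-edges excludes.\<close>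

lemma step_prod_eq_0:
  assumes "simple_graph E" "\<And>a b. {a, b} \<notin> E \<Longrightarrow> Q $ a $ b = 0" "xs \<noteq> []" "\<not> based_loop E xs"
  shows "step_prod Q xs = 0"
proof -
  have "\<exists>(a, b)\<in>set (cyclic_steps xs). {a, b} \<notin> E"
  proof (cases "length xs = 1")
    case True
    then obtain x where x: "xs = [x]" by (auto simp: length_Suc_conv)
    have "{x, x} \<notin> E" using assms(1) by (auto simp: simple_graph_def)
    then show ?thesis by (auto simp: x cyclic_steps_def)
  next
    case False
    then have "2 \<le> length xs" using assms(3) by (cases xs) (auto simp: Suc_le_eq)
    then show ?thesis using assms(4) by (auto simp: based_loop_def)
  qed
  then obtain a b where ab: "(a, b) \<in> set (cyclic_steps xs)" "{a, b} \<notin> E" by blast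
  then have "0 \<in> (\<lambda>(a, b). Q $ a $ b) ` set (cyclic_steps xs)"
    using assms(2) by (intro rev_image_eqI[OF ab(1)]) simp
  then show ?thesis by (simp add: step_prod_def prod_list_zero_iff)
qed

text \<open>The step product is constant on the class, and by \<open>card_cyc\<close> the class has
  length divided by multiplicity elements.\<close>

lemma sum_cyc_weight:
  assumes c: "c \<in> discrete_loops E"
  shows "(\<Sum>xs\<in>c. step_prod Q xs / real (length xs)) = discrete_weight Q c" "finite c"
proof -
  let ?r = "rep c"
  have r: "cyc ?r = c" "based_loop E ?r" "?r \<noteq> []"
    using rep_discrete_loop[OF c] by (auto simp: based_loop_def)
  have const: "step_prod Q xs / real (length xs) = step_prod Q ?r / real (length ?r)" if "xs \<in> c" for xs
  proof -
    have "xs \<in> cyc ?r" using that r(1) by simp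
    then show ?thesis by (auto simp: cyc_def step_prod_rotate)
  qed
  have card: "real (multiplicity_loop ?r) * real (card c) = real (length ?r)"
    using card_cyc[OF r(3)] r(1) by (metis of_nat_mult)
  moreover have "real (length ?r) \<noteq> 0" using r(3) by simp
  ultimately have "card c \<noteq> 0" "multiplicity_loop ?r \<noteq> 0"
    by (metis mult_zero_left mult_zero_right of_nat_0)+
  \<comment> \<open>An infinite set has cardinality 0, so the nonzero value already gives
    finiteness.\<close>
  then show "finite c" by (metis card.infinite)
  have "(\<Sum>xs\<in>c. step_prod Q xs / real (length xs)) = real (card c) * (step_prod Q ?r / real (length ?r))"
    using const by simp
  also have "\<dots> = 1 / real (multiplicity_loop ?r) * step_prod Q ?r"
    using \<open>card c \<noteq> 0\<close> by (simp add: card[symmetric])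
  finally show "(\<Sum>xs\<in>c. step_prod Q xs / real (length xs)) = discrete_weight Q c"
    by (simp add: discrete_weight_def step_prod_def)
qed

lemma step_prod_nonneg:
  assumes "\<And>a b. 0 \<le> Q $ a $ b"
  shows "0 \<le> step_prod Q xs"
  unfolding step_prod_def using assms by (intro prod_list_nonneg) auto

text \<open>Each class weight is spread over its representatives, the double sum over classes and
  representatives is exchanged, and the resulting sum over sequences is sorted by length. One over
  the length becomes the coefficient of the trace.\<close>

lemma nn_integral_discrete_loops:
  fixes Q :: "real^'v^'v::finite"
  assumes E: "simple_graph E" and Q: "\<And>a b. {a, b} \<notin> E \<Longrightarrow> Q $ a $ b = 0" "\<And>a b. 0 \<le> Q $ a $ b"
  shows "(\<integral>\<^sup>+c. ennreal (discrete_weight Q c) \<partial>count_space (discrete_loops E))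
    = (\<Sum>n. ennreal (trace (matpow Q (Suc n)) / real (Suc n)))"
proof -
  let ?h = "\<lambda>xs. step_prod Q xs / real (length xs)"
  have h0: "0 \<le> ?h xs" for xs using step_prod_nonneg[OF Q(2)] by simp
  define f where "f = (\<lambda>(c, xs). if c \<in> discrete_loops E \<and> xs \<in> c then ennreal (?h xs) else 0)"
  have "(\<integral>\<^sup>+c. ennreal (discrete_weight Q c) \<partial>count_space (discrete_loops E))
    = (\<integral>\<^sup>+c. \<integral>\<^sup>+xs. f (c, xs) \<partial>count_space UNIV \<partial>count_space (discrete_loops E))"
  proof (rule nn_integral_cong)
    fix c assume "c \<in> space (count_space (discrete_loops E))"
    then have c: "c \<in> discrete_loops E" by simp
    have "(\<integral>\<^sup>+xs. f (c, xs) \<partial>count_space UNIV) = (\<integral>\<^sup>+xs. ennreal (?h xs) \<partial>count_space c)"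
      using c by (subst (2) nn_integral_count_space_indicator) (auto intro!: nn_integral_cong simp: f_def)
    also have "\<dots> = ennreal (discrete_weight Q c)"
      using sum_cyc_weight(1)[OF c, of Q] sum_cyc_weight(2)[OF c] h0 by (simp add: nn_integral_count_space_finite sum_ennreal)
    finally show "ennreal (discrete_weight Q c) = (\<integral>\<^sup>+xs. f (c, xs) \<partial>count_space UNIV)" ..
  qed
  also have "\<dots> = (\<integral>\<^sup>+c. \<integral>\<^sup>+xs. f (c, xs) \<partial>count_space UNIV \<partial>count_space UNIV)"
    by (rule nn_integral_count_space_eq) (auto simp: f_def)
  also have "\<dots> = (\<integral>\<^sup>+xs. \<integral>\<^sup>+c. f (c, xs) \<partial>count_space UNIV \<partial>count_space UNIV)"
    by (simp only: nn_integral_fst_count_space nn_integral_snd_count_space)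
  also have "\<dots> = (\<integral>\<^sup>+xs. (if based_loop E xs then ennreal (?h xs) else 0) \<partial>count_space UNIV)"
  proof (rule nn_integral_cong)
    fix xs :: "'v list"
    \<comment> \<open>A based loop belongs to exactly one class, so the inner sum over classes has a
      single term.\<close>
    have "c \<in> discrete_loops E \<and> xs \<in> c \<longleftrightarrow> based_loop E xs \<and> c = cyc xs" for c
    proof
      assume "c \<in> discrete_loops E \<and> xs \<in> c"
      then obtain w where w: "based_loop E w" "c = cyc w" "xs \<in> cyc w" by (auto simp: discrete_loops_def)
      then have "based_loop E xs" by (auto simp: cyc_def based_loop_rotate)
      with w show "based_loop E xs \<and> c = cyc xs" by (simp add: cyc_eq_iff)
    qed (auto simp: discrete_loops_def cyc_self)
    then have "(\<integral>\<^sup>+c. f (c, xs) \<partial>count_space UNIV)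
      = (\<integral>\<^sup>+c. (if based_loop E xs then ennreal (?h xs) else 0) * indicator {cyc xs} c \<partial>count_space UNIV)"
      by (intro nn_integral_cong) (auto simp: f_def indicator_def)
    then show "(\<integral>\<^sup>+c. f (c, xs) \<partial>count_space UNIV) = (if based_loop E xs then ennreal (?h xs) else 0)"
      by (simp add: nn_integral_cmult)
  qed
  also have "\<dots> = (\<integral>\<^sup>+xs. \<integral>\<^sup>+n. (if length xs = Suc n then ennreal (?h xs) else 0) \<partial>count_space UNIV \<partial>count_space UNIV)"
  proof (rule nn_integral_cong)
    fix xs :: "'v list"
    have "(\<integral>\<^sup>+n. (if length xs = Suc n then ennreal (?h xs) else 0) \<partial>count_space UNIV)
      = (\<integral>\<^sup>+n. (if xs = [] then 0 else ennreal (?h xs)) * indicator {length xs - 1} n \<partial>count_space UNIV)"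
      by (intro nn_integral_cong) (auto simp: indicator_def)
    also have "\<dots> = (if xs = [] then 0 else ennreal (?h xs))" by (simp add: nn_integral_cmult)
    also have "\<dots> = (if based_loop E xs then ennreal (?h xs) else 0)"
      using step_prod_eq_0[OF E Q(1), of xs] by (auto simp: based_loop_def)
    finally show "(if based_loop E xs then ennreal (?h xs) else 0)
      = (\<integral>\<^sup>+n. (if length xs = Suc n then ennreal (?h xs) else 0) \<partial>count_space UNIV)" ..
  qed
  also have "\<dots> = (\<integral>\<^sup>+n. \<integral>\<^sup>+xs. (if length xs = Suc n then ennreal (?h xs) else 0) \<partial>count_space UNIV \<partial>count_space UNIV)"
    using nn_integral_fst_count_space[of "\<lambda>(xs, n). if length xs = Suc n then ennreal (?h xs) else 0"]
      nn_integral_snd_count_space[of "\<lambda>(xs, n). if length xs = Suc n then ennreal (?h xs) else 0"] by simp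
  also have "\<dots> = (\<integral>\<^sup>+n. ennreal (trace (matpow Q (Suc n)) / real (Suc n)) \<partial>count_space UNIV)"
  proof (rule nn_integral_cong)
    fix n :: nat
    have fin: "finite {xs :: 'v list. length xs = Suc n}" using finite_lists_length_eq[of "UNIV :: 'v set"] by simp
    have "(\<integral>\<^sup>+xs. (if length xs = Suc n then ennreal (?h xs) else 0) \<partial>count_space UNIV)
      = (\<integral>\<^sup>+xs. ennreal (?h xs) \<partial>count_space {xs. length xs = Suc n})"
      by (subst (2) nn_integral_count_space_indicator) (auto intro!: nn_integral_cong)
    also have "\<dots> = ennreal (\<Sum>xs | length xs = Suc n. ?h xs)"
      by (subst nn_integral_count_space_finite[OF fin]) (rule sum_ennreal, rule h0)
    also have "(\<Sum>xs | length xs = Suc n. ?h xs) = trace (matpow Q (Suc n)) / real (Suc n)"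
      unfolding trace_matpow sum_divide_distrib by (rule sum.cong) auto
    finally show "(\<integral>\<^sup>+xs. (if length xs = Suc n then ennreal (?h xs) else 0) \<partial>count_space UNIV)
      = ennreal (trace (matpow Q (Suc n)) / real (Suc n))" .
  qed
  finally show ?thesis by (simp only: nn_integral_count_space_nat)
qed

subsection \<open>Integration against the loop measure\<close>

lemma sum_list_rotate: "sum_list (rotate n (xs :: 'a :: comm_monoid_add list)) = sum_list xs"
proof (induction n)
  case (Suc n)
  have "sum_list (rotate1 ys) = sum_list (ys :: 'a list)" for ys by (cases ys) (auto simp: add.commute)
  with Suc show ?case by simp
qed simp

lemma loop_time_cyc: "loop_time x (cyc w) = (\<Sum>p\<leftarrow>w. if fst p = x then snd p else 0)"
proof -
  obtain n where "rep (cyc w) = rotate n w" using rep_cyc[of w] by (auto simp: cyc_def)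
  then show ?thesis by (simp add: loop_time_def rotate_map[symmetric] sum_list_rotate)
qed

definition edge_count :: "'v set \<Rightarrow> 'v list \<Rightarrow> nat" where
  "edge_count e xs = length (filter (\<lambda>(a, b). {a, b} = e) (cyclic_steps xs))"

lemma edge_count_rotate: "edge_count e (rotate n xs) = edge_count e xs"
proof -
  have "length (filter p (rotate n ys)) = length (filter p ys)" for p and ys :: "('a \<times> 'a) list"
    using sum_list_rotate[of n "map (\<lambda>y. if p y then 1 else 0::nat) ys"]
    by (simp add: rotate_map sum_list_map_filter'[symmetric] sum_list_triv)
  then show ?thesis by (simp add: edge_count_def cyclic_steps_rotate)
qed

definition loop_edges :: "'v set \<Rightarrow> ('v \<times> real) list set \<Rightarrow> nat" where
  "loop_edges e l = edge_count e (map fst (rep l))"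

lemma loop_edges_cyc: "loop_edges e (cyc w) = edge_count e (map fst w)"
proof -
  obtain n where "rep (cyc w) = rotate n w" using rep_cyc[of w] by (auto simp: cyc_def)
  then show ?thesis by (simp add: loop_edges_def rotate_map[symmetric] edge_count_rotate)
qed

lemma loop_edges_doubleton:
  assumes "x \<noteq> y"
  shows "loop_edges {x, y} l = loop_jumps x y l + loop_jumps y x l"
proof -
  have "length (filter (\<lambda>(a, b). {a, b} = {x, y}) L) = count_list L (x, y) + count_list L (y, x)" for L
    using assms by (induction L) (auto simp: doubleton_eq_iff)
  then show ?thesis by (simp add: loop_edges_def edge_count_def loop_jumps_def)
qed

lemma count_list_rotate: "count_list (rotate n xs) x = count_list xs x"
proof (induction n)
  case (Suc n)
  have "count_list (rotate1 ys) x = count_list ys x" for ys by (cases ys) auto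
  with Suc show ?case by simp
qed simp

lemma loop_jumps_cyc: "loop_jumps x y (cyc w) = count_list (cyclic_steps (map fst w)) (x, y)"
proof -
  obtain n where "rep (cyc w) = rotate n w" using rep_cyc[of w] by (auto simp: cyc_def)
  then show ?thesis by (simp add: loop_jumps_def rotate_map[symmetric] cyclic_steps_rotate count_list_rotate)
qed

lemma loop_jumps_attach: "loop_jumps x y (attach_times xs t) = count_list (cyclic_steps xs) (x, y)"
  by (simp add: attach_times_def loop_jumps_cyc)

lemma loop_edges_attach: "loop_edges e (attach_times xs t) = edge_count e xs"
  by (simp add: attach_times_def loop_edges_cyc)

lemma loop_time_attach:
  "loop_time x (attach_times xs t) = (\<Sum>i<length xs. if xs ! i = x then t i else 0)"
  unfolding attach_times_def loop_time_cyc sum_list_sum_nth by (auto simp: atLeast0LessThan intro!: sum.cong)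

lemma measurable_attach_cloops:
  fixes E :: "'v::finite set set"
  assumes "skeleton E xs"
  shows "{t \<in> space (PiM {..<length xs} (\<lambda>_. borel)). attach_times xs t \<in> cloops E}
    \<in> sets (PiM {..<length xs} (\<lambda>_. borel :: real measure))"
  using sets.top[of "loop_measure E (mat 1)"] assms
  by (auto simp: sets_loop_measure space_loop_measure cloop_sets_def)

text \<open>Universal property of the quotient sigma-algebra: measurability is tested after
  composition with each class map. The class maps leave the space where some time is not positive,
  hence the intersection with \<open>cloops E\<close> in the proof.\<close>

lemma measurable_loop_measureI:
  assumes F: "\<And>xs. skeleton E xs \<Longrightarrow> (\<lambda>t. F (attach_times xs t)) \<in> PiM {..<length xs} (\<lambda>_. borel :: real measure) \<rightarrow>\<^sub>M N"
    and sp: "F \<in> cloops E \<rightarrow> space N"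
  shows "F \<in> loop_measure E P \<rightarrow>\<^sub>M N"
proof (rule measurableI)
  fix A assume A: "A \<in> sets N"
  show "F -` A \<inter> space (loop_measure E P) \<in> sets (loop_measure E P)"
    unfolding sets_loop_measure space_loop_measure cloop_sets_def
  proof (intro CollectI conjI allI impI)
    fix xs assume xs: "skeleton E xs"
    let ?N = "PiM {..<length xs} (\<lambda>_. borel :: real measure)"
    have "{t \<in> space ?N. attach_times xs t \<in> F -` A \<inter> cloops E} =
      ((\<lambda>t. F (attach_times xs t)) -` A \<inter> space ?N) \<inter> {t \<in> space ?N. attach_times xs t \<in> cloops E}" by auto
    also have "\<dots> \<in> sets ?N"
      using measurable_sets[OF F[OF xs] A] measurable_attach_cloops[OF xs] by (rule sets.Int)
    finally show "{t \<in> space ?N. attach_times xs t \<in> F -` A \<inter> cloops E} \<in> sets ?N" .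
  qed auto
qed (use sp in \<open>auto simp: space_loop_measure\<close>)

lemma measurable_loop_time [measurable]: "loop_time x \<in> borel_measurable (loop_measure E P)"
proof (rule measurable_loop_measureI)
  show "(\<lambda>t. loop_time x (attach_times xs t)) \<in> borel_measurable (PiM {..<length xs} (\<lambda>_. borel :: real measure))" for xs
    unfolding loop_time_attach by measurable
qed simp

lemma measurable_loop_jumps [measurable]: "loop_jumps x y \<in> loop_measure E P \<rightarrow>\<^sub>M count_space UNIV"
  by (rule measurable_loop_measureI) (auto simp: loop_jumps_attach)

lemma measurable_loop_edges [measurable]: "loop_edges e \<in> loop_measure E P \<rightarrow>\<^sub>M count_space UNIV"
  by (rule measurable_loop_measureI) (auto simp: loop_edges_attach)

lemma attach_times_in_cloops_iff:
  assumes "skeleton E xs"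
  shows "attach_times xs t \<in> cloops E \<longleftrightarrow> (\<forall>i<length xs. 0 < t i)"
proof
  assume "attach_times xs t \<in> cloops E"
  then obtain w where w: "cyc (zip xs (map t [0..<length xs])) = cyc w" "\<forall>p\<in>set w. 0 < snd p"
    by (auto simp: cloops_def attach_times_def)
  have "zip xs (map t [0..<length xs]) \<in> cyc w"
    unfolding w(1)[symmetric] by (rule cyc_self)
  then have "set (zip xs (map t [0..<length xs])) = set w" by (auto simp: cyc_def)
  moreover have "(xs ! i, t i) \<in> set (zip xs (map t [0..<length xs]))" if "i < length xs" for i
    using that by (auto simp: set_zip)
  ultimately show "\<forall>i<length xs. 0 < t i" using w(2) by fastforce
next
  assume "\<forall>i<length xs. 0 < t i"
  then show "attach_times xs t \<in> cloops E" using assms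
    unfolding cloops_def attach_times_def
    by (intro CollectI exI[of _ "zip xs (map t [0..<length xs])"]) (auto simp: set_zip)
qed

lemma skeleton_rep: "c \<in> discrete_loops E \<Longrightarrow> skeleton E (rep c)"
  using rep_discrete_loop(2) by (auto simp: skeleton_def)

abbreviation trivial_time :: "real measure" where
  "trivial_time \<equiv> density lborel (\<lambda>t. ennreal (indicator {0<..} t * (exp (- t) / t)))"

abbreviation holding_times :: "nat \<Rightarrow> (nat \<Rightarrow> real) measure" where
  "holding_times n \<equiv> PiM {..<n} (\<lambda>_. density lborel (exponential_density 1))"

lemma sets_holding_times [measurable_cong]: "sets (holding_times n) = sets (PiM {..<n} (\<lambda>_. borel :: real measure))"
  by (intro sets_PiM_cong) auto

text \<open>Holding times range over all reals here; the indicator discards those that are not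
  positive, for which the attached class lies outside the space and \<open>f\<close> is not
  controlled.\<close>

abbreviation trivial_integral :: "'v::finite set set \<Rightarrow> (('v \<times> real) list set \<Rightarrow> ennreal) \<Rightarrow> 'v \<Rightarrow> ennreal" where
  "trivial_integral E f x \<equiv> (\<integral>\<^sup>+t. f (cyc [(x, t)]) * indicator (cloops E) (cyc [(x, t)]) \<partial>trivial_time)"

abbreviation loop_integral :: "'v::finite set set \<Rightarrow> (('v \<times> real) list set \<Rightarrow> ennreal) \<Rightarrow> 'v list set \<Rightarrow> ennreal" where
  "loop_integral E f c \<equiv> (\<integral>\<^sup>+t. f (attach_times (rep c) t) * indicator (cloops E) (attach_times (rep c) t)
     \<partial>holding_times (length (rep c)))"

text \<open>The loop measure is specified on sets only; the formula extends from indicators by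
  scaling, addition and increasing limits, both sides being monotone and additive in
  \<open>f\<close>.\<close>

lemma nn_integral_loop_measure:
  fixes f :: "('v::finite \<times> real) list set \<Rightarrow> ennreal"
  assumes "f \<in> borel_measurable (loop_measure E P)"
  shows "(\<integral>\<^sup>+l. f l \<partial>loop_measure E P) =
     (\<Sum>x\<in>UNIV. trivial_integral E f x)
   + (\<integral>\<^sup>+c. ennreal (discrete_weight P c) *
        (loop_integral E f c)
      \<partial>count_space (discrete_loops E))"
    (is "_ = ?R f")
proof -
  have m: "(\<lambda>t. f (attach_times xs t) * indicator (cloops E) (attach_times xs t))
      \<in> borel_measurable (PiM {..<length xs} (\<lambda>_. borel :: real measure))"
    if f: "f \<in> borel_measurable (loop_measure E P)" and xs: "skeleton E xs" for xs and f :: "('v \<times> real) list set \<Rightarrow> ennreal"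
  proof (rule measurableI)
    fix A :: "ennreal set" assume A: "A \<in> sets borel"
    let ?N = "PiM {..<length xs} (\<lambda>_. borel :: real measure)"
    have "f -` A \<inter> cloops E \<in> cloop_sets E"
      using measurable_sets[OF f A] by (simp add: sets_loop_measure space_loop_measure)
    then have 1: "{t \<in> space ?N. attach_times xs t \<in> f -` A \<inter> cloops E} \<in> sets ?N"
      using xs by (auto simp: cloop_sets_def)
    \<comment> \<open>Off \<open>cloops E\<close> the product is 0, so that whole part belongs to
      the preimage exactly when \<open>0 \<in> A\<close>.\<close>
    have "(\<lambda>t. f (attach_times xs t) * indicator (cloops E) (attach_times xs t)) -` A \<inter> space ?N
      = {t \<in> space ?N. attach_times xs t \<in> f -` A \<inter> cloops E} \<union>
        (if 0 \<in> A then space ?N - {t \<in> space ?N. attach_times xs t \<in> cloops E} else {})"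
      by (auto simp: indicator_def of_bool_def split: if_splits)
    also have "\<dots> \<in> sets ?N" using 1 measurable_attach_cloops[OF xs] by auto
    finally show "(\<lambda>t. f (attach_times xs t) * indicator (cloops E) (attach_times xs t)) -` A \<inter> space ?N \<in> sets ?N" .
  qed simp
  have m2: "(\<lambda>t. f (attach_times (rep c) t) * indicator (cloops E) (attach_times (rep c) t))
      \<in> borel_measurable (holding_times (length (rep c)))"
    if f: "f \<in> borel_measurable (loop_measure E P)" and c: "c \<in> discrete_loops E" for c and f :: "('v \<times> real) list set \<Rightarrow> ennreal"
    using m[OF f skeleton_rep[OF c]] measurable_cong_sets[OF sets_holding_times refl] by blast
  have m1: "(\<lambda>t. f (cyc [(x, t)]) * indicator (cloops E) (cyc [(x, t)])) \<in> borel_measurable borel"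
    if f: "f \<in> borel_measurable (loop_measure E P)" for x and f :: "('v \<times> real) list set \<Rightarrow> ennreal"
  proof -
    have "(\<lambda>t. \<lambda>j\<in>{..<length [x]}. t) \<in> measurable borel (PiM {..<length [x]} (\<lambda>_. borel :: real measure))"
      by (intro measurable_restrict) auto
    from measurable_compose[OF this m[OF f, of "[x]"]] show ?thesis
      by (simp add: skeleton_def attach_times_def)
  qed
  from assms show ?thesis
  proof (induction f rule: borel_measurable_induct)
    case (cong f g)
    have eq: "f l * indicator (cloops E) l = g l * indicator (cloops E) l" for l
      using cong(3)[of l] by (auto simp: space_loop_measure indicator_def)
    have "(\<integral>\<^sup>+l. g l \<partial>loop_measure E P) = (\<integral>\<^sup>+l. f l \<partial>loop_measure E P)"
      using cong(3) by (intro nn_integral_cong) auto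
    with cong(4) show ?case by (simp only: eq)
  next
    case (set A)
    then have A: "A \<in> cloop_sets E" by (simp add: sets_loop_measure)
    then have sub: "indicator A l * indicator (cloops E) l = (indicator A l :: ennreal)" for l
      by (auto simp: cloop_sets_def indicator_def)
    have 1: "(\<integral>\<^sup>+t. indicator A (cyc [(x, t)]) \<partial>trivial_time) = emeasure trivial_time {t. cyc [(x, t)] \<in> A}" for x
    proof -
      have eq: "(\<lambda>t. indicator A (cyc [(x, t)]) :: ennreal) = indicator {t. cyc [(x, t)] \<in> A}"
        by (auto simp: indicator_def)
      have "(\<lambda>t. indicator A (cyc [(x, t)]) :: ennreal) \<in> borel_measurable borel"
        using m1[OF borel_measurable_indicator[OF set], of x] by (simp only: sub)
      then have "{t. cyc [(x, t)] \<in> A} \<in> sets borel" by (simp add: eq borel_measurable_indicator_iff)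
      then show ?thesis unfolding eq by (intro nn_integral_indicator) simp
    qed
    have 2: "(\<integral>\<^sup>+t. indicator A (attach_times (rep c) t) \<partial>holding_times (length (rep c)))
      = emeasure (holding_times (length (rep c)))
         {t \<in> space (PiM {..<length (rep c)} (\<lambda>_. borel)). attach_times (rep c) t \<in> A}" if "c \<in> discrete_loops E" for c
    proof -
      have S: "{t \<in> space (PiM {..<length (rep c)} (\<lambda>_. borel)). attach_times (rep c) t \<in> A} \<in> sets (holding_times (length (rep c)))"
        using A skeleton_rep[OF that] unfolding sets_holding_times by (auto simp: cloop_sets_def)
      show ?thesis
        unfolding nn_integral_indicator[OF S, symmetric]
        by (intro nn_integral_cong) (auto simp: indicator_def space_PiM)
    qed
    have "(\<integral>\<^sup>+l. indicator A l \<partial>loop_measure E P) = loop_mass E P A"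
      using set A by (simp add: emeasure_loop_measure)
    also have "\<dots> = ?R (indicator A)"
      unfolding sub loop_mass_def 1 by (intro arg_cong2[where f="(+)"] nn_integral_cong) (auto simp: 2)
    finally show ?case .
  next
    case (mult u c)
    have 1: "(trivial_integral E (\<lambda>l. c * u l) x)
      = c * (trivial_integral E u x)" for x
      unfolding mult.assoc using mult.hyps by (intro nn_integral_cmult) (simp add: m1)
    have 2: "(loop_integral E (\<lambda>l. c * u l) d)
      = c * (loop_integral E u d)"
      if "d \<in> discrete_loops E" for d
      unfolding mult.assoc using mult.hyps m2[OF _ that] by (intro nn_integral_cmult) simp
    have "?R (\<lambda>l. c * u l) = c * ?R u"
      unfolding 1 distrib_left sum_distrib_left
      by (subst (3) nn_integral_cmult[symmetric])
        (auto intro!: arg_cong2[where f="(+)"] nn_integral_cong simp: 2 mult.left_commute)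
    with mult show ?case by (simp add: nn_integral_cmult)
  next
    case (add u v)
    let ?A = "\<lambda>f x. trivial_integral E f x"
    let ?B = "\<lambda>f d. loop_integral E f d"
    have 1: "?A (\<lambda>l. v l + u l) x = ?A v x + ?A u x" for x
      unfolding distrib_right using add.hyps by (intro nn_integral_add) (simp_all add: m1)
    have 2: "?B (\<lambda>l. v l + u l) d = ?B v d + ?B u d" if "d \<in> discrete_loops E" for d
      unfolding distrib_right using add.hyps m2[OF _ that] by (intro nn_integral_add) simp_all
    have "(\<integral>\<^sup>+d. ennreal (discrete_weight P d) * ?B (\<lambda>l. v l + u l) d \<partial>count_space (discrete_loops E))
      = (\<integral>\<^sup>+d. ennreal (discrete_weight P d) * ?B v d + ennreal (discrete_weight P d) * ?B u d \<partial>count_space (discrete_loops E))"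
      by (intro nn_integral_cong) (simp add: 2 distrib_left)
    also have "\<dots> = (\<integral>\<^sup>+d. ennreal (discrete_weight P d) * ?B v d \<partial>count_space (discrete_loops E))
      + (\<integral>\<^sup>+d. ennreal (discrete_weight P d) * ?B u d \<partial>count_space (discrete_loops E))"
      by (intro nn_integral_add) auto
    finally have "?R (\<lambda>l. v l + u l) = ?R v + ?R u"
      by (simp only: 1 sum.distrib) (simp only: add_ac)
    with add show ?case by (simp add: nn_integral_add)
  next
    case (seq U)
    have inc: "incseq (\<lambda>i l. U i l * indicator (cloops E) l)"
      using seq.hyps by (auto simp: incseq_def le_fun_def intro!: mult_right_mono)
    have s: "(SUP i. U i) l * indicator (cloops E) l = (SUP i. U i l * indicator (cloops E) l)" for l
      by (simp add: SUP_mult_right_ennreal image_comp)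
    have 1: "(\<integral>\<^sup>+t. (SUP i. U i (cyc [(x, t)]) * indicator (cloops E) (cyc [(x, t)])) \<partial>trivial_time)
      = (SUP i. trivial_integral E (U i) x)" for x
      using inc seq.hyps m1 by (intro nn_integral_monotone_convergence_SUP) (auto simp: incseq_def le_fun_def)
    have 2: "(\<integral>\<^sup>+t. (SUP i. U i (attach_times (rep c) t) * indicator (cloops E) (attach_times (rep c) t)) \<partial>holding_times (length (rep c)))
      = (SUP i. loop_integral E (U i) c)"
      if "c \<in> discrete_loops E" for c
      using inc seq.hyps m2[OF _ that] by (intro nn_integral_monotone_convergence_SUP) (auto simp: incseq_def le_fun_def)
    let ?a = "\<lambda>i x. trivial_integral E (U i) x"
    let ?b = "\<lambda>i c. loop_integral E (U i) c"
    have inca: "incseq (\<lambda>i. ?a i x)" for x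
      using inc by (auto simp: incseq_def le_fun_def intro!: nn_integral_mono)
    have incb: "incseq (\<lambda>i. ?b i c)" for c
      using inc by (auto simp: incseq_def le_fun_def intro!: nn_integral_mono)
    have incw: "incseq (\<lambda>i c. ennreal (discrete_weight P c) * ?b i c)"
      using incb by (auto simp: incseq_def le_fun_def intro!: mult_left_mono)
    have "?R (SUP i. U i) = (\<Sum>x\<in>UNIV. SUP i. ?a i x)
      + (\<integral>\<^sup>+c. (SUP i. ennreal (discrete_weight P c) * ?b i c) \<partial>count_space (discrete_loops E))"
      unfolding s 1 by (intro arg_cong2[where f="(+)"] nn_integral_cong) (auto simp: 2 SUP_mult_left_ennreal)
    also have "\<dots> = (SUP i. \<Sum>x\<in>UNIV. ?a i x)
      + (SUP i. \<integral>\<^sup>+c. ennreal (discrete_weight P c) * ?b i c \<partial>count_space (discrete_loops E))"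
      using inca incw by (subst incseq_sumI nn_integral_monotone_convergence_SUP, auto intro: ennreal_SUP_sum[symmetric])
    also have "\<dots> = (SUP i. ?R (U i))"
    proof (rule ennreal_SUP_add[symmetric])
      show "incseq (\<lambda>i. \<Sum>x\<in>UNIV. ?a i x)" by (rule incseq_sumI2) (rule inca)
      show "incseq (\<lambda>i. \<integral>\<^sup>+c. ennreal (discrete_weight P c) * ?b i c \<partial>count_space (discrete_loops E))"
        using incw by (auto simp: incseq_def le_fun_def intro!: nn_integral_mono)
    qed
    also have "\<dots> = (SUP i. \<integral>\<^sup>+l. U i l \<partial>loop_measure E P)" using seq.IH by simp
    also have "\<dots> = (\<integral>\<^sup>+l. (SUP i. U i) l \<partial>loop_measure E P)"
      unfolding SUP_apply using seq.hyps by (intro nn_integral_monotone_convergence_SUP[symmetric])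
    finally show ?case ..
  qed
qed


section \<open>Laplace transforms of the holding times\<close>

lemma nn_integral_exp_half_line:
  assumes "0 < a"
  shows "(\<integral>\<^sup>+t. ennreal (exp (- (a * t))) * indicator {0<..} t \<partial>lborel) = ennreal (1 / a)"
proof -
  have "(\<integral>\<^sup>+t. ennreal (exp (- (a * t))) * indicator {0<..} t \<partial>lborel)
    = (\<integral>\<^sup>+t. ennreal (1 / a) * ennreal (exponential_density a t) \<partial>lborel)"
  proof (rule nn_integral_cong_AE)
    show "AE t in lborel. ennreal (exp (- (a * t))) * indicator {0<..} t
      = ennreal (1 / a) * ennreal (exponential_density a t)"
      using AE_lborel_singleton[of "0::real"]
    proof eventually_elim
      fix t :: real assume "t \<noteq> 0"
      then show "ennreal (exp (- (a * t))) * indicator {0<..} t = ennreal (1 / a) * ennreal (exponential_density a t)"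
        using assms by (cases "0 < t") (auto simp: exponential_density_def ennreal_mult'[symmetric] mult.commute)
    qed
  qed
  also have "\<dots> = ennreal (1 / a) * emeasure (density lborel (exponential_density a)) UNIV"
    by (subst nn_integral_cmult) (auto simp: emeasure_density)
  also have "\<dots> = ennreal (1 / a)"
    using prob_space.emeasure_space_1[OF prob_space_exponential_density[OF assms]] by simp
  finally show ?thesis .
qed

text \<open>A Frullani integral: dividing \<open>1 - exp (- \<theta> * t)\<close> by
  \<open>t\<close> gives the integral of \<open>exp (- u * t)\<close> over \<open>u\<close> from 0
  to \<open>\<theta>\<close>. Exchanging the two integrals leaves the integral of
  \<open>1 / (1 + u)\<close>.\<close>

lemma nn_integral_trivial_time:
  assumes \<theta>: "0 \<le> \<theta>"
  shows "(\<integral>\<^sup>+t. ennreal (1 - exp (- (\<theta> * t))) * indicator {0<..} t \<partial>trivial_time) = ennreal (ln (1 + \<theta>))"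
proof -
  have "(\<integral>\<^sup>+t. ennreal (1 - exp (- (\<theta> * t))) * indicator {0<..} t \<partial>trivial_time)
    = (\<integral>\<^sup>+t. (\<integral>\<^sup>+u. ennreal (exp (- ((1 + u) * t))) * indicator {0<..} t * indicator {0..\<theta>} u \<partial>lborel) \<partial>lborel)"
  proof (subst nn_integral_density, measurable, rule nn_integral_cong)
    fix t :: real
    show "ennreal (indicator {0<..} t * (exp (- t) / t)) * (ennreal (1 - exp (- (\<theta> * t))) * indicator {0<..} t)
      = (\<integral>\<^sup>+u. ennreal (exp (- ((1 + u) * t))) * indicator {0<..} t * indicator {0..\<theta>} u \<partial>lborel)"
    proof (cases "0 < t")
      case True
      have "(\<integral>\<^sup>+u. ennreal (exp (- ((1 + u) * t))) * indicator {0..\<theta>} u \<partial>lborel)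
        = ennreal (- exp (- ((1 + \<theta>) * t)) / t - (- exp (- ((1 + 0) * t)) / t))"
        using True \<theta> by (intro nn_integral_FTC_Icc) (auto intro!: derivative_eq_intros)
      also have "- exp (- ((1 + \<theta>) * t)) / t - (- exp (- ((1 + 0) * t)) / t) = exp (- t) / t * (1 - exp (- (\<theta> * t)))"
        using True by (simp add: field_simps exp_add[symmetric])
      finally show ?thesis using True \<theta> by (simp add: ennreal_mult''[symmetric])
    qed simp
  qed
  also have "\<dots> = (\<integral>\<^sup>+u. (\<integral>\<^sup>+t. ennreal (exp (- ((1 + u) * t))) * indicator {0<..} t * indicator {0..\<theta>} u \<partial>lborel) \<partial>lborel)"
    by (rule lborel_pair.Fubini') measurable
  also have "\<dots> = (\<integral>\<^sup>+u. ennreal (1 / (1 + u)) * indicator {0..\<theta>} u \<partial>lborel)"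
  proof (rule nn_integral_cong)
    fix u :: real
    show "(\<integral>\<^sup>+t. ennreal (exp (- ((1 + u) * t))) * indicator {0<..} t * indicator {0..\<theta>} u \<partial>lborel)
      = ennreal (1 / (1 + u)) * indicator {0..\<theta>} u"
      by (cases "0 \<le> u") (auto simp: nn_integral_multc nn_integral_exp_half_line)
  qed
  also have "\<dots> = ennreal (ln (1 + \<theta>) - ln (1 + 0))"
    using \<theta> by (intro nn_integral_FTC_Icc) (auto intro!: derivative_eq_intros)
  finally show ?thesis by simp
qed

lemma ennreal_one_minus: "0 \<le> a \<Longrightarrow> 1 - ennreal a = ennreal (1 - a)"
  using ennreal_minus[of a 1] by simp

text \<open>An exponential time of mean 1 has Laplace transform \<open>1 / (1 + \<theta> i)\<close>,
  and independence multiplies these. \<open>W\<close> stands for the factor contributed by the edges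
  of the underlying discrete loop.\<close>

lemma nn_integral_holding_times:
  assumes \<theta>: "\<And>i. i < n \<Longrightarrow> 0 \<le> \<theta> i" and W: "0 \<le> W" "W \<le> 1"
  shows "(\<integral>\<^sup>+t. ennreal (1 - W * exp (- (\<Sum>i<n. \<theta> i * t i))) * (if \<forall>i<n. 0 < t i then 1 else 0) \<partial>holding_times n)
    = ennreal (1 - W * (\<Prod>i<n. 1 / (1 + \<theta> i)))"
proof -
  let ?d = "density lborel (exponential_density 1)"
  interpret prob_space ?d by (rule prob_space_exponential_density) simp
  interpret product_sigma_finite "\<lambda>_ :: nat. ?d" ..
  have one: "(\<integral>\<^sup>+t. ennreal (exp (- (a * t))) * indicator {0<..} t \<partial>?d) = ennreal (1 / (1 + a))" if "0 \<le> a" for a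
  proof -
    have "(\<integral>\<^sup>+t. ennreal (exp (- (a * t))) * indicator {0<..} t \<partial>?d)
      = (\<integral>\<^sup>+t. ennreal (exp (- ((1 + a) * t))) * indicator {0<..} t \<partial>lborel)"
      by (subst nn_integral_density)
        (auto intro!: nn_integral_cong simp: exponential_density_def indicator_def ennreal_mult'[symmetric] exp_add[symmetric] algebra_simps)
    then show ?thesis using that nn_integral_exp_half_line[of "1 + a"] by simp
  qed
  have pe: "(\<Prod>i<n. ennreal (1 / (1 + \<theta> i))) = ennreal (\<Prod>i<n. 1 / (1 + \<theta> i))"
    using \<theta> by (intro prod_ennreal) auto
  let ?I = "\<lambda>t. \<Prod>i<n. (indicator {0<..} (t i) :: ennreal)"
  let ?G = "\<lambda>t. \<Prod>i<n. ennreal (exp (- (\<theta> i * t i))) * indicator {0<..} (t i)"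
  have I: "?I t = (if \<forall>i<n. 0 < t i then 1 else 0)" for t :: "nat \<Rightarrow> real"
    by (auto simp: indicator_def)
  have G: "ennreal W * ?G t = ennreal (W * exp (- (\<Sum>i<n. \<theta> i * t i))) * ?I t" for t
    using W by (simp add: prod.distrib prod_ennreal exp_sum sum_negf[symmetric] ennreal_mult' prod_nonneg mult.assoc)
  have le: "W * exp (- (\<Sum>i<n. \<theta> i * t i)) \<le> 1" if "\<forall>i<n. 0 < t i" for t
  proof -
    have "0 \<le> (\<Sum>i<n. \<theta> i * t i)" using \<theta> that by (intro sum_nonneg mult_nonneg_nonneg) (auto simp: less_imp_le)
    then show ?thesis using W by (intro mult_le_one) auto
  qed
  have "(\<integral>\<^sup>+t. ennreal (1 - W * exp (- (\<Sum>i<n. \<theta> i * t i))) * (if \<forall>i<n. 0 < t i then 1 else 0) \<partial>holding_times n)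
    = (\<integral>\<^sup>+t. ?I t - ennreal W * ?G t \<partial>holding_times n)"
    unfolding G I using le W by (intro nn_integral_cong) (auto simp: ennreal_one_minus)
  \<comment> \<open>Splitting a difference of extended nonnegative functions requires the subtracted
    integral to be finite and the subtracted function to be the smaller one.\<close>
  also have "\<dots> = (\<integral>\<^sup>+t. ?I t \<partial>holding_times n) - (\<integral>\<^sup>+t. ennreal W * ?G t \<partial>holding_times n)"
  proof (rule nn_integral_diff)
    have Ival: "(\<integral>\<^sup>+t. ?G t \<partial>holding_times n) = (\<Prod>i<n. ennreal (1 / (1 + \<theta> i)))"
      using \<theta> by (subst product_nn_integral_prod) (auto simp: one)
    show "(\<integral>\<^sup>+t. ennreal W * ?G t \<partial>holding_times n) \<noteq> \<infinity>"
    proof -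
      have "(\<Prod>i<n. ennreal (1 / (1 + \<theta> i))) \<noteq> top" by (simp add: pe)
      then show ?thesis by (subst nn_integral_cmult) (simp_all add: Ival ennreal_mult_eq_top_iff)
    qed
    show "AE t in holding_times n. ennreal W * ?G t \<le> ?I t"
      unfolding G I using le by (auto intro!: ennreal_le_1[THEN iffD2])
  qed measurable
  also have "(\<integral>\<^sup>+t. ?I t \<partial>holding_times n) = 1"
    using one[of 0] by (subst product_nn_integral_prod) auto
  also have "(\<integral>\<^sup>+t. ennreal W * ?G t \<partial>holding_times n) = ennreal W * (\<Prod>i<n. ennreal (1 / (1 + \<theta> i)))"
    using \<theta> by (subst nn_integral_cmult, measurable, subst product_nn_integral_prod) (auto simp: one)
  also have "\<dots> = ennreal (W * (\<Prod>i<n. 1 / (1 + \<theta> i)))"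
    using W by (simp only: pe ennreal_mult')
  also have "1 - \<dots> = ennreal (1 - W * (\<Prod>i<n. 1 / (1 + \<theta> i)))"
    using \<theta> W by (intro ennreal_one_minus mult_nonneg_nonneg prod_nonneg) auto
  finally show ?thesis .
qed

subsection \<open>The Laplace functional of the loop measure\<close>

text \<open>Regroups the steps of the loop by the edge that they cross, which turns weights on edges
  into weights on entries of a matrix.\<close>

lemma prod_edge_count:
  fixes g :: "'v::finite set \<Rightarrow> 'b::comm_semiring_1"
  shows "(\<Prod>e\<in>E. g e ^ edge_count e xs) = (\<Prod>(a, b)\<leftarrow>cyclic_steps xs. if {a, b} \<in> E then g {a, b} else 1)"
proof -
  have fin: "finite E" by simp
  have "(\<Prod>e\<in>E. g e ^ length (filter (\<lambda>(a, b). {a, b} = e) L)) = (\<Prod>(a, b)\<leftarrow>L. if {a, b} \<in> E then g {a, b} else 1)" for L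
  proof (induction L)
    case (Cons p L)
    obtain a b where p: "p = (a, b)" by force
    have "(\<Prod>e\<in>E. g e ^ length (filter (\<lambda>(a, b). {a, b} = e) (p # L)))
      = (\<Prod>e\<in>E. (if {a, b} = e then g e else 1) * g e ^ length (filter (\<lambda>(a, b). {a, b} = e) L))"
      by (intro prod.cong) (auto simp: p)
    then show ?case by (simp add: prod.distrib Cons p prod.delta'[OF fin])
  qed simp
  then show ?thesis by (simp add: edge_count_def)
qed

lemma prod_cyclic_steps_fst:
  "(\<Prod>(a, b)\<leftarrow>cyclic_steps xs. g a) = (\<Prod>i<length xs. g (xs ! i))"
proof -
  have "(\<Prod>(a, b)\<leftarrow>cyclic_steps xs. g a) = prod_list (map g (map fst (cyclic_steps xs)))"
    by (simp add: case_prod_unfold o_def)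
  also have "map fst (cyclic_steps xs) = xs" by (simp add: cyclic_steps_def)
  finally show ?thesis by (simp add: prod.list_conv_set_nth atLeast0LessThan)
qed

lemma sum_loop_time_attach:
  fixes \<theta> :: "'v::finite \<Rightarrow> real"
  shows "(\<Sum>x\<in>UNIV. \<theta> x * loop_time x (attach_times xs t)) = (\<Sum>i<length xs. \<theta> (xs ! i) * t i)"
proof -
  have "(\<Sum>x\<in>UNIV. \<theta> x * loop_time x (attach_times xs t))
    = (\<Sum>i<length xs. \<Sum>x\<in>UNIV. if xs ! i = x then \<theta> x * t i else 0)"
    by (subst sum.swap) (auto simp: loop_time_attach sum_distrib_left intro!: sum.cong)
  then show ?thesis by simp
qed

lemma loop_time_nonneg:
  assumes "l \<in> cloops E"
  shows "0 \<le> loop_time x l"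
  using assms by (fastforce simp: cloops_def loop_time_cyc intro!: sum_list_nonneg dest: less_imp_le)

text \<open>The test function for the Laplace functional. Integrated over the ensemble it is a
  linear combination of edge counts and total times, so \<open>nexp\<close> of it is a monomial in
  their codes.\<close>

definition loop_functional :: "'v::finite set set \<Rightarrow> ('v set \<Rightarrow> nat) \<Rightarrow> ('v \<Rightarrow> real) \<Rightarrow> ('v \<times> real) list set \<Rightarrow> ennreal" where
  "loop_functional E j \<theta> l = (\<Sum>e\<in>E. of_nat (j e) * of_nat (loop_edges e l))
     + (\<Sum>x\<in>UNIV. ennreal (\<theta> x) * ennreal (loop_time x l))"

text \<open>Each crossing of an edge costs \<open>exp (- j e)\<close>, and each visit to
  \<open>a\<close> costs the Laplace transform \<open>1 / (1 + \<theta> a)\<close> of its holding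
  time.\<close>

definition tilt :: "'v::finite set set \<Rightarrow> ('v set \<Rightarrow> nat) \<Rightarrow> ('v \<Rightarrow> real) \<Rightarrow> real^'v^'v \<Rightarrow> real^'v^'v" where
  "tilt E j \<theta> P = (\<chi> a b. P $ a $ b * (if {a, b} \<in> E then exp (- real (j {a, b})) else 1) * (1 / (1 + \<theta> a)))"

lemma measurable_loop_functional [measurable]: "loop_functional E j \<theta> \<in> borel_measurable (loop_measure E' P)"
  unfolding loop_functional_def by measurable

lemma nexp_loop_functional_attach:
  assumes xs: "skeleton E xs" and t: "\<forall>i<length xs. 0 < t i" and \<theta>: "\<And>x. 0 \<le> \<theta> x"
  shows "nexp (loop_functional E j \<theta> (attach_times xs t)) =
    (\<Prod>(a, b)\<leftarrow>cyclic_steps xs. if {a, b} \<in> E then exp (- real (j {a, b})) else 1)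
    * exp (- (\<Sum>i<length xs. \<theta> (xs ! i) * t i))"
proof -
  let ?l = "attach_times xs t"
  have l: "?l \<in> cloops E" using t by (simp add: attach_times_in_cloops_iff[OF xs])
  have "(\<Sum>x\<in>UNIV. ennreal (\<theta> x) * ennreal (loop_time x ?l)) = (\<Sum>x\<in>UNIV. ennreal (\<theta> x * loop_time x ?l))"
    using \<theta> by (simp add: ennreal_mult')
  also have "\<dots> = ennreal (\<Sum>x\<in>UNIV. \<theta> x * loop_time x ?l)"
    using \<theta> loop_time_nonneg[OF l] by (intro sum_ennreal mult_nonneg_nonneg)
  finally have "nexp (\<Sum>x\<in>UNIV. ennreal (\<theta> x) * ennreal (loop_time x ?l)) = exp (- (\<Sum>x\<in>UNIV. \<theta> x * loop_time x ?l))"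
    using \<theta> loop_time_nonneg[OF l] by (simp add: nexp_ennreal sum_nonneg)
  moreover have "nexp (\<Sum>e\<in>E. of_nat (j e) * of_nat (loop_edges e ?l)) = (\<Prod>e\<in>E. exp (- real (j e)) ^ edge_count e xs)"
    by (simp add: nexp_sum loop_edges_attach mult.commute[of "of_nat (j _)"] nexp_of_nat_mult nexp_of_nat)
  ultimately show ?thesis
    by (simp add: loop_functional_def nexp_add sum_loop_time_attach prod_edge_count)
qed

lemma prod_list_nonneg_le_1:
  assumes "\<And>x. x \<in> set xs \<Longrightarrow> 0 \<le> f x \<and> f x \<le> (1::real)"
  shows "0 \<le> (\<Prod>x\<leftarrow>xs. f x)" "(\<Prod>x\<leftarrow>xs. f x) \<le> 1"
proof -
  have "0 \<le> (\<Prod>x\<leftarrow>xs. f x) \<and> (\<Prod>x\<leftarrow>xs. f x) \<le> 1"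
    using assms by (induction xs) (auto intro: mult_le_one)
  then show "0 \<le> (\<Prod>x\<leftarrow>xs. f x)" "(\<Prod>x\<leftarrow>xs. f x) \<le> 1" by auto
qed

lemma prod_list_mult_distrib:
  "(\<Prod>(a, b)\<leftarrow>L. f a b * g a b) = (\<Prod>(a, b)\<leftarrow>L. f a b) * (\<Prod>(a, b)\<leftarrow>L. g a b :: 'c :: comm_monoid_mult)"
  by (induction L) (auto simp: mult_ac)

text \<open>A discrete loop of weight \<open>w\<close> contributes \<open>w * (1 - W * V)\<close>,
  and \<open>w * W * V\<close> is its weight under the tilted matrix. The loops of length at least 2
  thus give a difference of two trace series, and the one-point loops give the logarithms.\<close>

lemma laplace_loop_measure:
  fixes E :: "'v::finite set set"
  assumes E: "simple_graph E" and P: "\<And>a b. {a, b} \<notin> E \<Longrightarrow> P $ a $ b = 0" "\<And>a b. 0 \<le> P $ a $ b"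
    and \<theta>: "\<And>x. 0 \<le> \<theta> x"
    and LP: "(\<lambda>n. trace (matpow P (Suc n)) / real (Suc n)) sums LP"
    and LQ: "(\<lambda>n. trace (matpow (tilt E j \<theta> P) (Suc n)) / real (Suc n)) sums LQ"
  shows "LQ \<le> LP"
    "(\<integral>\<^sup>+l. ennreal (1 - nexp (loop_functional E j \<theta> l)) \<partial>loop_measure E P)
      = ennreal ((\<Sum>x\<in>UNIV. ln (1 + \<theta> x)) + (LP - LQ))"
proof -
  let ?f = "loop_functional E j \<theta>"
  let ?Q = "tilt E j \<theta> P"
  let ?s = "\<lambda>a b. if {a, b} \<in> E then exp (- real (j {a, b})) else 1"
  define W where "W xs = (\<Prod>(a, b)\<leftarrow>cyclic_steps xs. ?s a b)" for xs
  define V where "V xs = (\<Prod>i<length xs. 1 / (1 + \<theta> (xs ! i)))" for xs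
  have W: "0 \<le> W xs" "W xs \<le> 1" for xs
    unfolding W_def by (intro prod_list_nonneg_le_1; auto)+
  have V: "0 \<le> V xs" "V xs \<le> 1" for xs
    unfolding V_def using \<theta> by (auto intro!: prod_nonneg prod_le_1 simp: divide_le_eq_1 add_pos_nonneg)
  have Q: "{a, b} \<notin> E \<Longrightarrow> ?Q $ a $ b = 0" "0 \<le> ?Q $ a $ b" for a b
    using P \<theta> by (auto simp: tilt_def)
  have attach: "(\<integral>\<^sup>+t. ennreal (1 - nexp (?f (attach_times xs t))) * indicator (cloops E) (attach_times xs t) \<partial>holding_times (length xs))
      = ennreal (1 - W xs * V xs)" if xs: "skeleton E xs" for xs
  proof -
    have "(\<integral>\<^sup>+t. ennreal (1 - nexp (?f (attach_times xs t))) * indicator (cloops E) (attach_times xs t) \<partial>holding_times (length xs))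
      = (\<integral>\<^sup>+t. ennreal (1 - W xs * exp (- (\<Sum>i<length xs. \<theta> (xs ! i) * t i))) * (if \<forall>i<length xs. 0 < t i then 1 else 0) \<partial>holding_times (length xs))"
      using xs \<theta> by (intro nn_integral_cong)
        (simp add: indicator_def attach_times_in_cloops_iff nexp_loop_functional_attach W_def)
    then show ?thesis unfolding V_def using \<theta> W by (simp add: nn_integral_holding_times)
  qed
  have trivial: "(trivial_integral E (\<lambda>l. ennreal (1 - nexp (?f l))) x)
      = ennreal (ln (1 + \<theta> x))" for x
  proof -
    have sk: "skeleton E [x]" by (simp add: skeleton_def)
    have at: "cyc [(x, t)] = attach_times [x] (\<lambda>_. t)" for t by (simp add: attach_times_def)
    \<comment> \<open>The only cyclic step of a one-point sequence is \<open>(x, x)\<close>, which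
      is no edge, so trivial loops do not contribute to the edge counts.\<close>
    have "{x, x} \<notin> E" using E by (auto simp: simple_graph_def)
    then have W1: "W [x] = 1" by (simp add: W_def cyclic_steps_def)
    have "(trivial_integral E (\<lambda>l. ennreal (1 - nexp (?f l))) x)
      = (\<integral>\<^sup>+t. ennreal (1 - exp (- (\<theta> x * t))) * indicator {0<..} t \<partial>trivial_time)"
      unfolding at using \<theta> W1
      by (intro nn_integral_cong)
        (simp add: indicator_def attach_times_in_cloops_iff[OF sk] nexp_loop_functional_attach[OF sk] W_def)
    then show ?thesis by (simp only: nn_integral_trivial_time[OF \<theta>])
  qed
  have Qe: "?Q $ a $ b = P $ a $ b * (?s a b * (1 / (1 + \<theta> a)))" for a b by (simp add: tilt_def)
  have wQ: "discrete_weight ?Q c = discrete_weight P c * (W (rep c) * V (rep c))" for c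
    unfolding discrete_weight_def W_def V_def prod_cyclic_steps_fst[symmetric, where g="\<lambda>a. 1 / (1 + \<theta> a)"]
  proof -
    have "(\<Prod>(a, b)\<leftarrow>L. ?Q $ a $ b) = (\<Prod>(a, b)\<leftarrow>L. P $ a $ b * (?s a b * (1 / (1 + \<theta> a))))" for L
      by (intro arg_cong[where f=prod_list] map_cong) (auto simp: Qe)
    then show "1 / real (multiplicity_loop (rep c)) * (\<Prod>(a, b)\<leftarrow>cyclic_steps (rep c). ?Q $ a $ b) =
      1 / real (multiplicity_loop (rep c)) * (\<Prod>(a, b)\<leftarrow>cyclic_steps (rep c). P $ a $ b) *
      ((\<Prod>(a, b)\<leftarrow>cyclic_steps (rep c). ?s a b) * (\<Prod>(a, b)\<leftarrow>cyclic_steps (rep c). 1 / (1 + \<theta> a)))"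
      by (simp only: prod_list_mult_distrib mult.assoc)
  qed
  have wP0: "0 \<le> discrete_weight P c" for c
    using step_prod_nonneg[OF P(2), of "rep c"] by (simp add: discrete_weight_def step_prod_def)
  have tP: "0 \<le> trace (matpow P (Suc n))" and tQ: "0 \<le> trace (matpow ?Q (Suc n))" for n
    unfolding trace_matpow using step_prod_nonneg[OF P(2)] step_prod_nonneg[OF Q(2)] by (auto intro: sum_nonneg)
  have sumP: "(\<integral>\<^sup>+c. ennreal (discrete_weight P c) \<partial>count_space (discrete_loops E)) = ennreal LP"
    using P tP by (subst nn_integral_discrete_loops[OF E])
      (auto intro!: suminf_ennreal_eq LP simp del: matpow.simps of_nat_Suc)
  have sumQ: "(\<integral>\<^sup>+c. ennreal (discrete_weight ?Q c) \<partial>count_space (discrete_loops E)) = ennreal LQ"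
    using Q tQ by (subst nn_integral_discrete_loops[OF E])
      (auto intro!: suminf_ennreal_eq LQ simp del: matpow.simps of_nat_Suc)
  have LQ0: "0 \<le> LQ" using tQ by (intro sums_le[OF _ sums_zero LQ]) auto
  have LP0: "0 \<le> LP" using tP by (intro sums_le[OF _ sums_zero LP]) auto
  have WV: "W xs * V xs \<le> 1" "0 \<le> W xs * V xs" for xs using W[of xs] V[of xs] by (auto intro: mult_le_one)
  \<comment> \<open>\<open>ennreal\<close> truncates negative numbers, so this order must be known
    before the difference can be handled as a real number.\<close>
  have "ennreal LQ \<le> ennreal LP"
    unfolding sumP[symmetric] sumQ[symmetric] wQ
    using wP0 WV by (intro nn_integral_mono ennreal_leI) (auto intro: mult_left_le)
  then show le: "LQ \<le> LP" using LP0 by simp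
  have "(\<integral>\<^sup>+c. ennreal (discrete_weight P c) * ennreal (1 - W (rep c) * V (rep c)) \<partial>count_space (discrete_loops E))
    = (\<integral>\<^sup>+c. ennreal (discrete_weight P c) - ennreal (discrete_weight ?Q c) \<partial>count_space (discrete_loops E))"
    unfolding wQ using wP0 WV
    by (intro nn_integral_cong) (simp add: ennreal_mult'[symmetric] ennreal_minus algebra_simps)
  also have "\<dots> = ennreal LP - ennreal LQ"
    unfolding sumP[symmetric] sumQ[symmetric]
  proof (rule nn_integral_diff)
    show "(\<integral>\<^sup>+c. ennreal (discrete_weight ?Q c) \<partial>count_space (discrete_loops E)) \<noteq> \<infinity>" by (simp add: sumQ)
    show "AE c in count_space (discrete_loops E). ennreal (discrete_weight ?Q c) \<le> ennreal (discrete_weight P c)"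
      unfolding wQ using wP0 WV by (auto simp: AE_count_space intro!: ennreal_leI mult_left_le)
  qed auto
  also have "\<dots> = ennreal (LP - LQ)" using LQ0 by (simp add: ennreal_minus)
  finally have "(\<integral>\<^sup>+c. ennreal (discrete_weight P c) * ennreal (1 - W (rep c) * V (rep c)) \<partial>count_space (discrete_loops E))
    = ennreal (LP - LQ)" .
  moreover have "(\<integral>\<^sup>+l. ennreal (1 - nexp (?f l)) \<partial>loop_measure E P)
    = (\<Sum>x\<in>UNIV. ennreal (ln (1 + \<theta> x)))
      + (\<integral>\<^sup>+c. ennreal (discrete_weight P c) * ennreal (1 - W (rep c) * V (rep c)) \<partial>count_space (discrete_loops E))"
  proof (subst nn_integral_loop_measure)
    have "(\<integral>\<^sup>+c. ennreal (discrete_weight P c) * (loop_integral E (\<lambda>l. ennreal (1 - nexp (?f l))) c) \<partial>count_space (discrete_loops E))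
      = (\<integral>\<^sup>+c. ennreal (discrete_weight P c) * ennreal (1 - W (rep c) * V (rep c)) \<partial>count_space (discrete_loops E))"
      by (intro nn_integral_cong) (simp add: attach skeleton_rep)
    then show "(\<Sum>x\<in>UNIV. trivial_integral E (\<lambda>l. ennreal (1 - nexp (?f l))) x)
      + (\<integral>\<^sup>+c. ennreal (discrete_weight P c) * (loop_integral E (\<lambda>l. ennreal (1 - nexp (?f l))) c) \<partial>count_space (discrete_loops E))
      = (\<Sum>x\<in>UNIV. ennreal (ln (1 + \<theta> x)))
        + (\<integral>\<^sup>+c. ennreal (discrete_weight P c) * ennreal (1 - W (rep c) * V (rep c)) \<partial>count_space (discrete_loops E))"
      by (simp only: trivial)
  qed measurable
  moreover have "(\<Sum>x\<in>UNIV. ennreal (ln (1 + \<theta> x))) = ennreal (\<Sum>x\<in>UNIV. ln (1 + \<theta> x))"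
    using \<theta> by (intro sum_ennreal) auto
  ultimately show "(\<integral>\<^sup>+l. ennreal (1 - nexp (?f l)) \<partial>loop_measure E P) = ennreal ((\<Sum>x\<in>UNIV. ln (1 + \<theta> x)) + (LP - LQ))"
    using le \<theta> by (simp add: ennreal_plus sum_nonneg)
qed

subsection \<open>Determination of a measure by its moments\<close>

lemma integrable_continuous_AE_compact:
  fixes h :: "'a::euclidean_space \<Rightarrow> real"
  assumes M: "finite_measure M" and sets: "sets M = sets borel" and K: "compact K" "AE z in M. z \<in> K"
    and h: "continuous_on UNIV h"
  shows "integrable M h"
proof -
  interpret finite_measure M by (rule M)
  have "compact (h ` K)" using K(1) h by (intro compact_continuous_image) (auto intro: continuous_on_subset)
  then obtain B where B: "\<And>z. z \<in> K \<Longrightarrow> norm (h z) \<le> B"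
    using compact_imp_bounded bounded_iff by (metis imageI)
  have "h \<in> borel_measurable M"
    unfolding measurable_cong_sets[OF sets refl] using h by (rule borel_measurable_continuous_onI)
  then show ?thesis using K(2) B by (intro integrable_const_bound[where B=B]) auto
qed

text \<open>The indicator of a closed set is the limit of the continuous functions
  \<open>max 0 (1 - m * infdist z C)\<close>, and closed sets are an intersection-stable generator
  of the Borel sets.\<close>

lemma measure_eqI_continuous:
  fixes M N :: "'a::euclidean_space measure"
  assumes M: "finite_measure M" "sets M = sets borel" and N: "finite_measure N" "sets N = sets borel"
    and eq: "\<And>f :: 'a \<Rightarrow> real. continuous_on UNIV f \<Longrightarrow> (\<And>z. 0 \<le> f z \<and> f z \<le> 1) \<Longrightarrow> integral\<^sup>L M f = integral\<^sup>L N f"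
  shows "M = N"
proof -
  interpret M: finite_measure M by (rule M)
  interpret N: finite_measure N by (rule N)
  have closed: "measure M C = measure N C" if C: "closed C" for C
  proof (cases "C = {}")
    case False
    define f where "f m z = max 0 (1 - real m * infdist z C)" for m z
    have cont: "continuous_on UNIV (f m)" for m unfolding f_def by (intro continuous_intros)
    have bd: "0 \<le> f m z \<and> f m z \<le> 1" for m z by (auto simp: f_def infdist_nonneg)
    have lim: "(\<lambda>m. f m z) \<longlonglongrightarrow> indicator C z" for z
    proof (cases "z \<in> C")
      case True
      then show ?thesis by (simp add: f_def)
    next
      case notin: False
      then have pos: "0 < infdist z C"
        using C False in_closed_iff_infdist_zero infdist_nonneg by (metis less_eq_real_def)
      obtain m0 :: nat where m0: "1 < real m0 * infdist z C"
        using ex_less_of_nat_mult[OF pos] by auto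
      have "f m z = 0" if "m \<ge> m0" for m
      proof -
        have "real m0 * infdist z C \<le> real m * infdist z C" using that pos by (intro mult_right_mono) auto
        then show ?thesis using m0 by (simp add: f_def)
      qed
      then have "eventually (\<lambda>m. f m z = indicator C z) sequentially"
        using notin by (auto simp: eventually_sequentially)
      then show ?thesis by (rule tendsto_eventually)
    qed
    have conv: "(\<lambda>m. integral\<^sup>L L (f m)) \<longlonglongrightarrow> measure L C"
      if L: "finite_measure L" "sets L = sets borel" for L
    proof -
      interpret L: finite_measure L by (rule L)
      have meas: "f m \<in> borel_measurable L" for m
        unfolding measurable_cong_sets[OF L(2) refl] using cont by (rule borel_measurable_continuous_onI)
      have "C \<in> sets L" using C L(2) by simp
      then have "(\<lambda>m. integral\<^sup>L L (f m)) \<longlonglongrightarrow> integral\<^sup>L L (indicator C)"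
        using bd lim meas
        by (intro integral_dominated_convergence[where w="\<lambda>_. 1"]) auto
      also have "integral\<^sup>L L (indicator C) = measure L C"
        using sets_eq_imp_space_eq[OF L(2)] by simp
      finally show ?thesis .
    qed
    show ?thesis
      using conv[OF M] conv[OF N] eq[OF cont bd] by (simp add: LIMSEQ_unique)
  qed simp
  show ?thesis
  proof (rule measure_eqI_generator_eq[where E="Collect closed" and \<Omega>=UNIV and A="\<lambda>_. UNIV"])
    show "Int_stable (Collect closed)" by (auto simp: Int_stable_def)
    show "sets M = sigma_sets UNIV (Collect closed)" "sets N = sigma_sets UNIV (Collect closed)"
      by (simp_all add: M(2) N(2) borel_eq_closed)
    fix X :: "'a set" assume "X \<in> Collect closed"
    then show "emeasure M X = emeasure N X"
      using closed by (simp add: M.emeasure_eq_measure N.emeasure_eq_measure)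
  qed auto
qed

text \<open>By Stone-Weierstrass a continuous function is uniformly close to a polynomial on
  \<open>K\<close>. Both measures live on \<open>K\<close>, so the two integrals differ by at most
  that distance times the total masses.\<close>

lemma measure_eqI_moments:
  fixes M N :: "(real^'n::finite) measure"
  assumes M: "finite_measure M" "sets M = sets borel" "AE z in M. z \<in> K"
    and N: "finite_measure N" "sets N = sets borel" "AE z in N. z \<in> K"
    and K: "compact K"
    and moments: "\<And>j. (\<integral>z. (\<Prod>i\<in>UNIV. z $ i ^ j i) \<partial>M) = (\<integral>z. (\<Prod>i\<in>UNIV. z $ i ^ j i) \<partial>N)"
  shows "M = N"
proof (rule measure_eqI_continuous[OF M(1,2) N(1,2)])
  interpret M: finite_measure M by (rule M)
  interpret N: finite_measure N by (rule N)
  note intM = integrable_continuous_AE_compact[OF M(1,2) K M(3)]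
  note intN = integrable_continuous_AE_compact[OF N(1,2) K N(3)]
  define mon where "mon j z = (\<Prod>i\<in>UNIV. z $ i ^ j i)" for j :: "'n \<Rightarrow> nat" and z :: "real^'n"
  have cmon: "continuous_on UNIV (mon j)" for j unfolding mon_def by (intro continuous_intros)
  \<comment> \<open>Multipliers preserving \<open>good\<close> are closed under products, so polynomials are among them.\<close>
  define good where "good h \<longleftrightarrow> continuous_on UNIV h \<and> (\<forall>j. (\<integral>z. h z * mon j z \<partial>M) = (\<integral>z. h z * mon j z \<partial>N))"
    for h :: "real^'n \<Rightarrow> real"
  have mon_Suc: "z $ i * mon j z = mon (j(i := Suc (j i))) z" for z i j
    unfolding mon_def by (subst (1 2) prod.remove[of _ i]) (auto intro!: prod.cong)
  have gc: "continuous_on UNIV h" if "good h" for h using that by (simp add: good_def)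
  \<comment> \<open>\<open>real_polynomial_function\<close> is generated by all bounded linear
    functionals rather than by the coordinates, hence the expansion along the axes.\<close>
  have good_lin: "good (\<lambda>z. f z * h z)" if f: "bounded_linear f" and h: "good h" for f h
  proof -
    have fz: "f z = (\<Sum>i\<in>UNIV. z $ i * f (axis i 1))" for z
    proof -
      have "z = (\<Sum>i\<in>UNIV. z $ i *\<^sub>R axis i 1)"
        by (simp add: vec_eq_iff axis_def if_distrib[of "\<lambda>a. _ * a"] cong: if_cong)
      then have "f z = f (\<Sum>i\<in>UNIV. z $ i *\<^sub>R axis i 1)" by (rule arg_cong)
      then show ?thesis using f by (simp add: linear_sum[OF bounded_linear.linear] linear_scale[OF bounded_linear.linear])
    qed
    have "(\<integral>z. f z * h z * mon j z \<partial>M) = (\<integral>z. f z * h z * mon j z \<partial>N)" for j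
    proof -
      have e: "f z * h z * mon j z = (\<Sum>i\<in>UNIV. f (axis i 1) * (h z * mon (j(i := Suc (j i))) z))" for z
        unfolding fz[of z] mon_Suc[symmetric] sum_distrib_right by (intro sum.cong) (auto simp: mult_ac)
      have c: "continuous_on UNIV (\<lambda>z. h z * mon (j(i := Suc (j i))) z)" for i
        using gc[OF h] cmon by (intro continuous_intros)
      show ?thesis unfolding e using h
        by (subst (1 2) Bochner_Integration.integral_sum) (simp_all add: intM[OF c] intN[OF c] good_def)
    qed
    then show ?thesis
      using gc[OF h] linear_continuous_on[OF f] by (auto simp: good_def intro!: continuous_intros)
  qed
  have poly: "\<forall>h. good h \<longrightarrow> good (\<lambda>z. f z * h z)" if "real_polynomial_function f" for f
    using that
  proof induction
    case (linear f)
    then show ?case using good_lin by blast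
  next
    case (const c)
    then show ?case by (auto simp: good_def mult.assoc intro!: continuous_intros)
  next
    case (add f g)
    show ?case
    proof (intro allI impI)
      fix h assume "good h"
      then have fh: "good (\<lambda>z. f z * h z)" and gh: "good (\<lambda>z. g z * h z)" using add by auto
      have c: "continuous_on UNIV (\<lambda>z. f z * h z * mon j z)" "continuous_on UNIV (\<lambda>z. g z * h z * mon j z)" for j
        using gc[OF fh] gc[OF gh] cmon by (auto intro: continuous_on_mult)
      have "(\<integral>z. (f z + g z) * h z * mon j z \<partial>M) = (\<integral>z. (f z + g z) * h z * mon j z \<partial>N)" for j
        using fh gh c[THEN intM] c[THEN intN]
        by (simp add: distrib_right good_def)
      then show "good (\<lambda>z. (f z + g z) * h z)"
        using continuous_on_add[OF gc[OF fh] gc[OF gh]] by (simp add: good_def distrib_right)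
    qed
  next
    case (mult f g)
    then show ?case by (simp add: mult.assoc)
  qed
  have good1: "good (\<lambda>_. 1)" using moments by (simp add: good_def mon_def)
  have mon0: "mon (\<lambda>_. 0) z = 1" for z by (simp add: mon_def)
  have polyeq: "integral\<^sup>L M g = integral\<^sup>L N g" if "real_polynomial_function g" for g
  proof -
    have "good (\<lambda>z. g z * 1)" using poly[OF that] good1 by blast
    then have "(\<integral>z. g z * 1 * mon (\<lambda>_. 0) z \<partial>M) = (\<integral>z. g z * 1 * mon (\<lambda>_. 0) z \<partial>N)"
      unfolding good_def by blast
    then show ?thesis by (simp add: mon0)
  qed
  fix f :: "real^'n \<Rightarrow> real" assume f: "continuous_on UNIV f"
  let ?m = "measure M (space M) + measure N (space N)"
  have le: "\<bar>integral\<^sup>L M f - integral\<^sup>L N f\<bar> \<le> e * ?m" if e: "0 < e" for e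
  proof -
    obtain g where g: "real_polynomial_function g" "\<And>z. z \<in> K \<Longrightarrow> \<bar>f z - g z\<bar> < e"
      using Stone_Weierstrass_real_polynomial_function[OF K continuous_on_subset[OF f subset_UNIV] e] by metis
    have cg: "continuous_on UNIV g"
      using g(1) continuous_on_polymonial_function real_polynomial_function_eq by blast
    have bound: "\<bar>integral\<^sup>L L f - integral\<^sup>L L g\<bar> \<le> e * measure L (space L)"
      if L: "finite_measure L" "sets L = sets borel" "AE z in L. z \<in> K" for L
    proof -
      interpret L: finite_measure L by (rule L)
      note int = integrable_continuous_AE_compact[OF L(1,2) K L(3)]
      have "\<bar>integral\<^sup>L L f - integral\<^sup>L L g\<bar> = norm (\<integral>z. f z - g z \<partial>L)"
        using int[OF f] int[OF cg] by simp
      also have "\<dots> \<le> (\<integral>z. norm (f z - g z) \<partial>L)" by (rule integral_norm_bound)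
      also have "\<dots> \<le> (\<integral>z. e \<partial>L)"
      proof (rule integral_mono_AE)
        show "AE z in L. norm (f z - g z) \<le> e" using L(3) by eventually_elim (use g(2) in force)
      qed (use int[OF f] int[OF cg] in auto)
      finally show ?thesis by (simp add: mult.commute)
    qed
    from bound[OF M] bound[OF N] polyeq[OF g(1)] show ?thesis by (simp add: distrib_left)
  qed
  have "\<bar>integral\<^sup>L M f - integral\<^sup>L N f\<bar> \<le> 0 + e" if "0 < e" for e
  proof -
    \<comment> \<open>The total mass \<open>?m\<close> may be 0, so the tolerance is divided by
      \<open>?m + 1\<close>.\<close>
    have m: "0 < ?m + 1" using measure_nonneg[of M "space M"] measure_nonneg[of N "space N"] by linarith
    then have "\<bar>integral\<^sup>L M f - integral\<^sup>L N f\<bar> \<le> e / (?m + 1) * ?m"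
      using that by (intro le) simp
    also have "\<dots> \<le> e" using m that by (simp add: divide_simps)
    finally show ?thesis by simp
  qed
  then have "\<bar>integral\<^sup>L M f - integral\<^sup>L N f\<bar> \<le> 0" by (rule field_le_epsilon)
  then show "integral\<^sup>L M f = integral\<^sup>L N f" by simp
qed

subsection \<open>Squares and signs of a Gaussian field\<close>

lemma nn_integral_even_half_line:
  fixes f :: "real \<Rightarrow> ennreal"
  assumes [measurable]: "f \<in> borel_measurable borel" and even: "\<And>t. f (- t) = f t"
  shows "(\<integral>\<^sup>+t. f t \<partial>lborel) = 2 * (\<integral>\<^sup>+t. f t * indicator {0<..} t \<partial>lborel)"
proof -
  have "(\<integral>\<^sup>+t. f t \<partial>lborel) = (\<integral>\<^sup>+t. f t * indicator {0<..} t + f t * indicator {0<..} (- t) \<partial>lborel)"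
    using AE_lborel_singleton[of "0::real"]
    by (intro nn_integral_cong_AE, eventually_elim) (auto simp: indicator_def)
  also have "\<dots> = (\<integral>\<^sup>+t. f t * indicator {0<..} t \<partial>lborel) + (\<integral>\<^sup>+t. f t * indicator {0<..} (- t) \<partial>lborel)"
    by (rule nn_integral_add) auto
  also have "(\<integral>\<^sup>+t. f t * indicator {0<..} (- t) \<partial>lborel) = (\<integral>\<^sup>+t. f t * indicator {0<..} t \<partial>lborel)"
    by (subst nn_integral_real_affine[where c="-1" and t=0]) (auto simp: even)
  finally show ?thesis by (simp add: mult_2)
qed

text \<open>Substitution \<open>r = t\<^sup>2\<close> with \<open>dr = 2 * t * dt\<close>, performed
  on compact intervals and then exhausted by monotone convergence on both sides.\<close>

lemma nn_integral_square_half_line: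
  fixes h :: "real \<Rightarrow> ennreal"
  assumes [measurable]: "h \<in> borel_measurable borel"
  shows "(\<integral>\<^sup>+r. h r * ennreal (1 / sqrt r) * indicator {0<..} r \<partial>lborel) = 2 * (\<integral>\<^sup>+t. h (t\<^sup>2) * indicator {0<..} t \<partial>lborel)"
proof -
  let ?f = "\<lambda>r. h r * ennreal (1 / sqrt r) * indicator {0<..} r"
  let ?g = "\<lambda>t. 2 * h (t\<^sup>2) * indicator {0<..} t"
  have sub: "(\<integral>\<^sup>+r. ?f r * indicator {0..(real n)\<^sup>2} r \<partial>lborel) = (\<integral>\<^sup>+t. ?g t * indicator {0..real n} t \<partial>lborel)" for n :: nat
  proof (cases "n = 0")
    case True
    have "(\<integral>\<^sup>+r. ?f r * indicator {0..0} r \<partial>lborel) = (\<integral>\<^sup>+r. 0 \<partial>(lborel :: real measure))"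
      by (intro nn_integral_cong) (auto simp: indicator_def)
    moreover have "(\<integral>\<^sup>+t. ?g t * indicator {0..0} t \<partial>lborel) = (\<integral>\<^sup>+r. 0 \<partial>(lborel :: real measure))"
      by (intro nn_integral_cong) (auto simp: indicator_def)
    ultimately show ?thesis using True by simp
  next
    case False
    have "(\<integral>\<^sup>+r. ?f r * indicator {0\<^sup>2..(real n)\<^sup>2} r \<partial>lborel)
      = (\<integral>\<^sup>+t. ?f (t\<^sup>2) * ennreal (2 * t) * indicator {0..real n} t \<partial>lborel)"
      using False by (intro nn_integral_substitution_aux[where g="\<lambda>t. t\<^sup>2" and g'="\<lambda>t. 2 * t"])
        (auto intro!: derivative_eq_intros continuous_intros)
    also have "\<dots> = (\<integral>\<^sup>+t. ?g t * indicator {0..real n} t \<partial>lborel)"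
    proof (rule nn_integral_cong)
      fix t :: real
      have "ennreal (1 / t) * ennreal (2 * t) = 2" if "0 < t"
        using that by (simp add: ennreal_mult''[symmetric])
      then show "?f (t\<^sup>2) * ennreal (2 * t) * indicator {0..real n} t = ?g t * indicator {0..real n} t"
        by (auto simp: indicator_def mult.assoc) (metis mult.commute)
    qed
    finally show ?thesis by simp
  qed
  have sup: "(\<integral>\<^sup>+r. F r \<partial>lborel) = (SUP n. \<integral>\<^sup>+r. F r * indicator {0..u n} r \<partial>lborel)"
    if [measurable]: "F \<in> borel_measurable borel" and F0: "\<And>r. r \<le> 0 \<Longrightarrow> F r = 0" and u: "mono u" "\<And>r. \<exists>n. r \<le> u n"
    for F :: "real \<Rightarrow> ennreal" and u :: "nat \<Rightarrow> real"
  proof -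
    have inc: "incseq (\<lambda>n r. F r * indicator {0..u n} r)"
      using u(1) by (auto simp: incseq_def le_fun_def mono_def indicator_def intro: order_trans)
    have "(SUP n. F r * indicator {0..u n} r) = F r" for r
    proof (cases "r \<le> 0")
      case False
      obtain N where N: "r \<le> u N" using u(2) by blast
      show ?thesis
      proof (rule antisym)
        have "F r * indicator {0..u N} r = F r" using False N by simp
        then show "F r \<le> (SUP n. F r * indicator {0..u n} r)" by (metis SUP_upper UNIV_I)
      qed (auto intro!: SUP_least simp: indicator_def)
    qed (simp add: F0)
    then have "(\<integral>\<^sup>+r. F r \<partial>lborel) = (\<integral>\<^sup>+r. (SUP n. F r * indicator {0..u n} r) \<partial>lborel)" by simp
    also have "\<dots> = (SUP n. \<integral>\<^sup>+r. F r * indicator {0..u n} r \<partial>lborel)"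
      by (rule nn_integral_monotone_convergence_SUP[OF inc]) measurable
    finally show ?thesis .
  qed
  have "(\<integral>\<^sup>+r. ?f r \<partial>lborel) = (SUP n. \<integral>\<^sup>+r. ?f r * indicator {0..(real n)\<^sup>2} r \<partial>lborel)"
  proof (rule sup)
    show "\<exists>n. r \<le> (real n)\<^sup>2" for r
    proof -
      obtain n :: nat where "max 1 r \<le> real n" using real_arch_simple by blast
      moreover have "real n \<le> (real n)\<^sup>2" by (cases n) (auto simp: power2_eq_square)
      ultimately show ?thesis by (intro exI[of _ n]) linarith
    qed
  qed (auto simp: mono_def power_mono)
  also have "\<dots> = (SUP n. \<integral>\<^sup>+t. ?g t * indicator {0..real n} t \<partial>lborel)" by (simp only: sub)
  also have "\<dots> = (\<integral>\<^sup>+t. ?g t \<partial>lborel)"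
    by (rule sup[symmetric]) (auto simp: mono_def intro: real_arch_simple)
  also have "\<dots> = 2 * (\<integral>\<^sup>+t. h (t\<^sup>2) * indicator {0<..} t \<partial>lborel)"
    by (simp add: nn_integral_cmult mult.assoc)
  finally show ?thesis .
qed

text \<open>The density of the image of Lebesgue measure on the line under squaring; the two
  preimages of \<open>r\<close> make up for the factor 1/2 of each branch.\<close>

definition square_weight :: "real \<Rightarrow> ennreal" where
  "square_weight r = ennreal (1 / sqrt r) * indicator {0<..} r"

lemma measurable_square_weight [measurable]: "square_weight \<in> borel_measurable borel"
  unfolding square_weight_def by measurable

lemma nn_integral_square:
  fixes h :: "real \<Rightarrow> ennreal"
  assumes [measurable]: "h \<in> borel_measurable borel"
  shows "(\<integral>\<^sup>+r. h r * square_weight r \<partial>lborel) = (\<integral>\<^sup>+t. h (t\<^sup>2) \<partial>lborel)"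
proof -
  have "(\<integral>\<^sup>+r. h r * square_weight r \<partial>lborel) = 2 * (\<integral>\<^sup>+t. h (t\<^sup>2) * indicator {0<..} t \<partial>lborel)"
    unfolding square_weight_def mult.assoc[symmetric] by (rule nn_integral_square_half_line) measurable
  also have "\<dots> = (\<integral>\<^sup>+t. h (t\<^sup>2) \<partial>lborel)"
    by (rule nn_integral_even_half_line[symmetric]) auto
  finally show ?thesis .
qed

text \<open>The measure with the product density and the image of Lebesgue measure under
  coordinatewise squaring are both the product of the one-dimensional image measures, as is seen on
  rectangles.\<close>

lemma nn_integral_square_vec:
  fixes H :: "real^'n::finite \<Rightarrow> ennreal"
  assumes [measurable]: "H \<in> borel_measurable borel"
  shows "(\<integral>\<^sup>+\<rho>. H \<rho> * (\<Prod>i\<in>UNIV. square_weight (\<rho> $ i)) \<partial>lborel) = (\<integral>\<^sup>+\<phi>. H (\<chi> i. (\<phi> $ i)\<^sup>2) \<partial>lborel)"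
proof -
  let ?L = "PiM (UNIV :: 'n set) (\<lambda>_. lborel :: real measure)"
  let ?B = "PiM (UNIV :: 'n set) (\<lambda>_. borel :: real measure)"
  let ?D = "\<lambda>_ :: 'n. density lborel square_weight"
  let ?w = "\<lambda>g :: 'n \<Rightarrow> real. \<Prod>i\<in>UNIV. square_weight (g i)"
  have sB: "sets ?L = sets ?B" by (intro sets_PiM_cong) auto
  have sD: "sets (PiM UNIV ?D) = sets ?B" by (intro sets_PiM_cong) auto
  note [measurable_cong] = sB
  have sq [measurable]: "(\<lambda>g i. (g i)\<^sup>2) \<in> ?L \<rightarrow>\<^sub>M ?B"
    by (rule measurable_PiM_single') (auto simp: space_PiM)
  interpret D: product_sigma_finite ?D
    unfolding product_sigma_finite_def
    by (subst sigma_finite_measure.sigma_finite_iff_density_finite[OF sigma_finite_lborel]) (auto simp: square_weight_def ennreal_mult_eq_top_iff indicator_def)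
  have "density ?L ?w = PiM UNIV ?D"
  proof (rule D.PiM_eqI)
    fix A :: "'n \<Rightarrow> real set" assume "\<And>i. i \<in> UNIV \<Longrightarrow> A i \<in> sets (density lborel square_weight)"
    then have A [measurable]: "A i \<in> sets borel" for i by simp
    have "emeasure (density ?L ?w) (PiE UNIV A) = (\<integral>\<^sup>+g. ?w g * indicator (PiE UNIV A) g \<partial>?L)"
      by (subst emeasure_density) (auto simp: sB intro!: sets_PiM_I_finite)
    also have "\<dots> = (\<integral>\<^sup>+g. (\<Prod>i\<in>UNIV. square_weight (g i) * indicator (A i) (g i)) \<partial>?L)"
      by (intro nn_integral_cong) (auto simp: prod.distrib indicator_def PiE_iff)
    also have "\<dots> = (\<Prod>i\<in>UNIV. emeasure (density lborel square_weight) (A i))"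
      by (subst lborel_product.product_nn_integral_prod) (auto simp: emeasure_density)
    finally show "emeasure (density ?L ?w) (PiE UNIV A) = (\<Prod>i\<in>UNIV. emeasure (density lborel square_weight) (A i))" .
  qed (auto simp: sD sB)
  moreover have "distr ?L ?B (\<lambda>g i. (g i)\<^sup>2) = PiM UNIV ?D"
  proof (rule D.PiM_eqI)
    fix A :: "'n \<Rightarrow> real set" assume "\<And>i. i \<in> UNIV \<Longrightarrow> A i \<in> sets (density lborel square_weight)"
    then have A [measurable]: "A i \<in> sets borel" for i by simp
    have "emeasure (distr ?L ?B (\<lambda>g i. (g i)\<^sup>2)) (PiE UNIV A) = (\<integral>\<^sup>+g. indicator (PiE UNIV A) (\<lambda>i. (g i)\<^sup>2) \<partial>?L)"
      by (subst nn_integral_indicator[symmetric], simp, subst nn_integral_distr) (auto intro!: sets_PiM_I_finite)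
    also have "\<dots> = (\<integral>\<^sup>+g. (\<Prod>i\<in>UNIV. indicator (A i) ((g i)\<^sup>2)) \<partial>?L)"
      by (intro nn_integral_cong) (auto simp: indicator_def PiE_iff)
    also have "\<dots> = (\<Prod>i\<in>UNIV. \<integral>\<^sup>+t. indicator (A i) (t\<^sup>2) \<partial>lborel)"
      by (subst lborel_product.product_nn_integral_prod) auto
    also have "\<dots> = (\<Prod>i\<in>UNIV. emeasure (density lborel square_weight) (A i))"
      by (simp add: nn_integral_square[symmetric] emeasure_density mult.commute)
    finally show "emeasure (distr ?L ?B (\<lambda>g i. (g i)\<^sup>2)) (PiE UNIV A) = (\<Prod>i\<in>UNIV. emeasure (density lborel square_weight) (A i))" .
  qed (auto simp: sD)
  ultimately have eq: "density ?L ?w = distr ?L ?B (\<lambda>g i. (g i)\<^sup>2)" by simp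
  have "(\<integral>\<^sup>+\<rho>. H \<rho> * (\<Prod>i\<in>UNIV. square_weight (\<rho> $ i)) \<partial>lborel) = (\<integral>\<^sup>+g. ?w g * H (\<chi> i. g i) \<partial>?L)"
    by (subst nn_integral_lborel_vec) (auto simp: mult.commute)
  also have "\<dots> = (\<integral>\<^sup>+g. H (\<chi> i. g i) \<partial>density ?L ?w)"
    by (subst nn_integral_density) auto
  also have "\<dots> = (\<integral>\<^sup>+g. H (\<chi> i. (g i)\<^sup>2) \<partial>?L)"
    unfolding eq by (subst nn_integral_distr) auto
  also have "\<dots> = (\<integral>\<^sup>+\<phi>. H (\<chi> i. (\<phi> $ i)\<^sup>2) \<partial>lborel)"
    by (subst nn_integral_lborel_vec) auto
  finally show ?thesis .
qed

section \<open>The power series of the interaction and the average over signs\<close>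

lemma exp_sum_PiE:
  fixes u :: "'e \<Rightarrow> real"
  assumes E: "finite E"
  shows "integrable (count_space (PiE E (\<lambda>_. UNIV :: nat set))) (\<lambda>k. \<Prod>e\<in>E. u e ^ k e / fact (k e))"
    and "(\<integral>k. (\<Prod>e\<in>E. u e ^ k e / fact (k e)) \<partial>count_space (PiE E (\<lambda>_. UNIV))) = exp (\<Sum>e\<in>E. u e)"
proof -
  have sm: "Infinite_Set_Sum.abs_summable_on (\<lambda>n. x ^ n / fact n) (UNIV :: nat set)" for x :: real
    using summable_norm_exp[of x] by (simp add: abs_summable_on_nat_iff' divide_inverse mult.commute)
  have "infsetsum (\<lambda>n. x ^ n / fact n) UNIV = exp x" for x :: real
    using sm[of x] by (simp add: infsetsum_nat' exp_def divide_inverse mult.commute)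
  then show "(\<integral>k. (\<Prod>e\<in>E. u e ^ k e / fact (k e)) \<partial>count_space (PiE E (\<lambda>_. UNIV))) = exp (\<Sum>e\<in>E. u e)"
    using infsetsum_prod_PiE[OF E, of "\<lambda>_. UNIV" "\<lambda>e n. u e ^ n / fact n"] sm
    by (simp add: infsetsum_def exp_sum[OF E])
  show "integrable (count_space (PiE E (\<lambda>_. UNIV :: nat set))) (\<lambda>k. \<Prod>e\<in>E. u e ^ k e / fact (k e))"
    using abs_summable_on_prod_PiE[OF E, of "\<lambda>_. UNIV" "\<lambda>e n. u e ^ n / fact n"] sm
    by (simp add: Infinite_Set_Sum.abs_summable_on_def)
qed

definition degree_at :: "'v set set \<Rightarrow> ('v set \<Rightarrow> nat) \<Rightarrow> 'v \<Rightarrow> nat" where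
  "degree_at E k x = (\<Sum>e\<in>{e\<in>E. x \<in> e}. k e)"

text \<open>Counts the incidences of edges and vertices in two ways.\<close>

lemma prod_edges_vertices:
  fixes g :: "'v::finite \<Rightarrow> 'b::comm_semiring_1"
  shows "(\<Prod>e\<in>E. (\<Prod>x\<in>e. g x) ^ k e) = (\<Prod>x\<in>UNIV. g x ^ degree_at E k x)"
proof -
  have "(\<Prod>e\<in>E. (\<Prod>x\<in>e. g x) ^ k e) = (\<Prod>e\<in>E. \<Prod>x\<in>UNIV. if x \<in> e then g x ^ k e else 1)"
    by (intro prod.cong refl) (simp add: prod_power_distrib prod.If_cases)
  also have "\<dots> = (\<Prod>x\<in>UNIV. \<Prod>e\<in>E. if x \<in> e then g x ^ k e else 1)" by (rule prod.swap)
  also have "\<dots> = (\<Prod>x\<in>UNIV. g x ^ degree_at E k x)"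
    by (intro prod.cong refl) (simp add: degree_at_def power_sum prod.inter_filter)
  finally show ?thesis .
qed

text \<open>Extensional functions are used so that each network, given by its values on
  \<open>E\<close>, occurs exactly once in sums over networks and there are only countably
  many.\<close>

definition even_networks :: "'v set set \<Rightarrow> ('v set \<Rightarrow> nat) set" where
  "even_networks E = {k \<in> PiE E (\<lambda>_. UNIV). \<forall>x. even (degree_at E k x)}"

abbreviation signs :: "('v \<Rightarrow> real) set" where
  "signs \<equiv> PiE UNIV (\<lambda>_. {1, -1})"

lemma card_signs: "card (signs :: ('v::finite \<Rightarrow> real) set) = 2 ^ CARD('v)"
  by (simp add: card_PiE numeral_2_eq_2)

text \<open>After regrouping by vertices the sum factorises, and the factor
  \<open>1 + (-1) ^ d\<close> at a vertex of degree \<open>d\<close> is 2 or 0.\<close>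

lemma sum_signs_network:
  fixes E :: "'v::finite set set"
  shows "(\<Sum>\<sigma>\<in>signs. \<Prod>e\<in>E. (\<Prod>x\<in>e. \<sigma> x) ^ k e) = (if \<forall>x. even (degree_at E k x) then 2 ^ CARD('v) else (0::real))"
proof -
  have "(\<Sum>\<sigma>\<in>signs. \<Prod>e\<in>E. (\<Prod>x\<in>e. \<sigma> x) ^ k e) = (\<Prod>x\<in>UNIV. \<Sum>s\<in>{1, -1::real}. s ^ degree_at E k x)"
    by (simp only: prod_edges_vertices) (rule prod_sum_PiE[symmetric], auto)
  also have "\<dots> = (\<Prod>x\<in>UNIV. if even (degree_at E k x) then 2 else 0)"
    by (intro prod.cong) auto
  also have "\<dots> = (if \<forall>x. even (degree_at E k x) then 2 ^ CARD('v) else 0)"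
    by auto
  finally show ?thesis .
qed

lemma prod_abs_even_network:
  fixes E :: "'v::finite set set" and \<phi> :: "'v \<Rightarrow> real"
  assumes "\<forall>x. even (degree_at E k x)"
  shows "(\<Prod>e\<in>E. (b e * (\<Prod>x\<in>e. \<phi> x)) ^ k e) = (\<Prod>e\<in>E. (b e * (\<Prod>x\<in>e. \<bar>\<phi> x\<bar>)) ^ k e)"
  using assms by (simp add: power_mult_distrib prod.distrib prod_edges_vertices power_even_abs)

text \<open>Averaging over the signs of the field kills the networks with an odd vertex.\<close>

lemma sum_signs_exp:
  fixes E :: "'v::finite set set" and \<phi> :: "'v \<Rightarrow> real"
  assumes b: "\<And>e. e \<in> E \<Longrightarrow> 0 \<le> b e"
  shows "ennreal (\<Sum>\<sigma>\<in>signs. exp (\<Sum>e\<in>E. b e * (\<Prod>x\<in>e. \<sigma> x * \<phi> x)))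
    = 2 ^ CARD('v) * (\<integral>\<^sup>+k. ennreal (\<Prod>e\<in>E. (b e * (\<Prod>x\<in>e. \<bar>\<phi> x\<bar>)) ^ k e / fact (k e)) \<partial>count_space (even_networks E))"
proof -
  have fin: "finite E" "finite (signs :: ('v \<Rightarrow> real) set)" by (auto intro: finite_PiE)
  let ?N = "count_space (PiE E (\<lambda>_. UNIV :: nat set))"
  let ?t = "\<lambda>\<sigma> k. \<Prod>e\<in>E. (b e * (\<Prod>x\<in>e. \<sigma> x * \<phi> x)) ^ k e / fact (k e)"
  let ?r = "\<lambda>k. \<Prod>e\<in>E. (b e * (\<Prod>x\<in>e. \<bar>\<phi> x\<bar>)) ^ k e / fact (k e)"
  have r0: "0 \<le> ?r k" for k
    using b by (intro prod_nonneg divide_nonneg_nonneg zero_le_power mult_nonneg_nonneg) auto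
  have t: "?t \<sigma> k = (\<Prod>e\<in>E. (\<Prod>x\<in>e. \<sigma> x) ^ k e) * (\<Prod>e\<in>E. (b e * (\<Prod>x\<in>e. \<phi> x)) ^ k e / fact (k e))" for \<sigma> k
    by (simp add: prod.distrib prod_dividef power_mult_distrib mult_ac)
  have sum: "(\<Sum>\<sigma>\<in>signs. ?t \<sigma> k) = 2 ^ CARD('v) * (?r k * indicator (even_networks E) k)" if "k \<in> space ?N" for k
  proof (cases "\<forall>x. even (degree_at E k x)")
    case True
    then have "k \<in> even_networks E" using that by (simp add: even_networks_def)
    moreover have "(\<Prod>e\<in>E. (b e * (\<Prod>x\<in>e. \<phi> x)) ^ k e / fact (k e)) = ?r k"
      using prod_abs_even_network[OF True, of b \<phi>] by (simp add: prod_dividef)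
    ultimately show ?thesis using True by (simp add: t sum_distrib_right[symmetric] sum_signs_network)
  next
    case False
    then have "k \<notin> even_networks E" by (simp add: even_networks_def)
    then show ?thesis using False by (simp only: t sum_distrib_right[symmetric] sum_signs_network) simp
  qed
  have "(\<Sum>\<sigma>\<in>signs. exp (\<Sum>e\<in>E. b e * (\<Prod>x\<in>e. \<sigma> x * \<phi> x))) = (\<Sum>\<sigma>\<in>signs. \<integral>k. ?t \<sigma> k \<partial>?N)"
    by (simp only: exp_sum_PiE(2)[OF fin(1)])
  also have "\<dots> = (\<integral>k. (\<Sum>\<sigma>\<in>signs. ?t \<sigma> k) \<partial>?N)"
    by (rule Bochner_Integration.integral_sum[symmetric]) (rule exp_sum_PiE(1)[OF fin(1)])
  also have "\<dots> = (\<integral>k. 2 ^ CARD('v) * (?r k * indicator (even_networks E) k) \<partial>?N)"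
    by (intro Bochner_Integration.integral_cong sum refl)
  also have "ennreal \<dots> = (\<integral>\<^sup>+k. ennreal (2 ^ CARD('v) * (?r k * indicator (even_networks E) k)) \<partial>?N)"
  proof (rule nn_integral_eq_integral[symmetric])
    have "integrable ?N (\<lambda>k. ?r k)" by (rule exp_sum_PiE(1)[OF fin(1)])
    then show "integrable ?N (\<lambda>k. 2 ^ CARD('v) * (?r k * indicator (even_networks E) k))"
      by (intro integrable_mult_right integrable_real_mult_indicator) (auto simp: even_networks_def)
  qed (use r0 in auto)
  also have "\<dots> = 2 ^ CARD('v) * (\<integral>\<^sup>+k. ennreal (?r k) * indicator (even_networks E) k \<partial>?N)"
    by (subst nn_integral_cmult[symmetric])
      (auto intro!: nn_integral_cong simp: ennreal_mult'' r0 ennreal_power[symmetric] indicator_def)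
  also have "(\<integral>\<^sup>+k. ennreal (?r k) * indicator (even_networks E) k \<partial>?N) = (\<integral>\<^sup>+k. ennreal (?r k) \<partial>count_space (even_networks E))"
  proof -
    have "even_networks E \<subseteq> PiE E (\<lambda>_. UNIV)" by (auto simp: even_networks_def)
    then have "(\<integral>\<^sup>+k. ennreal (?r k) * indicator (even_networks E) k \<partial>?N)
      = (\<integral>\<^sup>+k. ennreal (?r k) * indicator (even_networks E) k * indicator (PiE E (\<lambda>_. UNIV)) k \<partial>count_space UNIV)"
      by (subst nn_integral_count_space_indicator) auto
    also have "\<dots> = (\<integral>\<^sup>+k. ennreal (?r k) * indicator (even_networks E) k \<partial>count_space UNIV)"
      using \<open>even_networks E \<subseteq> _\<close> by (intro nn_integral_cong) (auto simp: indicator_def)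
    finally show ?thesis by (subst (2) nn_integral_count_space_indicator) auto
  qed
  finally show ?thesis .
qed

text \<open>Each sign pattern acts as a diagonal orthogonal matrix, which preserves Lebesgue
  measure.\<close>

lemma nn_integral_signs:
  fixes F :: "real^'v::finite \<Rightarrow> ennreal"
  assumes [measurable]: "F \<in> borel_measurable borel"
  shows "2 ^ CARD('v) * (\<integral>\<^sup>+\<phi>. F \<phi> \<partial>lborel) = (\<integral>\<^sup>+\<phi>. (\<Sum>\<sigma>\<in>signs. F (\<chi> x. \<sigma> x * \<phi> $ x)) \<partial>lborel)"
proof -
  have "(\<integral>\<^sup>+\<phi>. F (\<chi> x. \<sigma> x * \<phi> $ x) \<partial>lborel) = (\<integral>\<^sup>+\<phi>. F \<phi> \<partial>lborel)" if "\<sigma> \<in> signs" for \<sigma> :: "'v \<Rightarrow> real"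
  proof -
    have s: "\<sigma> x * \<sigma> x = 1" for x
    proof -
      have "\<sigma> x = 1 \<or> \<sigma> x = -1" using that by (auto simp: PiE_iff)
      then show ?thesis by auto
    qed
    have "diag \<sigma> ** diag \<sigma> = mat 1"
      by (simp add: vec_eq_iff matrix_matrix_mult_def mat_def if_distrib[of "\<lambda>a. a * _"] s cong: if_cong)
    moreover have "transpose (diag \<sigma>) = diag \<sigma>" by (simp add: transpose_def vec_eq_iff)
    ultimately have "orthogonal_matrix (diag \<sigma>)" by (simp add: orthogonal_matrix_def)
    from nn_integral_lborel_orthogonal[OF this assms] show ?thesis
      by (simp add: vec_eq_iff diag_mult_vec[symmetric])
  qed
  then have "(\<Sum>\<sigma>\<in>signs. \<integral>\<^sup>+\<phi>. F (\<chi> x. \<sigma> x * \<phi> $ x) \<partial>lborel) = 2 ^ CARD('v) * (\<integral>\<^sup>+\<phi>. F \<phi> \<partial>lborel)"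
    by (simp add: card_signs)
  then show ?thesis by (subst nn_integral_sum) auto
qed

subsection \<open>The loop ensemble of a killed network\<close>

lemma diag_conjugate_entry: "(diag d ** X ** diag e) $ x $ y = d x * X $ x $ y * e y"
  by (simp add: matrix_matrix_mult_def if_distrib[of "\<lambda>a. a * _"] if_distrib[of "\<lambda>a. _ * a"] cong: if_cong)

lemma diag_mult_entry: "(diag d ** X) $ x $ y = d x * X $ x $ y"
  by (simp add: matrix_matrix_mult_def if_distrib[of "\<lambda>a. a * _"] cong: if_cong)

text \<open>An edge is met by exactly two ordered pairs, and the diagonal gives singletons, which
  are not edges.\<close>

lemma double_sum_edges:
  fixes h :: "'v::finite set \<Rightarrow> real"
  assumes "simple_graph E" "\<And>e. e \<notin> E \<Longrightarrow> h e = 0"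
  shows "(\<Sum>x\<in>UNIV. \<Sum>y\<in>UNIV. h {x, y}) = 2 * (\<Sum>e\<in>E. h e)"
proof -
  have "(\<Sum>x\<in>UNIV. \<Sum>y\<in>UNIV. h {x, y}) = (\<Sum>(x, y)\<in>UNIV. h {x, y})"
    by (simp add: sum.cartesian_product)
  also have "\<dots> = (\<Sum>(x, y)\<in>{(x, y). {x, y} \<in> E}. h {x, y})"
    using assms(2) by (intro sum.mono_neutral_right) auto
  also have "\<dots> = (\<Sum>e\<in>E. \<Sum>p\<in>{p\<in>{(x, y). {x, y} \<in> E}. (case p of (x, y) \<Rightarrow> {x, y}) = e}. case p of (x, y) \<Rightarrow> h {x, y})"
    by (intro sum.group[symmetric]) auto
  also have "\<dots> = (\<Sum>e\<in>E. 2 * h e)"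
  proof (rule sum.cong)
    fix e assume e: "e \<in> E"
    then obtain a b where ab: "e = {a, b}" "a \<noteq> b" using assms(1) by (auto simp: simple_graph_def card_2_iff)
    have "{p\<in>{(x, y). {x, y} \<in> E}. (case p of (x, y) \<Rightarrow> {x, y}) = e} = {(a, b), (b, a)}"
      using e ab by (auto simp: doubleton_eq_iff insert_commute)
    then show "(\<Sum>p\<in>{p\<in>{(x, y). {x, y} \<in> E}. (case p of (x, y) \<Rightarrow> {x, y}) = e}. case p of (x, y) \<Rightarrow> h {x, y}) = 2 * h e"
      using ab by (simp add: insert_commute)
  qed simp
  finally show ?thesis by (simp add: sum_distrib_left)
qed

lemma degree_at_neighbours:
  fixes E :: "'v::finite set set"
  assumes "simple_graph E"
  shows "degree_at E k x = (\<Sum>y\<in>{y. {x, y} \<in> E}. k {x, y})"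
proof -
  have "{e\<in>E. x \<in> e} = (\<lambda>y. {x, y}) ` {y. {x, y} \<in> E}"
  proof safe
    fix e assume e: "e \<in> E" "x \<in> e"
    then obtain a b where "e = {a, b}" using assms by (auto simp: simple_graph_def card_2_iff)
    with e have "\<exists>y. e = {x, y}" by (auto simp: insert_commute)
    with e show "e \<in> (\<lambda>y. {x, y}) ` {y. {x, y} \<in> E}" by auto
  qed
  moreover have "inj_on (\<lambda>y. {x, y}) {y. {x, y} \<in> E}" by (auto simp: inj_on_def doubleton_eq_iff)
  ultimately show ?thesis by (simp add: degree_at_def sum.reindex)
qed

locale killed_network =
  fixes E :: "'v::finite set set" and C :: "'v \<Rightarrow> 'v \<Rightarrow> real" and \<kappa> :: "'v \<Rightarrow> real"
  assumes simple: "simple_graph E"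
    and C_sym: "\<And>x y. C x y = C y x" and C_nonneg: "\<And>x y. 0 \<le> C x y"
    and C_supp: "\<And>x y. {x, y} \<notin> E \<Longrightarrow> C x y = 0"
    and energy_pos: "\<And>f. f \<noteq> (\<lambda>_. 0) \<Longrightarrow> 0 < energy C \<kappa> f"
begin

abbreviation rate :: "'v \<Rightarrow> real" where "rate \<equiv> total_rate C \<kappa>"
abbreviation cond :: "'v set \<Rightarrow> real" where "cond \<equiv> unord C"

lemma edgeE:
  assumes "e \<in> E"
  obtains x y where "e = {x, y}" "x \<noteq> y"
  using assms simple by (auto simp: simple_graph_def card_2_iff)

lemma cond_eq: "cond {x, y} = C x y"
  by (rule unord_eq) (rule C_sym)

lemma cond_nonneg: "e \<in> E \<Longrightarrow> 0 \<le> cond e"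
  by (auto elim!: edgeE simp: cond_eq C_nonneg)

lemma singleton_notin: "{x} \<notin> E"
  using simple by (auto simp: simple_graph_def)

lemma energy_eq: "energy C \<kappa> f = (\<Sum>x\<in>UNIV. rate x * (f x)\<^sup>2) - (\<Sum>x\<in>UNIV. \<Sum>y\<in>UNIV. C x y * (f x * f y))"
proof -
  have "(\<Sum>x\<in>UNIV. \<Sum>y\<in>UNIV. C x y * (f x - f y)\<^sup>2)
    = (\<Sum>x\<in>UNIV. \<Sum>y\<in>UNIV. C x y * (f x)\<^sup>2) + (\<Sum>x\<in>UNIV. \<Sum>y\<in>UNIV. C x y * (f y)\<^sup>2)
      - 2 * (\<Sum>x\<in>UNIV. \<Sum>y\<in>UNIV. C x y * (f x * f y))"
    by (simp add: sum.distrib[symmetric] sum_subtractf[symmetric] sum_distrib_left power2_diff algebra_simps)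
  also have "(\<Sum>x\<in>UNIV. \<Sum>y\<in>UNIV. C x y * (f y)\<^sup>2) = (\<Sum>x\<in>UNIV. \<Sum>y\<in>UNIV. C x y * (f x)\<^sup>2)"
    by (subst sum.swap) (simp add: C_sym)
  finally have sq: "(\<Sum>x\<in>UNIV. \<Sum>y\<in>UNIV. C x y * (f x - f y)\<^sup>2)
    = 2 * (\<Sum>x\<in>UNIV. \<Sum>y\<in>UNIV. C x y * (f x)\<^sup>2) - 2 * (\<Sum>x\<in>UNIV. \<Sum>y\<in>UNIV. C x y * (f x * f y))"
    by simp
  have "(\<Sum>x\<in>UNIV. rate x * (f x)\<^sup>2) = (\<Sum>x\<in>UNIV. \<Sum>y\<in>UNIV. C x y * (f x)\<^sup>2) + (\<Sum>x\<in>UNIV. \<kappa> x * (f x)\<^sup>2)"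
    by (simp add: total_rate_def sum_distrib_right distrib_right sum.distrib)
  then show ?thesis unfolding energy_def sq by simp
qed

text \<open>The energy of the indicator function of \<open>x\<close> equals
  \<open>rate x\<close>.\<close>

lemma rate_pos: "0 < rate x"
proof -
  let ?f = "\<lambda>y. if y = x then 1 else 0 :: real"
  have "?f x \<noteq> (\<lambda>_. 0 :: real) x" by simp
  then have "?f \<noteq> (\<lambda>_. 0)" by metis
  then have "0 < energy C \<kappa> ?f" by (rule energy_pos)
  also have "energy C \<kappa> ?f = rate x"
    using C_supp[of x x] singleton_notin
    by (simp add: energy_eq if_distrib[of "\<lambda>a. a\<^sup>2"] if_distrib[of "\<lambda>a. _ * a"] if_distrib[of "\<lambda>a. a * _"] cong: if_cong)
  finally show ?thesis .
qed

text \<open>Inverse covariance of the Gaussian field after damping the conductances by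
  \<open>s\<close> and replacing the diagonal by \<open>a\<close>. For \<open>s = 1\<close> and
  \<open>a = rate\<close> it is the matrix that \<open>green\<close> inverts.\<close>

definition precision :: "('v set \<Rightarrow> real) \<Rightarrow> ('v \<Rightarrow> real) \<Rightarrow> real^'v^'v" where
  "precision s a = (\<chi> x y. (if x = y then a x else 0) - C x y * s {x, y})"

text \<open>Absolute values increase the interaction and \<open>s\<close> only damps it, so
  positivity of the energy at the absolute value of \<open>\<phi>\<close> bounds both signs at
  once.\<close>

lemma interaction_bound:
  assumes s: "\<And>e. 0 \<le> s e \<and> s e \<le> 1" and a: "\<And>x. rate x \<le> a x" and \<phi>: "\<phi> \<noteq> (0 :: real^'v)"
  shows "\<bar>\<Sum>x\<in>UNIV. \<Sum>y\<in>UNIV. C x y * s {x, y} * (\<phi> $ x * \<phi> $ y)\<bar> < (\<Sum>x\<in>UNIV. a x * (\<phi> $ x)\<^sup>2)"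
proof -
  have "\<bar>\<Sum>x\<in>UNIV. \<Sum>y\<in>UNIV. C x y * s {x, y} * (\<phi> $ x * \<phi> $ y)\<bar>
    \<le> (\<Sum>x\<in>UNIV. \<Sum>y\<in>UNIV. \<bar>C x y * s {x, y} * (\<phi> $ x * \<phi> $ y)\<bar>)"
    by (intro order_trans[OF sum_abs] sum_mono sum_abs)
  also have "\<dots> \<le> (\<Sum>x\<in>UNIV. \<Sum>y\<in>UNIV. C x y * (\<bar>\<phi> $ x\<bar> * \<bar>\<phi> $ y\<bar>))"
    using s C_nonneg by (intro sum_mono) (simp add: abs_mult mult_left_le mult_right_mono)
  also have "\<dots> < (\<Sum>x\<in>UNIV. rate x * \<bar>\<phi> $ x\<bar>\<^sup>2)"
  proof -
    have "(\<lambda>x. \<bar>\<phi> $ x\<bar>) \<noteq> (\<lambda>_. 0)" using \<phi> by (auto simp: vec_eq_iff fun_eq_iff)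
    from energy_pos[OF this] show ?thesis by (simp add: energy_eq)
  qed
  also have "\<dots> \<le> (\<Sum>x\<in>UNIV. a x * (\<phi> $ x)\<^sup>2)" using a by (intro sum_mono) (simp add: mult_right_mono)
  finally show ?thesis .
qed

lemma precision_form:
  "\<phi> \<bullet> (precision s a *v \<phi>) = (\<Sum>x\<in>UNIV. a x * (\<phi> $ x)\<^sup>2) - (\<Sum>x\<in>UNIV. \<Sum>y\<in>UNIV. C x y * s {x, y} * (\<phi> $ x * \<phi> $ y))"
proof -
  have "(precision s a *v \<phi>) $ x = a x * \<phi> $ x - (\<Sum>y\<in>UNIV. C x y * s {x, y} * \<phi> $ y)" for x
    by (simp add: precision_def matrix_vector_mult_def left_diff_distrib sum_subtractf if_distrib[of "\<lambda>a. a * _"] cong: if_cong)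
  then show ?thesis
    by (simp add: inner_vec_def right_diff_distrib sum_subtractf sum_distrib_left power2_eq_square mult_ac)
qed

lemma precision_form_edges:
  "\<phi> \<bullet> (precision s a *v \<phi>) = (\<Sum>x\<in>UNIV. a x * (\<phi> $ x)\<^sup>2) - 2 * (\<Sum>e\<in>E. s e * cond e * (\<Prod>x\<in>e. \<phi> $ x))"
proof -
  have "(\<Sum>x\<in>UNIV. \<Sum>y\<in>UNIV. C x y * s {x, y} * (\<phi> $ x * \<phi> $ y))
    = (\<Sum>x\<in>UNIV. \<Sum>y\<in>UNIV. if {x, y} \<in> E then s {x, y} * cond {x, y} * (\<Prod>z\<in>{x, y}. \<phi> $ z) else 0)"
  proof (intro sum.cong refl)
    fix x y
    show "C x y * s {x, y} * (\<phi> $ x * \<phi> $ y)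
      = (if {x, y} \<in> E then s {x, y} * cond {x, y} * (\<Prod>z\<in>{x, y}. \<phi> $ z) else 0)"
      using C_supp[of x y] singleton_notin[of x] by (cases "x = y") (auto simp: cond_eq)
  qed
  also have "\<dots> = 2 * (\<Sum>e\<in>E. if e \<in> E then s e * cond e * (\<Prod>x\<in>e. \<phi> $ x) else 0)"
    by (rule double_sum_edges[OF simple]) simp
  finally show ?thesis by (simp add: precision_form)
qed

lemma transpose_precision: "transpose (precision s a) = precision s a"
  by (auto simp: precision_def transpose_def vec_eq_iff C_sym insert_commute)

lemma precision_pos:
  assumes "\<And>e. 0 \<le> s e \<and> s e \<le> 1" "\<And>x. rate x \<le> a x" "\<phi> \<noteq> 0"
  shows "0 < \<phi> \<bullet> (precision s a *v \<phi>)"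
  using interaction_bound[of s a \<phi>, OF assms] by (simp add: precision_form abs_less_iff)

lemma det_precision_pos:
  assumes "\<And>e. 0 \<le> s e \<and> s e \<le> 1" "\<And>x. rate x \<le> a x"
  shows "0 < det (precision s a)"
  by (rule posdef_det_pos) (auto simp: transpose_precision precision_pos assms)

text \<open>\<open>Q\<close> need not be symmetric, but conjugation by the diagonal matrix of
  \<open>sqrt (a x)\<close> makes it so without changing traces of powers or the
  determinant.\<close>

lemma sums_trace_transition:
  assumes s: "\<And>e. 0 \<le> s e \<and> s e \<le> 1" and a: "\<And>x. rate x \<le> a x"
  defines "Q \<equiv> (\<chi> x y. C x y * s {x, y} / a x) :: real^'v^'v"
  shows "(\<lambda>n. trace (matpow Q (Suc n)) / real (Suc n)) sums (- ln (det (mat 1 - Q)))"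
    and "det (precision s a) = (\<Prod>x\<in>UNIV. a x) * det (mat 1 - Q)"
proof -
  have a0: "0 < a x" for x using rate_pos[of x] a[of x] by linarith
  define S :: "real^'v^'v" where "S = (\<chi> x y. C x y * s {x, y} / (sqrt (a x) * sqrt (a y)))"
  let ?U = "diag (\<lambda>x. 1 / sqrt (a x))" and ?V = "diag (\<lambda>x. sqrt (a x))"
  have inv: "?V ** ?U = mat 1" "?U ** ?V = mat 1"
    using a0 by (auto simp: vec_eq_iff mat_def diag_mult_entry less_imp_neq[symmetric])
  have sq: "sqrt (a x) * sqrt (a x) = a x" for x using a0[of x] by simp
  have Q: "Q = ?U ** S ** ?V"
    using a0 sq by (simp add: vec_eq_iff diag_conjugate_entry Q_def S_def field_simps less_imp_neq[symmetric])
  have Q1: "mat 1 - Q = ?U ** (mat 1 - S) ** ?V"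
    unfolding Q using a0 by (auto simp: vec_eq_iff diag_conjugate_entry mat_def algebra_simps less_imp_neq[symmetric])
  have "det ?U * det ?V = 1" using arg_cong[OF inv(2), of det] by (simp only: det_mul det_I)
  then have detQ: "det (mat 1 - Q) = det (mat 1 - S)" by (simp add: Q1 det_mul)
  have "(\<lambda>n. trace (matpow S (Suc n)) / real (Suc n)) sums (- ln (det (mat 1 - S)))"
  proof (rule sums_trace_matpow)
    show "transpose S = S"
      unfolding S_def transpose_def vec_eq_iff by (simp add: C_sym insert_commute mult.commute)
    fix \<phi> :: "real^'v" assume \<phi>: "\<phi> \<noteq> 0"
    \<comment> \<open>This rescaling turns the form of \<open>S\<close> into the interaction and the
      Euclidean norm into the diagonal form with entries \<open>a x\<close>.\<close>
    define \<psi> :: "real^'v" where "\<psi> = (\<chi> x. \<phi> $ x / sqrt (a x))"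
    have "\<psi> \<noteq> 0" using \<phi> a0 by (auto simp: \<psi>_def vec_eq_iff less_imp_neq[symmetric])
    from interaction_bound[of s a \<psi>, OF s a this]
    show "\<bar>\<phi> \<bullet> (S *v \<phi>)\<bar> < \<phi> \<bullet> \<phi>"
    proof (rule back_subst)
      have "\<phi> \<bullet> (S *v \<phi>) = (\<Sum>x\<in>UNIV. \<Sum>y\<in>UNIV. C x y * s {x, y} * (\<psi> $ x * \<psi> $ y))"
        by (simp add: inner_vec_def matrix_vector_mult_def S_def \<psi>_def sum_distrib_left divide_inverse mult_ac)
      moreover have "\<phi> \<bullet> \<phi> = (\<Sum>x\<in>UNIV. a x * (\<psi> $ x)\<^sup>2)"
        using a0 by (simp add: inner_vec_def \<psi>_def power_divide less_imp_le less_imp_neq[symmetric] power2_eq_square)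
      ultimately show "(\<bar>\<Sum>x\<in>UNIV. \<Sum>y\<in>UNIV. C x y * s {x, y} * (\<psi> $ x * \<psi> $ y)\<bar> < (\<Sum>x\<in>UNIV. a x * (\<psi> $ x)\<^sup>2))
        = (\<bar>\<phi> \<bullet> (S *v \<phi>)\<bar> < \<phi> \<bullet> \<phi>)" by simp
    qed
  qed
  moreover have "trace (matpow Q n) = trace (matpow S n)" for n
    unfolding Q by (rule trace_matpow_conjugate[OF inv])
  ultimately show "(\<lambda>n. trace (matpow Q (Suc n)) / real (Suc n)) sums (- ln (det (mat 1 - Q)))"
    by (simp add: detQ del: matpow.simps of_nat_Suc)
  have "precision s a = diag a ** (mat 1 - Q)"
    using a0 by (auto simp: vec_eq_iff diag_mult_entry precision_def Q_def mat_def right_diff_distrib less_imp_neq[symmetric])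
  then show "det (precision s a) = (\<Prod>x\<in>UNIV. a x) * det (mat 1 - Q)"
    by (simp add: det_mul det_diag)
qed

abbreviation "det0 \<equiv> det (precision (\<lambda>_. 1) rate)"

lemma det0_pos: "0 < det0"
  by (rule det_precision_pos) auto

lemma det_green: "1 / sqrt (det (green C \<kappa>)) = sqrt det0"
proof -
  have A: "green C \<kappa> = matrix_inv (precision (\<lambda>_. 1) rate)"
    by (simp add: green_def precision_def)
  have "invertible (precision (\<lambda>_. 1) rate)"
    using det0_pos by (simp add: invertible_det_nz)
  then have "precision (\<lambda>_. 1) rate ** green C \<kappa> = mat 1"
    unfolding A invertible_def matrix_inv_def by (rule someI2_ex) simp
  then have "det0 * det (green C \<kappa>) = 1" by (metis det_mul det_I)
  then have "det (green C \<kappa>) = 1 / det0" using det0_pos by (simp add: field_simps)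
  then show ?thesis by (simp add: real_sqrt_divide)
qed

text \<open>The factor 1 is the trivial tilt, so that the matrix matches \<open>Q\<close> of
  \<open>sums_trace_transition\<close>.\<close>

lemma transition_eq: "transition C \<kappa> = (\<chi> x y. C x y * 1 / rate x)"
  by (simp add: transition_def)

lemma det_transition: "det0 = (\<Prod>x\<in>UNIV. rate x) * det (mat 1 - transition C \<kappa>)"
  using sums_trace_transition(2)[of "\<lambda>_. 1" rate] by (simp add: transition_eq)

text \<open>The rate \<open>2 * m x / rate x\<close> per unit of time is \<open>m x\<close> per unit
  of \<open>2 * occupation\<close>. Intensity 1/2 halves the logarithm of the determinant ratio,
  which produces the square roots.\<close>

lemma expectation_loop_functional:
  assumes L: "loop_ensemble M E C \<kappa> (1/2) L"
  shows "(\<integral>\<omega>. nexp (\<integral>\<^sup>+l. loop_functional E j (\<lambda>x. 2 * real (m x) / rate x) l \<partial>L \<omega>) \<partial>M)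
    = sqrt det0 / sqrt (det (precision (\<lambda>e. exp (- real (j e))) (\<lambda>x. rate x + 2 * real (m x))))"
proof -
  let ?P = "transition C \<kappa>"
  let ?\<nu> = "scale_measure (ennreal (1/2)) (loop_measure E ?P)"
  define \<theta> where "\<theta> x = 2 * real (m x) / rate x" for x
  define s :: "'v set \<Rightarrow> real" where "s e = exp (- real (j e))" for e
  define a where "a x = rate x + 2 * real (m x)" for x
  have \<theta>: "0 \<le> \<theta> x" for x using rate_pos[of x] by (simp add: \<theta>_def)
  \<comment> \<open>Dividing by \<open>1 + \<theta> x\<close> in the tilt is thus the same as
    replacing the rate by \<open>a x\<close>, so the tilted matrix is again of the form
    \<open>Q\<close>.\<close>
  have a: "a x = rate x * (1 + \<theta> x)" for x using rate_pos[of x] by (simp add: a_def \<theta>_def field_simps)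
  have s: "0 \<le> s e \<and> s e \<le> 1" for e by (simp add: s_def)
  have ra: "rate x \<le> a x" for x by (simp add: a_def)
  define Q :: "real^'v^'v" where "Q = (\<chi> x y. C x y * s {x, y} / a x)"
  have Q: "tilt E j \<theta> ?P = Q"
    using C_supp by (auto simp: vec_eq_iff tilt_def Q_def transition_def a s_def)
  note sumsQ = sums_trace_transition[of s a, OF s ra, folded Q_def]
  let ?LP = "- ln (det (mat 1 - ?P))" and ?LQ = "- ln (det (mat 1 - Q))"
  have P: "{x, y} \<notin> E \<Longrightarrow> ?P $ x $ y = 0" "0 \<le> ?P $ x $ y" for x y
    using C_supp C_nonneg rate_pos[of x] by (auto simp: transition_def)
  have LP: "(\<lambda>n. trace (matpow ?P (Suc n)) / real (Suc n)) sums ?LP"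
    using sums_trace_transition(1)[of "\<lambda>_. 1" rate] by (simp add: transition_eq)
  have LQ: "(\<lambda>n. trace (matpow (tilt E j \<theta> ?P) (Suc n)) / real (Suc n)) sums ?LQ"
    unfolding Q by (rule sumsQ(1))
  have lap: "?LQ \<le> ?LP" "(\<integral>\<^sup>+l. ennreal (1 - nexp (loop_functional E j \<theta> l)) \<partial>loop_measure E ?P)
      = ennreal ((\<Sum>x\<in>UNIV. ln (1 + \<theta> x)) + (?LP - ?LQ))"
    using laplace_loop_measure[OF simple P \<theta> LP LQ] by blast+
  have sl: "0 \<le> (\<Sum>x\<in>UNIV. ln (1 + \<theta> x))" using \<theta> by (intro sum_nonneg) auto
  interpret poisson_random_measure M ?\<nu> L
    using L by unfold_locales (simp add: loop_ensemble_def)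
  have meas: "loop_functional E j \<theta> \<in> borel_measurable ?\<nu>"
    by (simp add: measurable_cong_sets[OF sets_scale_measure refl])
  have "(\<integral>\<omega>. nexp (\<integral>\<^sup>+l. loop_functional E j \<theta> l \<partial>L \<omega>) \<partial>M)
    = nexp (ennreal (1/2) * ennreal ((\<Sum>x\<in>UNIV. ln (1 + \<theta> x)) + (?LP - ?LQ)))"
    unfolding laplace_functional[OF meas] by (simp add: nn_integral_scale_measure lap(2))
  also have "\<dots> = exp (- (1/2 * ((\<Sum>x\<in>UNIV. ln (1 + \<theta> x)) + (?LP - ?LQ))))"
    using sl lap(1) by (subst ennreal_mult'[symmetric]) (auto intro!: nexp_ennreal)
  also have "\<dots> = sqrt det0 / sqrt (det (precision s a))"
  proof -
    have pr: "0 < (\<Prod>x\<in>UNIV. rate x)" "0 < (\<Prod>x\<in>UNIV. 1 + \<theta> x)"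
      using rate_pos \<theta> by (auto intro!: prod_pos add_pos_nonneg)
    have dP: "det0 = (\<Prod>x\<in>UNIV. rate x) * det (mat 1 - ?P)" by (rule det_transition)
    have dQ: "det (precision s a) = (\<Prod>x\<in>UNIV. rate x) * (\<Prod>x\<in>UNIV. 1 + \<theta> x) * det (mat 1 - Q)"
      using sumsQ(2) by (simp add: a prod.distrib)
    have pos: "0 < det (mat 1 - ?P)" "0 < det (mat 1 - Q)"
      using det0_pos det_precision_pos[of s a, OF s ra] pr mult_pos_pos[OF pr]
      unfolding dP dQ by (auto simp: zero_less_mult_iff)
    have sum_ln: "(\<Sum>x\<in>UNIV. ln (1 + \<theta> x)) = ln (\<Prod>x\<in>UNIV. 1 + \<theta> x)"
      using \<theta> by (intro ln_prod[symmetric]) (auto, metis add_pos_nonneg less_irrefl zero_less_one)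
    have "(\<Sum>x\<in>UNIV. ln (1 + \<theta> x)) + (?LP - ?LQ) = - ln (det0 / det (precision s a))"
    proof -
      \<comment> \<open>Here \<open>r\<close> is the product of the rates, common to both precision
        determinants, and \<open>t\<close> is the contribution of the one-point loops.\<close>
      have "ln t + (- ln p - - ln q) = - ln (r * p / (r * t * q))" if "0 < r" "0 < t" "0 < p" "0 < q" for r t p q :: real
        using that by (simp add: ln_mult ln_div)
      from this[OF pr pos] show ?thesis unfolding dP dQ sum_ln .
    qed
    then have "exp (- (1/2 * ((\<Sum>x\<in>UNIV. ln (1 + \<theta> x)) + (?LP - ?LQ)))) = exp (ln (det0 / det (precision s a)) / 2)"
      by simp
    also have "\<dots> = exp (ln (sqrt (det0 / det (precision s a))))"
      using det0_pos det_precision_pos[of s a, OF s ra] by (simp add: ln_sqrt)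
    also have "\<dots> = sqrt (det0 / det (precision s a))"
      using det0_pos det_precision_pos[of s a, OF s ra] by (subst exp_ln) auto
    finally show ?thesis by (simp add: real_sqrt_divide)
  qed
  finally show ?thesis unfolding \<theta>_def s_def a_def .
qed

end

subsection \<open>The joint density of network and field\<close>

lemma countable_even_networks: "countable (even_networks (E :: 'v::finite set set))"
proof (rule countable_subset)
  show "even_networks E \<subseteq> PiE E (\<lambda>_. UNIV)" by (auto simp: even_networks_def)
  show "countable (PiE E (\<lambda>_. UNIV :: nat set))" by (intro countable_PiE) auto
qed

context killed_network
begin

definition dens :: "('v set \<Rightarrow> nat) \<Rightarrow> real^'v \<Rightarrow> real" where
  "dens k \<rho> = 1 / sqrt (det (green C \<kappa>))
    * (\<Prod>e\<in>E. unord (\<lambda>x y. sqrt (\<rho> $ x) * C x y * sqrt (\<rho> $ y)) e ^ k e / fact (k e))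
    * (\<Prod>x\<in>UNIV. 1 / sqrt (2 * pi * \<rho> $ x) * exp (- 1/2 * rate x * \<rho> $ x))"

abbreviation nonneg_vec :: "(real^'v) set" where
  "nonneg_vec \<equiv> {\<rho>. \<forall>x. 0 \<le> \<rho> $ x}"

abbreviation joint_dens :: "('v set \<Rightarrow> nat) \<Rightarrow> real^'v \<Rightarrow> ennreal" where
  "joint_dens k \<rho> \<equiv> ennreal (dens k \<rho>) * indicator nonneg_vec \<rho>"

abbreviation "networks \<equiv> count_space (even_networks E)"

text \<open>The term of index \<open>k\<close> in the expansion of the exponential interaction with
  edge weights \<open>b\<close>, taken at the absolute values of the field.\<close>

definition network_weight :: "('v set \<Rightarrow> real) \<Rightarrow> ('v set \<Rightarrow> nat) \<Rightarrow> real^'v \<Rightarrow> real" where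
  "network_weight b k \<phi> = (\<Prod>e\<in>E. (b e * (\<Prod>x\<in>e. \<bar>\<phi> $ x\<bar>)) ^ k e / fact (k e))"

lemma unord_sqrt:
  assumes "e \<in> E"
  shows "unord (\<lambda>x y. sqrt (\<rho> $ x) * C x y * sqrt (\<rho> $ y)) e = cond e * (\<Prod>x\<in>e. sqrt (\<rho> $ x))"
proof -
  obtain x y where e: "e = {x, y}" "x \<noteq> y" using edgeE[OF assms] .
  have "unord (\<lambda>x y. sqrt (\<rho> $ x) * C x y * sqrt (\<rho> $ y)) {x, y} = sqrt (\<rho> $ x) * C x y * sqrt (\<rho> $ y)"
    by (rule unord_eq) (simp add: C_sym mult_ac)
  then show ?thesis using e by (simp add: cond_eq)
qed

lemma network_weight_nonneg:
  assumes "\<And>e. e \<in> E \<Longrightarrow> 0 \<le> b e"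
  shows "0 \<le> network_weight b k \<phi>"
  unfolding network_weight_def using assms
  by (intro prod_nonneg divide_nonneg_nonneg zero_le_power mult_nonneg_nonneg) auto

lemma measurable_network_weight [measurable]: "network_weight b k \<in> borel_measurable borel"
  unfolding network_weight_def by measurable

lemma dens_eq:
  "dens k \<rho> = sqrt det0 * (\<Prod>e\<in>E. (cond e * (\<Prod>x\<in>e. sqrt (\<rho> $ x))) ^ k e / fact (k e))
    * (\<Prod>x\<in>UNIV. 1 / sqrt (2 * pi * \<rho> $ x) * exp (- 1/2 * rate x * \<rho> $ x))"
  unfolding dens_def det_green by (simp add: unord_sqrt)

lemma measurable_dens [measurable]: "dens k \<in> borel_measurable borel"
  unfolding dens_eq by measurable

lemma dens_cong: "(\<And>e. e \<in> E \<Longrightarrow> k e = k' e) \<Longrightarrow> dens k \<rho> = dens k' \<rho>"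
  by (simp add: dens_def)

lemma measurable_nonneg_vec [measurable]: "nonneg_vec \<in> sets borel"
proof -
  have "{\<rho> \<in> space (borel :: (real^'v) measure). \<forall>x. 0 \<le> \<rho> $ x} \<in> sets borel" by measurable
  then show ?thesis by simp
qed

text \<open>Separates the density into the Jacobian of squaring, a network term and a Gaussian
  factor; the test factor with exponents \<open>m\<close> merges into the latter by raising each
  rate by \<open>2 * m x\<close>.\<close>

lemma dens_square_weight:
  "joint_dens k \<rho> * ennreal (exp (- (\<Sum>x\<in>UNIV. m x * \<rho> $ x)))
    = ennreal (sqrt det0 / sqrt (2 * pi) ^ CARD('v)) * (ennreal (network_weight cond k (\<chi> x. sqrt (\<rho> $ x)))
      * ennreal (exp (- (1/2) * (\<Sum>x\<in>UNIV. (rate x + 2 * m x) * \<rho> $ x)))) * (\<Prod>x\<in>UNIV. square_weight (\<rho> $ x))"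
proof (cases "\<rho> \<in> nonneg_vec")
  case True
  then have \<rho>: "0 \<le> \<rho> $ x" for x by simp
  let ?w = "network_weight cond k (\<chi> x. sqrt (\<rho> $ x))"
  have w0: "0 \<le> ?w" by (intro network_weight_nonneg cond_nonneg)
  \<comment> \<open>At 0 the two sides agree because \<open>1 / sqrt 0 = 0\<close>, so no null set
    has to be removed.\<close>
  have sw: "square_weight (\<rho> $ x) = ennreal (1 / sqrt (\<rho> $ x))" for x
    using \<rho>[of x] by (cases "\<rho> $ x = 0") (auto simp: square_weight_def)
  have psw: "(\<Prod>x\<in>UNIV. square_weight (\<rho> $ x)) = ennreal (\<Prod>x\<in>UNIV. 1 / sqrt (\<rho> $ x))"
    unfolding sw using \<rho> by (intro prod_ennreal) auto
  have "(\<Prod>x\<in>UNIV. 1 / sqrt (2 * pi * \<rho> $ x) * exp (- 1/2 * rate x * \<rho> $ x))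
    = (\<Prod>x\<in>(UNIV :: 'v set). 1 / sqrt (2 * pi)) * (\<Prod>x\<in>UNIV. 1 / sqrt (\<rho> $ x)) * (\<Prod>x\<in>UNIV. exp (- 1/2 * rate x * \<rho> $ x))"
    unfolding prod.distrib[symmetric] by (simp add: real_sqrt_mult)
  also have "(\<Prod>x\<in>(UNIV :: 'v set). 1 / sqrt (2 * pi)) = 1 / sqrt (2 * pi) ^ CARD('v)"
    by (simp add: power_one_over)
  also have "(\<Prod>x\<in>UNIV. exp (- 1/2 * rate x * \<rho> $ x)) = exp (\<Sum>x\<in>UNIV. - 1/2 * rate x * \<rho> $ x)"
    by (simp add: exp_sum)
  finally have d: "dens k \<rho> = sqrt det0 / sqrt (2 * pi) ^ CARD('v) * ?w * exp (\<Sum>x\<in>UNIV. - 1/2 * rate x * \<rho> $ x)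
      * (\<Prod>x\<in>UNIV. 1 / sqrt (\<rho> $ x))"
    using \<rho> by (simp add: dens_eq network_weight_def mult_ac)
  have e: "exp (\<Sum>x\<in>UNIV. - 1/2 * rate x * \<rho> $ x) * exp (- (\<Sum>x\<in>UNIV. m x * \<rho> $ x))
    = exp (- (1/2) * (\<Sum>x\<in>UNIV. (rate x + 2 * m x) * \<rho> $ x))"
    by (simp add: exp_add[symmetric] sum_distrib_left sum_negf[symmetric] sum.distrib[symmetric] distrib_right add_divide_distrib)
  have p0: "0 \<le> (\<Prod>x\<in>UNIV. 1 / sqrt (\<rho> $ x))" using \<rho> by (intro prod_nonneg) auto
  have d0: "0 \<le> sqrt det0 / sqrt (2 * pi) ^ CARD('v)" using det0_pos by simp
  have "dens k \<rho> * exp (- (\<Sum>x\<in>UNIV. m x * \<rho> $ x)) = sqrt det0 / sqrt (2 * pi) ^ CARD('v) * (?w *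
      exp (- (1/2) * (\<Sum>x\<in>UNIV. (rate x + 2 * m x) * \<rho> $ x))) * (\<Prod>x\<in>UNIV. 1 / sqrt (\<rho> $ x))"
    unfolding d e[symmetric] by (simp only: mult_ac)
  then have "ennreal (dens k \<rho>) * ennreal (exp (- (\<Sum>x\<in>UNIV. m x * \<rho> $ x)))
    = ennreal (sqrt det0 / sqrt (2 * pi) ^ CARD('v)) * (ennreal ?w *
      ennreal (exp (- (1/2) * (\<Sum>x\<in>UNIV. (rate x + 2 * m x) * \<rho> $ x)))) * ennreal (\<Prod>x\<in>UNIV. 1 / sqrt (\<rho> $ x))"
    using w0 p0 d0 by (simp only: ennreal_mult'[symmetric] ennreal_mult''[symmetric] exp_ge_zero mult_nonneg_nonneg)
  then show ?thesis using True psw by simp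
next
  case False
  then obtain x where "\<rho> $ x < 0" by (auto simp: not_le)
  then have "square_weight (\<rho> $ x) = 0" by (simp add: square_weight_def)
  then have "(\<Prod>x\<in>UNIV. square_weight (\<rho> $ x)) = 0" by (intro prod_zero) auto
  then show ?thesis using False by simp
qed

lemma nn_integral_dens:
  "(\<integral>\<^sup>+\<rho>. joint_dens k \<rho> * ennreal (exp (- (\<Sum>x\<in>UNIV. m x * \<rho> $ x))) \<partial>lborel)
    = ennreal (sqrt det0 / sqrt (2 * pi) ^ CARD('v)) * (\<integral>\<^sup>+\<phi>. ennreal (network_weight cond k \<phi>)
      * ennreal (exp (- (1/2) * (\<Sum>x\<in>UNIV. (rate x + 2 * m x) * (\<phi> $ x)\<^sup>2))) \<partial>lborel)"
proof -
  have nw: "network_weight cond k (\<chi> x. sqrt ((\<chi> x. (\<phi> $ x)\<^sup>2) $ x)) = network_weight cond k \<phi>" for \<phi>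
    by (simp add: network_weight_def)
  show ?thesis unfolding dens_square_weight
    by (subst nn_integral_square_vec, measurable, subst nn_integral_cmult, measurable) (simp add: nw network_weight_def)
qed

text \<open>The sum over even networks is the sign average of the exponential interaction, and that
  average does not change the integral. What remains is the Gaussian integral of
  \<open>precision s a\<close>.\<close>

lemma nn_integral_network_gaussian:
  assumes s: "\<And>e. 0 \<le> s e \<and> s e \<le> 1" and a: "\<And>x. rate x \<le> a x"
  shows "(\<integral>\<^sup>+\<phi>. (\<integral>\<^sup>+k. ennreal (network_weight (\<lambda>e. s e * cond e) k \<phi>) \<partial>networks)
      * ennreal (exp (- (1/2) * (\<Sum>x\<in>UNIV. a x * (\<phi> $ x)\<^sup>2))) \<partial>lborel)
    = ennreal (sqrt (2 * pi) ^ CARD('v) / sqrt (det (precision s a)))"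
proof -
  let ?G = "\<lambda>\<phi>. (\<integral>\<^sup>+k. ennreal (network_weight (\<lambda>e. s e * cond e) k \<phi>) \<partial>networks)
      * ennreal (exp (- (1/2) * (\<Sum>x\<in>UNIV. a x * (\<phi> $ x)\<^sup>2)))"
  let ?F = "\<lambda>\<phi>. ennreal (exp (- (1/2) * (\<phi> \<bullet> (precision s a *v \<phi>))))"
  have b: "e \<in> E \<Longrightarrow> 0 \<le> s e * cond e" for e using s[of e] cond_nonneg[of e] by auto
  have F: "?F (\<chi> x. \<sigma> x * \<phi> $ x) = ennreal (exp (\<Sum>e\<in>E. s e * cond e * (\<Prod>x\<in>e. \<sigma> x * \<phi> $ x)))
      * ennreal (exp (- (1/2) * (\<Sum>x\<in>UNIV. a x * (\<phi> $ x)\<^sup>2)))" if "\<sigma> \<in> signs" for \<sigma> \<phi>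
  proof -
    have sq: "(\<sigma> x * \<phi> $ x)\<^sup>2 = (\<phi> $ x)\<^sup>2" for x
    proof -
      have "\<sigma> x = 1 \<or> \<sigma> x = -1" using that by (auto simp: PiE_iff)
      then show ?thesis by auto
    qed
    have ex: "exp (- (1/2) * (X - 2 * Y)) = exp Y * exp (- (1/2) * X)" for X Y :: real
      by (simp add: exp_add[symmetric] diff_divide_distrib)
    show ?thesis
      by (simp only: precision_form_edges vec_lambda_beta sq ex ennreal_mult' exp_ge_zero)
  qed
  have [measurable]: "?F \<in> borel_measurable borel"
    unfolding precision_form by measurable
  \<comment> \<open>Since the networks are countable, joint measurability needs to be checked only
    for each fixed network.\<close>
  have mG: "(\<lambda>\<phi>. \<integral>\<^sup>+k. ennreal (network_weight (\<lambda>e. s e * cond e) k \<phi>) \<partial>networks) \<in> borel_measurable borel"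
  proof -
    interpret sigma_finite_measure "networks"
      by (rule sigma_finite_measure_count_space_countable[OF countable_even_networks])
    have "(\<lambda>(k, \<phi>). ennreal (network_weight (\<lambda>e. s e * cond e) k \<phi>)) \<in> borel_measurable (networks \<Otimes>\<^sub>M borel)"
      by (rule measurable_pair_measure_countable1[OF countable_even_networks]) simp
    from measurable_pair_swap[OF this]
    have "(\<lambda>(\<phi>, k). ennreal (network_weight (\<lambda>e. s e * cond e) k \<phi>)) \<in> borel_measurable (borel \<Otimes>\<^sub>M networks)"
      by simp
    from borel_measurable_nn_integral[OF this] show ?thesis by simp
  qed
  have "2 ^ CARD('v) * (\<integral>\<^sup>+\<phi>. ?G \<phi> \<partial>lborel) = (\<integral>\<^sup>+\<phi>. 2 ^ CARD('v) * ?G \<phi> \<partial>lborel)"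
    using mG by (intro nn_integral_cmult[symmetric]) auto
  also have "\<dots> = (\<integral>\<^sup>+\<phi>. (\<Sum>\<sigma>\<in>signs. ?F (\<chi> x. \<sigma> x * \<phi> $ x)) \<partial>lborel)"
  proof (rule nn_integral_cong)
    fix \<phi> :: "real^'v"
    have "2 ^ CARD('v) * ?G \<phi> = ennreal (\<Sum>\<sigma>\<in>signs. exp (\<Sum>e\<in>E. s e * cond e * (\<Prod>x\<in>e. \<sigma> x * \<phi> $ x)))
      * ennreal (exp (- (1/2) * (\<Sum>x\<in>UNIV. a x * (\<phi> $ x)\<^sup>2)))"
    proof -
      have "ennreal (\<Sum>\<sigma>\<in>signs. exp (\<Sum>e\<in>E. s e * cond e * (\<Prod>x\<in>e. \<sigma> x * \<phi> $ x)))
        = 2 ^ CARD('v) * (\<integral>\<^sup>+k. ennreal (network_weight (\<lambda>e. s e * cond e) k \<phi>) \<partial>networks)"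
        unfolding network_weight_def by (rule sum_signs_exp) (rule b)
      then show ?thesis by (simp only: mult.assoc)
    qed
    also have "\<dots> = (\<Sum>\<sigma>\<in>signs. ?F (\<chi> x. \<sigma> x * \<phi> $ x))"
      by (subst sum_ennreal[symmetric], simp, unfold sum_distrib_right) (intro sum.cong refl F[symmetric])
    finally show "2 ^ CARD('v) * ?G \<phi> = (\<Sum>\<sigma>\<in>signs. ?F (\<chi> x. \<sigma> x * \<phi> $ x))" .
  qed
  also have "\<dots> = 2 ^ CARD('v) * (\<integral>\<^sup>+\<phi>. ?F \<phi> \<partial>lborel)"
    by (rule nn_integral_signs[symmetric]) measurable
  also have "(\<integral>\<^sup>+\<phi>. ?F \<phi> \<partial>lborel) = ennreal (sqrt (2 * pi) ^ CARD('v) / sqrt (det (precision s a)))"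
    by (intro nn_integral_gaussian_posdef transpose_precision precision_pos[of s a] s a)
  \<comment> \<open>The common factor \<open>2 ^ CARD('v)\<close>, the number of sign patterns, is
    positive and finite and cancels.\<close>
  finally show ?thesis by (simp add: ennreal_mult_cancel_left power_eq_top_ennreal)
qed

text \<open>The powers of \<open>s\<close> are absorbed into the conductances and the exponents
  \<open>m\<close> into the rates; the powers of \<open>sqrt (2 * pi)\<close> then cancel against
  the Gaussian integral.\<close>

lemma moments_dens:
  assumes s: "\<And>e. 0 \<le> s e \<and> s e \<le> 1" and m: "\<And>x. 0 \<le> m x"
  shows "(\<integral>\<^sup>+k. (\<integral>\<^sup>+\<rho>. joint_dens k \<rho> *
      ennreal ((\<Prod>e\<in>E. s e ^ k e) * exp (- (\<Sum>x\<in>UNIV. m x * \<rho> $ x))) \<partial>lborel) \<partial>networks)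
    = ennreal (sqrt det0 / sqrt (det (precision s (\<lambda>x. rate x + 2 * m x))))"
proof -
  let ?K = "networks" and ?w = "\<lambda>k \<phi>. ennreal (network_weight (\<lambda>e. s e * cond e) k \<phi>)"
  let ?c = "ennreal (sqrt det0 / sqrt (2 * pi) ^ CARD('v))"
  let ?g = "\<lambda>\<phi> :: real^'v. ennreal (exp (- (1/2) * (\<Sum>x\<in>UNIV. (rate x + 2 * m x) * (\<phi> $ x)\<^sup>2)))"
  interpret K: sigma_finite_measure ?K
    by (rule sigma_finite_measure_count_space_countable[OF countable_even_networks])
  interpret pair_sigma_finite ?K "lborel :: (real^'v) measure" ..
  have sk: "0 \<le> (\<Prod>e\<in>E. s e ^ k e)" for k using s by (intro prod_nonneg) auto
  have nw: "(\<Prod>e\<in>E. s e ^ k e) * network_weight cond k \<phi> = network_weight (\<lambda>e. s e * cond e) k \<phi>" for k \<phi>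
    by (simp add: network_weight_def prod.distrib[symmetric] power_mult_distrib mult_ac)
  have "(\<integral>\<^sup>+\<rho>. joint_dens k \<rho> *
      ennreal ((\<Prod>e\<in>E. s e ^ k e) * exp (- (\<Sum>x\<in>UNIV. m x * \<rho> $ x))) \<partial>lborel)
    = ?c * (\<integral>\<^sup>+\<phi>. ?w k \<phi> * ?g \<phi> \<partial>lborel)" for k
  proof -
    have "(\<integral>\<^sup>+\<rho>. joint_dens k \<rho> *
        ennreal ((\<Prod>e\<in>E. s e ^ k e) * exp (- (\<Sum>x\<in>UNIV. m x * \<rho> $ x))) \<partial>lborel)
      = (\<integral>\<^sup>+\<rho>. ennreal (\<Prod>e\<in>E. s e ^ k e) * (joint_dens k \<rho> *
        ennreal (exp (- (\<Sum>x\<in>UNIV. m x * \<rho> $ x)))) \<partial>lborel)"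
      using sk by (intro nn_integral_cong) (simp add: ennreal_mult' mult_ac)
    also have "\<dots> = ennreal (\<Prod>e\<in>E. s e ^ k e) * (?c * (\<integral>\<^sup>+\<phi>. ennreal (network_weight cond k \<phi>) * ?g \<phi> \<partial>lborel))"
      by (subst nn_integral_cmult) (auto simp: nn_integral_dens)
    also have "\<dots> = ?c * (\<integral>\<^sup>+\<phi>. ennreal (\<Prod>e\<in>E. s e ^ k e) * (ennreal (network_weight cond k \<phi>) * ?g \<phi>) \<partial>lborel)"
      by (subst nn_integral_cmult) (auto simp: mult_ac)
    also have "\<dots> = ?c * (\<integral>\<^sup>+\<phi>. ?w k \<phi> * ?g \<phi> \<partial>lborel)"
      unfolding nw[symmetric] using sk by (simp add: ennreal_mult' mult.assoc)
    finally show ?thesis .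
  qed
  then have "(\<integral>\<^sup>+k. (\<integral>\<^sup>+\<rho>. joint_dens k \<rho> *
      ennreal ((\<Prod>e\<in>E. s e ^ k e) * exp (- (\<Sum>x\<in>UNIV. m x * \<rho> $ x))) \<partial>lborel) \<partial>?K)
    = ?c * (\<integral>\<^sup>+k. (\<integral>\<^sup>+\<phi>. ?w k \<phi> * ?g \<phi> \<partial>lborel) \<partial>?K)"
    by (simp add: nn_integral_cmult)
  also have "(\<integral>\<^sup>+k. (\<integral>\<^sup>+\<phi>. ?w k \<phi> * ?g \<phi> \<partial>lborel) \<partial>?K)
    = (\<integral>\<^sup>+\<phi>. (\<integral>\<^sup>+k. ?w k \<phi> * ?g \<phi> \<partial>?K) \<partial>lborel)"
    by (rule Fubini'[symmetric]) (rule measurable_pair_measure_countable1[OF countable_even_networks], simp)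
  also have "\<dots> = (\<integral>\<^sup>+\<phi>. (\<integral>\<^sup>+k. ?w k \<phi> \<partial>?K) * ?g \<phi> \<partial>lborel)"
    by (intro nn_integral_cong nn_integral_multc) simp
  also have "\<dots> = ennreal (sqrt (2 * pi) ^ CARD('v) / sqrt (det (precision s (\<lambda>x. rate x + 2 * m x))))"
    by (rule nn_integral_network_gaussian) (use s m in auto)
  finally show ?thesis using det0_pos by (simp add: ennreal_mult'[symmetric] less_imp_le)
qed

end

subsection \<open>The joint law\<close>

text \<open>The coordinates of non-edges carry no information and are set to \<open>1\<close>.\<close>

definition field_code :: "'v::finite set set \<Rightarrow> ('v set \<Rightarrow> real) \<Rightarrow> ('v \<Rightarrow> real) \<Rightarrow> real^('v set + 'v)" where
  "field_code E N \<rho> = (\<chi> i. case i of Inl e \<Rightarrow> if e \<in> E then N e else 1 | Inr x \<Rightarrow> \<rho> x)"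

lemma field_code_nth [simp]:
  "field_code E N \<rho> $ Inl e = (if e \<in> E then N e else 1)" "field_code E N \<rho> $ Inr x = \<rho> x"
  by (simp_all add: field_code_def)

lemma prod_UNIV_sum:
  "(\<Prod>i\<in>(UNIV :: ('a::finite + 'b::finite) set). f i) = (\<Prod>a\<in>UNIV. f (Inl a)) * (\<Prod>b\<in>UNIV. f (Inr b) :: 'c :: comm_monoid_mult)"
  by (simp add: UNIV_Plus_UNIV[symmetric] prod.Plus o_def del: UNIV_Plus_UNIV)

lemma moment_field_code:
  "(\<Prod>i\<in>UNIV. field_code E N \<rho> $ i ^ j i) = (\<Prod>e\<in>E. N e ^ j (Inl e)) * (\<Prod>x\<in>UNIV. \<rho> x ^ j (Inr x))"
proof -
  have "(\<Prod>e\<in>UNIV. (if e \<in> E then N e else 1) ^ j (Inl e)) = (\<Prod>e\<in>UNIV. if e \<in> E then N e ^ j (Inl e) else 1)"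
    by (intro prod.cong) auto
  also have "\<dots> = (\<Prod>e\<in>E. N e ^ j (Inl e))" by (simp add: prod.If_cases)
  finally show ?thesis by (simp add: prod_UNIV_sum)
qed

lemma measurable_field_code [measurable (raw)]:
  assumes "\<And>e. e \<in> E \<Longrightarrow> (\<lambda>w. N w e) \<in> borel_measurable M" "\<And>x. (\<lambda>w. \<rho> w x) \<in> borel_measurable M"
  shows "(\<lambda>w. field_code E (N w) (\<rho> w)) \<in> M \<rightarrow>\<^sub>M borel"
  unfolding field_code_def
proof (rule measurable_vec_lambda)
  fix i :: "'a set + 'a"
  show "(\<lambda>w. case i of Inl e \<Rightarrow> if e \<in> E then N w e else 1 | Inr x \<Rightarrow> \<rho> w x) \<in> borel_measurable M"
  proof (cases i)
    case (Inl e)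
    then show ?thesis using assms(1)[of e] by (cases "e \<in> E") auto
  qed (use assms(2) in auto)
qed

lemma field_code_mem_cbox:
  assumes "\<And>e. e \<in> E \<Longrightarrow> 0 \<le> N e \<and> N e \<le> 1" "\<And>x. 0 \<le> \<rho> x \<and> \<rho> x \<le> 1"
  shows "field_code E N \<rho> \<in> cbox 0 1"
  unfolding mem_box_cart
proof
  fix i show "0 $ i \<le> field_code E N \<rho> $ i \<and> field_code E N \<rho> $ i \<le> 1 $ i"
    using assms by (cases i) auto
qed

context killed_network
begin

abbreviation encode :: "('v set \<Rightarrow> nat) \<Rightarrow> real^'v \<Rightarrow> real^('v set + 'v)" where
  "encode k \<rho> \<equiv> field_code E (\<lambda>e. exp (- real (k e))) (\<lambda>x. exp (- (\<rho> $ x)))"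

text \<open>The candidate law, built from the claimed densities of all even networks together and
  carried to the cube by the coding.\<close>

definition network_field_law :: "(real^('v set + 'v)) measure" where
  "network_field_law = distr
     (density (networks \<Otimes>\<^sub>M lborel) (case_prod joint_dens))
     borel (\<lambda>(k, \<rho>). encode k \<rho>)"

lemma sets_network_field_law: "sets network_field_law = sets borel"
  by (simp add: network_field_law_def)

lemma nn_integral_network_field_law:
  assumes [measurable]: "g \<in> borel_measurable borel"
  shows "(\<integral>\<^sup>+z. g z \<partial>network_field_law) = (\<integral>\<^sup>+k. (\<integral>\<^sup>+\<rho>. joint_dens k \<rho> *
      g (encode k \<rho>) \<partial>lborel) \<partial>networks)"
proof -
  let ?K = "networks"
  let ?c = "\<lambda>(k, \<rho>). encode k \<rho>"
  let ?d = "case_prod joint_dens"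
  have [measurable]: "?c \<in> ?K \<Otimes>\<^sub>M lborel \<rightarrow>\<^sub>M borel"
    by (rule measurable_pair_measure_countable1[OF countable_even_networks]) simp
  have [measurable]: "?d \<in> borel_measurable (?K \<Otimes>\<^sub>M lborel)"
    by (rule measurable_pair_measure_countable1[OF countable_even_networks]) simp
  have "(\<integral>\<^sup>+z. g z \<partial>network_field_law) = (\<integral>\<^sup>+p. ?d p * g (?c p) \<partial>(?K \<Otimes>\<^sub>M lborel))"
    unfolding network_field_law_def by (subst nn_integral_distr, measurable, subst nn_integral_density) auto
  also have "\<dots> = (\<integral>\<^sup>+k. \<integral>\<^sup>+\<rho>. ?d (k, \<rho>) * g (?c (k, \<rho>)) \<partial>lborel \<partial>?K)"
    by (rule lborel.nn_integral_fst[symmetric]) measurable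
  finally show ?thesis by simp
qed

lemma moments_network_field_law:
  "(\<integral>\<^sup>+z. ennreal (\<Prod>i\<in>UNIV. z $ i ^ j i) \<partial>network_field_law) =
    ennreal (sqrt det0 / sqrt (det (precision (\<lambda>e. exp (- real (j (Inl e)))) (\<lambda>x. rate x + 2 * real (j (Inr x))))))"
proof -
  have "(\<Prod>i\<in>UNIV. encode k \<rho> $ i ^ j i)
    = (\<Prod>e\<in>E. exp (- real (j (Inl e))) ^ k e) * exp (- (\<Sum>x\<in>UNIV. real (j (Inr x)) * \<rho> $ x))" for k \<rho>
    unfolding moment_field_code
    by (simp add: exp_of_nat_mult[symmetric] exp_sum sum_negf[symmetric] mult.commute)
  then show ?thesis
    by (subst nn_integral_network_field_law, measurable) (simp add: moments_dens)
qed

lemma AE_network_field_law: "AE z in network_field_law. z \<in> cbox 0 1"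
proof -
  have "emeasure network_field_law (- cbox 0 1) = (\<integral>\<^sup>+z. indicator (- cbox 0 1) z \<partial>network_field_law)"
    by (simp add: sets_network_field_law)
  also have "\<dots> = (\<integral>\<^sup>+k. (\<integral>\<^sup>+\<rho>. 0 \<partial>(lborel :: (real^'v) measure)) \<partial>networks)"
  proof (subst nn_integral_network_field_law, measurable, intro nn_integral_cong)
    fix k :: "'v set \<Rightarrow> nat" and \<rho> :: "real^'v"
    show "joint_dens k \<rho> *
      indicator (- cbox 0 1) (encode k \<rho>) = 0"
    proof (cases "\<rho> \<in> nonneg_vec")
      case True
      then have "encode k \<rho> \<in> cbox 0 1"
        by (intro field_code_mem_cbox) auto
      then show ?thesis by simp
    qed simp
  qed
  finally have "emeasure network_field_law (- cbox 0 1) = 0" by simp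
  then show ?thesis
    by (intro AE_I[where N="- cbox 0 1"]) (auto simp: sets_network_field_law)
qed

text \<open>The mass is the moment of order zero, where both determinants are
  \<open>det0\<close>.\<close>

lemma emeasure_space_network_field_law: "emeasure network_field_law (space network_field_law) = 1"
proof -
  have "emeasure network_field_law (space network_field_law) = (\<integral>\<^sup>+z. ennreal (\<Prod>i\<in>UNIV. z $ i ^ (\<lambda>_. 0) i) \<partial>network_field_law)"
    by simp
  also have "\<dots> = 1" unfolding moments_network_field_law using det0_pos by simp
  finally show ?thesis .
qed

lemma edge_jumps_eq:
  assumes sets: "sets \<Lambda> = sets (loop_measure E P)" and e: "e \<in> E"
  shows "edge_jumps \<Lambda> e = (\<integral>\<^sup>+l. of_nat (loop_edges e l) \<partial>\<Lambda>)"
proof -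
  obtain x y where xy: "e = {x, y}" "x \<noteq> y" using edgeE[OF e] .
  have [measurable]: "loop_jumps a b \<in> \<Lambda> \<rightarrow>\<^sub>M count_space UNIV" for a b
    using measurable_loop_jumps[of a b E P] by (simp add: measurable_cong_sets[OF sets refl])
  have "edge_jumps \<Lambda> e = jumps \<Lambda> x y + jumps \<Lambda> y x"
    unfolding edge_jumps_def xy by (rule unord_eq) (simp add: add.commute)
  also have "\<dots> = (\<integral>\<^sup>+l. of_nat (loop_edges e l) \<partial>\<Lambda>)"
    unfolding jumps_def xy loop_edges_doubleton[OF xy(2)] by (subst nn_integral_add[symmetric]) auto
  finally show ?thesis .
qed

text \<open>Identifies the Laplace transform of the ensemble with the monomials in the coordinates
  of the code.\<close>

lemma nexp_loop_functional_ensemble: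
  assumes sets: "sets \<Lambda> = sets (loop_measure E P)"
  shows "nexp (\<integral>\<^sup>+l. loop_functional E j (\<lambda>x. 2 * real (m x) / rate x) l \<partial>\<Lambda>)
    = (\<Prod>e\<in>E. nexp (edge_jumps \<Lambda> e) ^ j e) * (\<Prod>x\<in>UNIV. nexp (2 * occupation C \<kappa> \<Lambda> x) ^ m x)"
proof -
  have [measurable]: "loop_edges e \<in> \<Lambda> \<rightarrow>\<^sub>M count_space UNIV" "loop_time x \<in> borel_measurable \<Lambda>" for e x
    using measurable_loop_edges[of e E P] measurable_loop_time[of x E P]
    by (simp_all add: measurable_cong_sets[OF sets refl])
  have occ: "ennreal (2 * real (m x) / rate x) * (\<integral>\<^sup>+l. ennreal (loop_time x l) \<partial>\<Lambda>) = of_nat (m x) * (2 * occupation C \<kappa> \<Lambda> x)" for x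
  proof -
    have "ennreal (2 * real (m x) / rate x) = of_nat (m x) * 2 * inverse (ennreal (rate x))"
      using rate_pos[of x]
      by (simp add: inverse_ennreal ennreal_of_nat_eq_real_of_nat divide_inverse ennreal_mult[symmetric]
          ennreal_numeral[symmetric] mult_ac del: ennreal_numeral)
    then show ?thesis by (simp add: occupation_def divide_ennreal_def mult_ac)
  qed
  have "(\<integral>\<^sup>+l. loop_functional E j (\<lambda>x. 2 * real (m x) / rate x) l \<partial>\<Lambda>)
    = (\<Sum>e\<in>E. of_nat (j e) * (\<integral>\<^sup>+l. of_nat (loop_edges e l) \<partial>\<Lambda>))
      + (\<Sum>x\<in>UNIV. ennreal (2 * real (m x) / rate x) * (\<integral>\<^sup>+l. ennreal (loop_time x l) \<partial>\<Lambda>))"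
    unfolding loop_functional_def
    by (subst nn_integral_add, measurable) (simp add: nn_integral_sum nn_integral_cmult)
  also have "\<dots> = (\<Sum>e\<in>E. of_nat (j e) * edge_jumps \<Lambda> e) + (\<Sum>x\<in>UNIV. of_nat (m x) * (2 * occupation C \<kappa> \<Lambda> x))"
    unfolding occ by (simp add: edge_jumps_eq[OF sets])
  finally show ?thesis by (simp only: nexp_add nexp_sum nexp_of_nat_mult)
qed

text \<open>Both laws are carried by the cube and their moments are the same ratio of
  determinants.\<close>

lemma law_loop_ensemble:
  fixes M :: "'w measure"
  assumes L: "loop_ensemble M E C \<kappa> (1/2) L"
  defines "Z \<equiv> \<lambda>\<omega>. field_code E (\<lambda>e. nexp (edge_jumps (L \<omega>) e)) (\<lambda>x. nexp (2 * occupation C \<kappa> (L \<omega>) x))"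
  shows "Z \<in> M \<rightarrow>\<^sub>M borel" and "distr M borel Z = network_field_law"
proof -
  let ?P = "transition C \<kappa>"
  let ?\<nu> = "scale_measure (ennreal (1/2)) (loop_measure E ?P)"
  interpret poisson_random_measure M ?\<nu> L
    using L by unfold_locales (simp add: loop_ensemble_def)
  have sets: "sets (L \<omega>) = sets (loop_measure E ?P)" if "\<omega> \<in> space M" for \<omega>
    using sets_\<Phi>[OF that] by simp
  note meas = borel_measurable_nn_integral_random_measure[of M L ?\<nu>, OF sets_\<Phi> measurable_\<Phi>]
  have [measurable]: "(\<lambda>\<omega>. \<integral>\<^sup>+l. ennreal (loop_time x l) \<partial>L \<omega>) \<in> borel_measurable M" for x
    by (rule meas) (auto simp: measurable_cong_sets[OF sets_scale_measure refl])
  have "(\<lambda>\<omega>. edge_jumps (L \<omega>) e) \<in> borel_measurable M" if "e \<in> E" for e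
  proof -
    have "(\<lambda>\<omega>. \<integral>\<^sup>+l. of_nat (loop_edges e l) \<partial>L \<omega>) \<in> borel_measurable M"
      by (rule meas) (auto simp: measurable_cong_sets[OF sets_scale_measure refl])
    then show ?thesis using edge_jumps_eq[OF sets that] by (simp cong: measurable_cong)
  qed
  then show Z: "Z \<in> M \<rightarrow>\<^sub>M borel"
    unfolding Z_def occupation_def by (intro measurable_field_code) auto
  have box: "Z \<omega> \<in> cbox 0 1" for \<omega> unfolding Z_def by (rule field_code_mem_cbox) auto
  interpret D: prob_space "distr M borel Z" using Z by (rule prob_space_distr)
  have T: "prob_space network_field_law" by (rule prob_spaceI) (rule emeasure_space_network_field_law)
  interpret T: prob_space network_field_law by (rule T)
  show "distr M borel Z = network_field_law"
  proof (rule measure_eqI_moments[where K="cbox 0 1"])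
    show "AE z in distr M borel Z. z \<in> cbox 0 1" using Z box by (subst AE_distr_iff) auto
    fix j :: "'v set + 'v \<Rightarrow> nat"
    let ?v = "sqrt det0 / sqrt (det (precision (\<lambda>e. exp (- real (j (Inl e)))) (\<lambda>x. rate x + 2 * real (j (Inr x)))))"
    have "(\<integral>z. (\<Prod>i\<in>UNIV. z $ i ^ j i) \<partial>distr M borel Z) = (\<integral>\<omega>. (\<Prod>i\<in>UNIV. Z \<omega> $ i ^ j i) \<partial>M)"
      using Z by (subst integral_distr) auto
    also have "\<dots> = (\<integral>\<omega>. nexp (\<integral>\<^sup>+l. loop_functional E (\<lambda>e. j (Inl e)) (\<lambda>x. 2 * real (j (Inr x)) / rate x) l \<partial>L \<omega>) \<partial>M)"
      unfolding Z_def moment_field_code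
      by (intro Bochner_Integration.integral_cong refl) (rule nexp_loop_functional_ensemble[OF sets, symmetric])
    also have "\<dots> = ?v" by (rule expectation_loop_functional[OF L])
    also have "?v = enn2real (\<integral>\<^sup>+z. ennreal (\<Prod>i\<in>UNIV. z $ i ^ j i) \<partial>network_field_law)"
    proof -
      have "0 < det (precision (\<lambda>e. exp (- real (j (Inl e)))) (\<lambda>x. rate x + 2 * real (j (Inr x))))"
        by (rule det_precision_pos) auto
      then show ?thesis unfolding moments_network_field_law using det0_pos by simp
    qed
    also have "\<dots> = (\<integral>z. (\<Prod>i\<in>UNIV. z $ i ^ j i) \<partial>network_field_law)"
    proof (rule integral_eq_nn_integral[symmetric])
      show "AE z in network_field_law. 0 \<le> (\<Prod>i\<in>UNIV. z $ i ^ j i)"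
        using AE_network_field_law by eventually_elim (auto simp: mem_box_cart intro!: prod_nonneg zero_le_power)
      show "(\<lambda>z. \<Prod>i\<in>UNIV. z $ i ^ j i) \<in> borel_measurable network_field_law"
        by (simp add: measurable_cong_sets[OF sets_network_field_law refl])
    qed
    finally show "(\<integral>z. (\<Prod>i\<in>UNIV. z $ i ^ j i) \<partial>distr M borel Z) = (\<integral>z. (\<Prod>i\<in>UNIV. z $ i ^ j i) \<partial>network_field_law)" .
  qed (auto simp: sets_network_field_law AE_network_field_law D.finite_measure_axioms T.finite_measure_axioms)
qed

section \<open>Reading the two events off the joint law\<close>

lemma even_network_restrict:
  assumes "even_network E k"
  shows "restrict k E \<in> even_networks E"
proof -
  have "degree_at E (restrict k E) x = degree_at E k x" for x
    unfolding degree_at_def by (intro sum.cong) auto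
  then show ?thesis
    using assms by (auto simp: even_networks_def even_network_def degree_at_neighbours[OF simple])
qed

text \<open>Agreement with \<open>k\<close> on the edges singles out one extensional representative,
  whatever values \<open>k\<close> has elsewhere.\<close>

lemma nn_integral_even_networks_eq:
  assumes "even_network E k"
  shows "(\<integral>\<^sup>+k'. h k' * (if \<forall>e\<in>E. k' e = k e then 1 else 0) \<partial>networks) = h (restrict k E)"
proof -
  have "(\<integral>\<^sup>+k'. h k' * (if \<forall>e\<in>E. k' e = k e then 1 else 0) \<partial>networks)
    = (\<integral>\<^sup>+k'. h (restrict k E) * indicator {restrict k E} k' \<partial>networks)"
  proof (rule nn_integral_cong)
    fix k' assume "k' \<in> space (networks)"
    then have "k' \<in> extensional E" by (auto simp: even_networks_def PiE_def)
    then have "(\<forall>e\<in>E. k' e = k e) \<longleftrightarrow> k' = restrict k E"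
      by (auto intro: extensionalityI[of _ E] split: if_splits)
    then show "h k' * (if \<forall>e\<in>E. k' e = k e then 1 else 0) = h (restrict k E) * indicator {restrict k E} k'"
      by (auto simp: indicator_def)
  qed
  also have "\<dots> = h (restrict k E)"
    using even_network_restrict[OF assms] by (subst nn_integral_cmult) auto
  finally show ?thesis .
qed

lemma nexp_eq_network_iff: "nexp u = exp (- real n) \<longleftrightarrow> u = of_nat n"
  by (simp add: nexp_eq_exp_iff ennreal_of_nat_eq_real_of_nat)

lemma emeasure_network:
  fixes M :: "'w measure"
  assumes L: "loop_ensemble M E C \<kappa> (1/2) L" and k: "even_network E k"
  shows "emeasure M {\<omega>\<in>space M. \<forall>e\<in>E. edge_jumps (L \<omega>) e = of_nat (k e)}
    = (\<integral>\<^sup>+\<rho>. joint_dens k \<rho> \<partial>lborel)"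
proof -
  note law = law_loop_ensemble[OF L]
  \<comment> \<open>The event in coded form; since \<open>nexp\<close> is injective, a coordinate
    determines the count exactly.\<close>
  let ?B = "{z :: real^('v set + 'v). \<forall>e\<in>E. z $ Inl e = exp (- real (k e))}"
  have "{z \<in> space (borel :: (real^('v set + 'v)) measure). \<forall>e\<in>E. z $ Inl e = exp (- real (k e))} \<in> sets borel"
    by measurable
  then have B: "?B \<in> sets borel" by simp
  have "emeasure M {\<omega>\<in>space M. \<forall>e\<in>E. edge_jumps (L \<omega>) e = of_nat (k e)} = emeasure network_field_law ?B"
    unfolding law(2)[symmetric] using law(1) B
    by (subst emeasure_distr) (auto intro!: arg_cong[where f="emeasure M"] simp: nexp_eq_network_iff)
  also have "\<dots> = (\<integral>\<^sup>+z. indicator ?B z \<partial>network_field_law)"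
    using B by (simp add: sets_network_field_law)
  also have "\<dots> = (\<integral>\<^sup>+k'. (\<integral>\<^sup>+\<rho>. joint_dens k' \<rho> \<partial>lborel) *
      (if \<forall>e\<in>E. k' e = k e then 1 else 0) \<partial>networks)"
    using B by (subst nn_integral_network_field_law) (auto intro!: nn_integral_cong simp: indicator_def)
  also have "\<dots> = (\<integral>\<^sup>+\<rho>. joint_dens (restrict k E) \<rho> \<partial>lborel)"
    by (rule nn_integral_even_networks_eq[OF k])
  finally show ?thesis by (simp add: dens_cong[of "restrict k E" k])
qed

lemma emeasure_network_field:
  fixes M :: "'w measure"
  assumes L: "loop_ensemble M E C \<kappa> (1/2) L" and k: "even_network E k" and A [measurable]: "A \<in> sets borel"
  shows "emeasure M {\<omega>\<in>space M. (\<forall>e\<in>E. edge_jumps (L \<omega>) e = of_nat (k e)) \<and>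
      (\<exists>\<rho>\<in>A. \<forall>x. 0 \<le> \<rho> $ x \<and> 2 * occupation C \<kappa> (L \<omega>) x = ennreal (\<rho> $ x))}
    = (\<integral>\<^sup>+\<rho>\<in>A \<inter> nonneg_vec. ennreal (dens k \<rho>) \<partial>lborel)"
proof -
  note law = law_loop_ensemble[OF L]
  let ?ln = "\<lambda>z :: real^('v set + 'v). (\<chi> x. - ln (z $ Inr x)) :: real^'v"
  let ?B = "{z :: real^('v set + 'v). (\<forall>e\<in>E. z $ Inl e = exp (- real (k e))) \<and> (\<forall>x. 0 < z $ Inr x) \<and> ?ln z \<in> A}"
  have "{z \<in> space (borel :: (real^('v set + 'v)) measure).
      (\<forall>e\<in>E. z $ Inl e = exp (- real (k e))) \<and> (\<forall>x. 0 < z $ Inr x) \<and> ?ln z \<in> A} \<in> sets borel"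
    by measurable
  then have B: "?B \<in> sets borel" by simp
  \<comment> \<open>The code is inverted by \<open>- ln\<close>; positivity of the coordinates
    expresses that the field is finite, which must be stated because \<open>nexp\<close> sends
    \<infinity> to 0.\<close>
  have occ: "(\<exists>\<rho>\<in>A. \<forall>x. 0 \<le> \<rho> $ x \<and> u x = ennreal (\<rho> $ x)) \<longleftrightarrow> (\<forall>x. 0 < nexp (u x)) \<and> (\<chi> x. - ln (nexp (u x))) \<in> A" for u
  proof
    assume "\<exists>\<rho>\<in>A. \<forall>x. 0 \<le> \<rho> $ x \<and> u x = ennreal (\<rho> $ x)"
    then obtain \<rho> where \<rho>: "\<rho> \<in> A" "\<And>x. 0 \<le> \<rho> $ x" "\<And>x. u x = ennreal (\<rho> $ x)" by blast
    then have "nexp (u x) = exp (- (\<rho> $ x))" for x by (simp add: nexp_ennreal)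
    then show "(\<forall>x. 0 < nexp (u x)) \<and> (\<chi> x. - ln (nexp (u x))) \<in> A" using \<rho>(1) by simp
  next
    assume r: "(\<forall>x. 0 < nexp (u x)) \<and> (\<chi> x. - ln (nexp (u x))) \<in> A"
    show "\<exists>\<rho>\<in>A. \<forall>x. 0 \<le> \<rho> $ x \<and> u x = ennreal (\<rho> $ x)"
    proof (rule bexI[of _ "\<chi> x. - ln (nexp (u x))"], rule allI)
      fix x
      have "0 < nexp (u x)" "nexp (u x) \<le> 1" using r by auto
      then have 0: "0 \<le> - ln (nexp (u x))" by simp
      moreover have "u x = ennreal (- ln (nexp (u x)))"
        using nexp_eq_exp_iff[OF 0, of "u x"] \<open>0 < nexp (u x)\<close> by simp
      ultimately show "0 \<le> (\<chi> x. - ln (nexp (u x))) $ x \<and> u x = ennreal ((\<chi> x. - ln (nexp (u x))) $ x)" by simp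
    qed (use r in simp)
  qed
  have "emeasure M {\<omega>\<in>space M. (\<forall>e\<in>E. edge_jumps (L \<omega>) e = of_nat (k e)) \<and>
      (\<exists>\<rho>\<in>A. \<forall>x. 0 \<le> \<rho> $ x \<and> 2 * occupation C \<kappa> (L \<omega>) x = ennreal (\<rho> $ x))} = emeasure network_field_law ?B"
    unfolding law(2)[symmetric] occ using law(1) B
    by (subst emeasure_distr) (auto intro!: arg_cong[where f="emeasure M"] simp: nexp_eq_network_iff)
  also have "\<dots> = (\<integral>\<^sup>+z. indicator ?B z \<partial>network_field_law)"
    using B by (simp add: sets_network_field_law)
  also have "\<dots> = (\<integral>\<^sup>+k'. (\<integral>\<^sup>+\<rho>\<in>A \<inter> nonneg_vec. ennreal (dens k' \<rho>) \<partial>lborel) *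
      (if \<forall>e\<in>E. k' e = k e then 1 else 0) \<partial>networks)"
  proof (subst nn_integral_network_field_law)
    have code: "indicator ?B (encode k' \<rho>)
      = (if \<forall>e\<in>E. k' e = k e then 1 else 0) * (indicator A \<rho> :: ennreal)" for k' \<rho>
      by (auto simp: indicator_def)
    show "(\<integral>\<^sup>+k'. (\<integral>\<^sup>+\<rho>. joint_dens k' \<rho> *
        indicator ?B (encode k' \<rho>) \<partial>lborel) \<partial>networks)
      = (\<integral>\<^sup>+k'. (\<integral>\<^sup>+\<rho>\<in>A \<inter> nonneg_vec. ennreal (dens k' \<rho>) \<partial>lborel) *
        (if \<forall>e\<in>E. k' e = k e then 1 else 0) \<partial>networks)"
      unfolding code
      by (intro nn_integral_cong, subst nn_integral_multc[symmetric])
        (auto intro!: nn_integral_cong simp: indicator_inter_arith mult_ac)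
  qed (use B in simp)
  also have "\<dots> = (\<integral>\<^sup>+\<rho>\<in>A \<inter> nonneg_vec. ennreal (dens (restrict k E) \<rho>) \<partial>lborel)"
    by (rule nn_integral_even_networks_eq[OF k])
  finally show ?thesis by (simp add: dens_cong[of "restrict k E" k])
qed

text \<open>The even moments of a centred Gaussian of variance \<open>1 / a\<close>; this is the
  origin of the factors \<open>(2 n)! / (2 ^ n * n!)\<close> in the first formula.\<close>

lemma nn_integral_gaussian_moment:
  assumes "0 < a"
  shows "(\<integral>\<^sup>+t. ennreal (\<bar>t\<bar> ^ (2 * n) * exp (- (1/2) * (a * t\<^sup>2))) \<partial>lborel)
    = ennreal (sqrt (2 * pi) / sqrt a * (fact (2 * n) / (2 ^ n * fact n)) * (1 / a) ^ n)"
proof -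
  let ?\<sigma> = "1 / sqrt a"
  have eq: "\<bar>t\<bar> ^ (2 * n) * exp (- (1/2) * (a * t\<^sup>2)) = sqrt (2 * pi) / sqrt a * (normal_density 0 ?\<sigma> t * (t - 0) ^ (2 * n))" for t
    using assms by (simp add: normal_density_def power_even_abs power_divide real_sqrt_divide field_simps)
  have "(\<integral>\<^sup>+t. ennreal (\<bar>t\<bar> ^ (2 * n) * exp (- (1/2) * (a * t\<^sup>2))) \<partial>lborel)
    = (\<integral>\<^sup>+t. ennreal (sqrt (2 * pi) / sqrt a) * ennreal (normal_density 0 ?\<sigma> t * (t - 0) ^ (2 * n)) \<partial>lborel)"
    unfolding eq using assms by (intro nn_integral_cong ennreal_mult') auto
  also have "\<dots> = ennreal (sqrt (2 * pi) / sqrt a) * ennreal (fact (2 * n) / ((2 / ?\<sigma>\<^sup>2) ^ n * fact n))"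
  proof (subst nn_integral_cmult)
    have "has_bochner_integral lborel (\<lambda>t. normal_density 0 ?\<sigma> t * (t - 0) ^ (2 * n)) (fact (2 * n) / ((2 / ?\<sigma>\<^sup>2) ^ n * fact n))"
      using assms by (intro normal_moment_even) simp
    from has_bochner_integral_integrable[OF has_bochner_integral_iff[THEN iffD1, THEN conjunct1, OF this]] this
    show "ennreal (sqrt (2 * pi) / sqrt a) * (\<integral>\<^sup>+t. ennreal (normal_density 0 ?\<sigma> t * (t - 0) ^ (2 * n)) \<partial>lborel)
      = ennreal (sqrt (2 * pi) / sqrt a) * ennreal (fact (2 * n) / ((2 / ?\<sigma>\<^sup>2) ^ n * fact n))"
      by (subst nn_integral_eq_integral) (auto simp: has_bochner_integral_iff)
  qed measurable
  also have "\<dots> = ennreal (sqrt (2 * pi) / sqrt a * (fact (2 * n) / ((2 / ?\<sigma>\<^sup>2) ^ n * fact n)))"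
    using assms by (intro ennreal_mult'[symmetric]) auto
  also have "fact (2 * n) / ((2 / ?\<sigma>\<^sup>2) ^ n * fact n) = fact (2 * n) / (2 ^ n * fact n) * (1 / a) ^ n"
    using assms by (simp add: power_divide power_mult_distrib)
  finally show ?thesis by (simp only: mult.assoc)
qed

lemma degree_at_half_degree:
  assumes "even_network E k"
  shows "degree_at E k x = 2 * half_degree E k x"
  using assms by (simp add: degree_at_neighbours[OF simple] half_degree_def even_network_def)

abbreviation edge_transition :: "'v set \<Rightarrow> real" where
  "edge_transition \<equiv> unord (\<lambda>x y. sqrt (transition C \<kappa> $ x $ y * transition C \<kappa> $ y $ x))"

abbreviation network_prob :: "('v set \<Rightarrow> nat) \<Rightarrow> real" where
  "network_prob k \<equiv> sqrt (det (mat 1 - transition C \<kappa>))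
       * ((\<Prod>x\<in>UNIV. fact (2 * half_degree E k x))
           / ((\<Prod>x\<in>UNIV. 2 ^ half_degree E k x * fact (half_degree E k x)) * (\<Prod>e\<in>E. fact (k e))))
       * (\<Prod>e\<in>E. edge_transition e ^ k e)"

text \<open>By symmetry of \<open>C\<close> the product of the two transition probabilities is a
  square divided by the two rates, which distributes the rates evenly over the endpoints.\<close>

lemma edge_transition_eq:
  assumes "e \<in> E"
  shows "edge_transition e = cond e * (\<Prod>x\<in>e. 1 / sqrt (rate x))"
proof -
  obtain x y where e: "e = {x, y}" "x \<noteq> y" using edgeE[OF assms] .
  have "edge_transition {x, y} = sqrt (transition C \<kappa> $ x $ y * transition C \<kappa> $ y $ x)"
    by (rule unord_eq) (simp add: mult.commute)
  also have "transition C \<kappa> $ x $ y * transition C \<kappa> $ y $ x = (C x y)\<^sup>2 / (rate x * rate y)"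
    by (simp add: transition_def C_sym[of y x] power2_eq_square)
  finally show ?thesis using e C_nonneg[of x y] by (simp add: cond_eq real_sqrt_divide real_sqrt_mult)
qed

lemma network_prob_nonneg: "0 \<le> network_prob k"
proof -
  have "0 < (\<Prod>x\<in>UNIV. rate x)" using rate_pos by (intro prod_pos) auto
  then have "0 < det (mat 1 - transition C \<kappa>)"
    using det0_pos by (simp add: det_transition zero_less_mult_iff)
  moreover have "0 \<le> edge_transition e" if "e \<in> E" for e
    using that cond_nonneg rate_pos by (auto simp: edge_transition_eq less_imp_le intro!: mult_nonneg_nonneg prod_nonneg)
  ultimately show ?thesis by (auto intro!: mult_nonneg_nonneg divide_nonneg_nonneg prod_nonneg)
qed

text \<open>For fixed \<open>k\<close> the network term factorises over the vertices with the
  exponent \<open>2 * half_degree\<close>, so the integral is a product of even Gaussian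
  moments.\<close>

lemma total_mass_dens:
  assumes k: "even_network E k"
  shows "(\<integral>\<^sup>+\<rho>. joint_dens k \<rho> \<partial>lborel)
    = ennreal (network_prob k)"
proof -
  let ?h = "half_degree E k"
  let ?b = "\<Prod>e\<in>E. cond e ^ k e / fact (k e)"
  have b0: "0 \<le> ?b" using cond_nonneg by (intro prod_nonneg) auto
  have nw: "network_weight cond k \<phi> = ?b * (\<Prod>x\<in>UNIV. \<bar>\<phi> $ x\<bar> ^ (2 * ?h x))" for \<phi>
    using prod_edges_vertices[of "\<lambda>x. \<bar>\<phi> $ x\<bar>" k E]
    by (simp add: network_weight_def power_mult_distrib prod.distrib prod_dividef degree_at_half_degree[OF k])
  have "(\<integral>\<^sup>+\<rho>. joint_dens k \<rho> \<partial>lborel)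
    = ennreal (sqrt det0 / sqrt (2 * pi) ^ CARD('v)) * (\<integral>\<^sup>+\<phi>. ennreal (network_weight cond k \<phi>)
      * ennreal (exp (- (1/2) * (\<Sum>x\<in>UNIV. rate x * (\<phi> $ x)\<^sup>2))) \<partial>lborel)"
    using nn_integral_dens[of k "\<lambda>_. 0"] by simp
  also have "(\<integral>\<^sup>+\<phi>. ennreal (network_weight cond k \<phi>)
      * ennreal (exp (- (1/2) * (\<Sum>x\<in>UNIV. rate x * (\<phi> $ x)\<^sup>2))) \<partial>lborel)
    = (\<integral>\<^sup>+\<phi>. ennreal ?b * (\<Prod>x\<in>UNIV. ennreal (\<bar>\<phi> $ x\<bar> ^ (2 * ?h x) * exp (- (1/2) * (rate x * (\<phi> $ x)\<^sup>2)))) \<partial>lborel)"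
    unfolding nw using b0
    by (intro nn_integral_cong)
      (simp add: prod_ennreal prod.distrib exp_sum sum_distrib_left sum_negf[symmetric] ennreal_mult' prod_nonneg mult.assoc)
  also have "\<dots> = ennreal ?b * (\<Prod>x\<in>UNIV. \<integral>\<^sup>+t. ennreal (\<bar>t\<bar> ^ (2 * ?h x) * exp (- (1/2) * (rate x * t\<^sup>2))) \<partial>lborel)"
    by (subst nn_integral_cmult, measurable, subst nn_integral_lborel_vec_prod) auto
  also have "(\<Prod>x\<in>UNIV. \<integral>\<^sup>+t. ennreal (\<bar>t\<bar> ^ (2 * ?h x) * exp (- (1/2) * (rate x * t\<^sup>2))) \<partial>lborel)
    = ennreal (\<Prod>x\<in>UNIV. sqrt (2 * pi) / sqrt (rate x) * (fact (2 * ?h x) / (2 ^ ?h x * fact (?h x))) * (1 / rate x) ^ ?h x)"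
    unfolding nn_integral_gaussian_moment[OF rate_pos] using rate_pos
    by (intro prod_ennreal) (auto simp: less_imp_le)
  also have "(\<Prod>x\<in>UNIV. sqrt (2 * pi) / sqrt (rate x) * (fact (2 * ?h x) / (2 ^ ?h x * fact (?h x))) * (1 / rate x) ^ ?h x)
    = sqrt (2 * pi) ^ CARD('v) / sqrt (\<Prod>x\<in>UNIV. rate x) *
      ((\<Prod>x\<in>UNIV. fact (2 * ?h x)) / (\<Prod>x\<in>UNIV. 2 ^ ?h x * fact (?h x))) * (\<Prod>x\<in>UNIV. (1 / rate x) ^ ?h x)"
  proof -
    have "sqrt (\<Prod>x\<in>I. rate x) = (\<Prod>x\<in>I. sqrt (rate x))" for I
      by (induction I rule: infinite_finite_induct) (auto simp: real_sqrt_mult)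
    then show ?thesis by (simp add: prod.distrib prod_dividef)
  qed
  \<comment> \<open>The exponent of \<open>1 / sqrt (rate x)\<close> is the full degree, twice
    \<open>half_degree\<close>; the vertex powers are returned to the edges to combine with the
    conductances.\<close>
  also have "(\<Prod>x\<in>UNIV. (1 / rate x) ^ ?h x) = (\<Prod>e\<in>E. (\<Prod>x\<in>e. 1 / sqrt (rate x)) ^ k e)"
    unfolding prod_edges_vertices degree_at_half_degree[OF k]
    by (intro prod.cong refl) (use rate_pos in \<open>simp add: power_mult power_divide less_imp_le\<close>)
  finally have val: "(\<integral>\<^sup>+\<rho>. joint_dens k \<rho> \<partial>lborel) =
    ennreal (sqrt det0 / sqrt (2 * pi) ^ CARD('v)) * (ennreal ?b * ennreal (sqrt (2 * pi) ^ CARD('v) / sqrt (\<Prod>x\<in>UNIV. rate x) *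
      ((\<Prod>x\<in>UNIV. fact (2 * ?h x)) / (\<Prod>x\<in>UNIV. 2 ^ ?h x * fact (?h x))) * (\<Prod>e\<in>E. (\<Prod>x\<in>e. 1 / sqrt (rate x)) ^ k e)))" .
  have fin: "sqrt det0 / sqrt (2 * pi) ^ CARD('v) * (?b * (sqrt (2 * pi) ^ CARD('v) / sqrt (\<Prod>x\<in>UNIV. rate x) *
      ((\<Prod>x\<in>UNIV. fact (2 * ?h x)) / (\<Prod>x\<in>UNIV. 2 ^ ?h x * fact (?h x))) * (\<Prod>e\<in>E. (\<Prod>x\<in>e. 1 / sqrt (rate x)) ^ k e)))
    = network_prob k"
  proof -
    have "0 < (\<Prod>x\<in>UNIV. rate x)" using rate_pos by (intro prod_pos) auto
    \<comment> \<open>The product of the rates in \<open>det0\<close> cancels the Gaussian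
      normalisations, leaving the determinant of
      \<open>mat 1 - transition C \<kappa>\<close>.\<close>
    then have "sqrt det0 = sqrt (\<Prod>x\<in>UNIV. rate x) * sqrt (det (mat 1 - transition C \<kappa>))" "sqrt (\<Prod>x\<in>UNIV. rate x) \<noteq> 0"
      by (auto simp: det_transition real_sqrt_mult simp del: prod_zero_iff)
    moreover have "(\<Prod>e\<in>E. edge_transition e ^ k e)
      = (\<Prod>e\<in>E. cond e ^ k e) * (\<Prod>e\<in>E. (\<Prod>x\<in>e. 1 / sqrt (rate x)) ^ k e)"
      by (simp add: edge_transition_eq power_mult_distrib prod.distrib[symmetric])
    moreover have "sqrt (2 * pi) ^ CARD('v) \<noteq> 0" by simp
    ultimately show ?thesis unfolding prod_dividef by (simp add: mult_ac)
  qed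
  have "ennreal a * (ennreal b * ennreal c) = ennreal (a * (b * c))" if "0 \<le> a" "0 \<le> b" for a b c
    using that by (simp add: ennreal_mult')
  then show ?thesis unfolding val fin[symmetric] using b0 det0_pos by simp
qed

lemma measure_network:
  assumes "loop_ensemble M E C \<kappa> (1/2) L" and "even_network E k"
  shows "measure M {\<omega>\<in>space M. \<forall>e\<in>E. edge_jumps (L \<omega>) e = of_nat (k e)} = network_prob k"
  by (rule measure_eq_emeasure_eq_ennreal[OF network_prob_nonneg])
    (simp only: emeasure_network[OF assms] total_mass_dens[OF assms(2)])

end

text \<open>The infinitesimal statement is expressed as an equality for every Borel set
  \<open>A\<close> of field values, with \<open>\<rho>\<close> standing for
  \<open>2 * occupation\<close> in the chosen normalisation. Zero field values are included, but
  they form a null set.\<close>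

theorem proposition3p2:
  fixes E :: "'v::finite set set"
    and C :: "'v \<Rightarrow> 'v \<Rightarrow> real" and \<kappa> :: "'v \<Rightarrow> real"
    and M :: "'w measure" and L :: "'w \<Rightarrow> ('v \<times> real) list set measure"
  assumes "simple_graph E" and "connected_graph E"
    and "\<And>x y. C x y = C y x" and "\<And>x y. 0 \<le> C x y" and "\<And>x y. {x, y} \<notin> E \<Longrightarrow> C x y = 0"
    and "\<And>x. 0 \<le> \<kappa> x"
    and "\<And>f. f \<noteq> (\<lambda>_. 0) \<Longrightarrow> 0 < energy C \<kappa> f"
    and "loop_ensemble M E C \<kappa> (1/2) L"
  shows "(\<forall>k. even_network E k \<longrightarrow>
         measure M {\<omega>\<in>space M. \<forall>e\<in>E. edge_jumps (L \<omega>) e = of_nat (k e)} =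
           sqrt (det (mat 1 - transition C \<kappa>))
           * ((\<Prod>x\<in>UNIV. fact (2 * half_degree E k x))
               / ((\<Prod>x\<in>UNIV. 2 ^ half_degree E k x * fact (half_degree E k x)) * (\<Prod>e\<in>E. fact (k e))))
           * (\<Prod>e\<in>E. unord (\<lambda>x y. sqrt (transition C \<kappa> $ x $ y * transition C \<kappa> $ y $ x)) e ^ k e))
       \<and> (\<forall>k. even_network E k \<longrightarrow> (\<forall>A\<in>sets (borel :: (real^'v) measure).
           emeasure M {\<omega>\<in>space M. (\<forall>e\<in>E. edge_jumps (L \<omega>) e = of_nat (k e)) \<and>
               (\<exists>\<rho>\<in>A. \<forall>x. 0 \<le> \<rho> $ x \<and> 2 * occupation C \<kappa> (L \<omega>) x = ennreal (\<rho> $ x))} =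
           (\<integral>\<^sup>+ \<rho> \<in> A \<inter> {\<rho>. \<forall>x. 0 \<le> \<rho> $ x}.
              ennreal (1 / sqrt (det (green C \<kappa>))
                * (\<Prod>e\<in>E. unord (\<lambda>x y. sqrt (\<rho> $ x) * C x y * sqrt (\<rho> $ y)) e ^ k e / fact (k e))
                * (\<Prod>x\<in>UNIV. 1 / sqrt (2 * pi * \<rho> $ x) * exp (- 1/2 * total_rate C \<kappa> x * \<rho> $ x)))
            \<partial>lborel)))"
proof -
  interpret killed_network E C \<kappa>
    using assms(1,3,4,5,7) by unfold_locales
  show ?thesis
    using measure_network[OF assms(8)] emeasure_network_field[OF assms(8)] unfolding dens_def by blast
qed

end
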